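(* Let $k\in\mathbb N$, let $\boldsymbol\alpha=(\alpha_{ij\ell})\in\mathbb R^{k\times k\times k}$ be symmetric under permutations of its indices and $\mathbf h=(h_{ij})\in\mathbb R^{k\times k}$ be symmetric. Suppose that $\boldsymbol\alpha\ge0$, i.e. $\alpha_{ij\ell}\ge0$ for all $i,j,\ell\in[k]$. Let $$\mathsf C_{\mathrm{sym}}=\{C=(c_{ij})_{i,j\in[k]}\in[0,1]^{k\times k}:c_{ij}=c_{ji}\ \forall i,j\in[k]\},$$ and for $C\in\mathsf C_{\mathrm{sym}}$ let $g_C(x,y)=\sum_{i,j=1}^kc_{ij}\mathbf 1_{\mathcal B_i}(x)\mathbf 1_{\mathcal B_j}(y)$, $(x,y)\in[0,1]^2$. Then: 1. Every maximizer $\widetilde g^\star\in\widetilde{\mathcal W}^{(k)}_{\mathcal B}$ of the variational problem $\sup_{\widetilde g\in\widetilde{\mathcal W}^{(k)}_{\mathcal B}}\{U^{(\mathcal B)}_{\boldsymbol\alpha,\mathbf h}(\widetilde g)-\frac12\mathcal I^{(\mathcal B)}(\widetilde g)\}$ admits a representative of the form $(g_C,\mathcal B^{(k)})$ with $C\in\mathsf C_{\mathrm{sym}}$. In particular, this supremum equals $$\sup_{C\in\mathsf C_{\mathrm{sym}}}\Bigl\{\frac16\sum_{i,j,\ell=1}^k\alpha_{ij\ell}\,t^{(\mathcal B)}_{ij\ell}(H_2,g_C)+\frac12\sum_{i,j=1}^kh_{ij}\,t^{(\mathcal B)}_{ij}(H_1,g_C)-\frac12\mathcal I^{(\mathcal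 B)}(g_C)\Bigr\}.\qquad(\ast)$$ 2. There exists at least one maximizer $C^\star\in\mathsf C_{\mathrm{sym}}$ of $(\ast)$. 3. Any maximizer $C^\star=(c^\star_{ij})_{i,j\in[k]}$ of $(\ast)$ satisfies, for all $i,j\in[k]$, $$c^\star_{ij}=\frac{\exp\bigl(h_{ij}+\sum_{\ell=1}^kb_\ell\,c^\star_{i\ell}c^\star_{j\ell}\,\alpha_{ij\ell}\bigr)}{1+\exp\bigl(h_{ij}+\sum_{\ell=1}^kb_\ell\,c^\star_{i\ell}c^\star_{j\ell}\,\alpha_{ij\ell}\bigr)}.$$
   Context: Fix $k\in\mathbb N$ and $b_1,\dots,b_k>0$ with $\sum_i b_i=1$. $\mathcal B^{(k)}=(\mathcal B_1,\dots,\mathcal B_k)$ is the partition of $[0,1]$ into consecutive intervals with Lebesgue measure $\lambda(\mathcal B_i)=b_i$. Colored graphons. $\mathcal W$ is the set of measurable symmetric functions $g:[0,1]^2\to[0,1]$ (graphons), and $\mathcal W^{(k)}_{\mathcal B}=\mathcal W\times\{\mathcal B^{(k)}\}$. Set $$d^{(k)}_\square\bigl((g_1,\mathcal B^{(k)}),(g_2,\mathcal B^{(k)})\bigr)=\sup_{C,D\subseteq[0,1]}\sum_{i,j\in[k]}\Bigl|\int_{C\times D}\mathbf 1_{\mathcal B_i\times\mathcal B_j}(x,y)(g_1-g_2)(x,y)\,dx\,dy\Bigr|$$ (sup over measurable sets). $\Sigma_{\mathcal B}$ is the set of measure-preserving maps $\sigma:[0,1]\to[0,1]$ with $\lambda(\sigma^{-1}(\mathcal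 B_i)\triangle\mathcal B_i)=0$ for all $i\in[k]$; $g^\sigma(x,y)=g(\sigma(x),\sigma(y))$. Set $\delta^{(k)}_\square(g_1,g_2)=\inf_{\sigma\in\Sigma_{\mathcal B}}d^{(k)}_\square((g_1,\mathcal B^{(k)}),(g_2^\sigma,\mathcal B^{(k)}))$. $\widetilde{\mathcal W}^{(k)}_{\mathcal B}$ is the quotient of $\mathcal W^{(k)}_{\mathcal B}$ obtained by identifying colored graphons at $\delta^{(k)}_\square$-distance $0$ (in particular $(g,\mathcal B^{(k)})$ and $(g^\sigma,\mathcal B^{(k)})$ are identified for $\sigma\in\Sigma_{\mathcal B}$), with metric $\delta^{(k)}_\square$. Functionals. For a finite simple graph $H$ on $[m]$ with edge set $\mathcal E(H)$ and $\boldsymbol\ell\in[k]^m$, $t^{(\mathcal B)}_{\boldsymbol\ell}(H,g)=\int_{\mathcal B_{\ell_1}\times\cdots\times\mathcal B_{\ell_m}}\prod_{\{i,j\}\in\mathcal E(H)}g(x_i,x_j)\,dx_1\cdots dx_m$. $H_1$ is a single edge, $H_2$ a triangle. With $I(u)=u\ln u+(1-u)\ln(1-u)$, $I(0)=I(1)=0$, and $g$ the first component of any representative of $\widetilde g$, $$\mathcal I^{(\mathcal B)}(\widetilde g)=\mathcal I^{(\mathcal B)}(g)=\sum_{i,j\in[k]}\int_{\mathcal B_i\times\mathcal B_j}I(g(x,y))\,dx\,dy,$$ $$U^{(\mathcal B)}_{\boldsymbol\alpha,\mathbf h}(\widetilde g)=\frac16\sum_{i,j,\ell\in[k]}\alpha_{ij\ell}\,t^{(\mathcal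 B)}_{ij\ell}(H_2,g)+\frac12\sum_{i,j\in[k]}h_{ij}\,t^{(\mathcal B)}_{ij}(H_1,g);$$ these do not depend on the representative. *)

theory Defs
  imports "HOL-Analysis.Analysis"
begin

text \<open>
  The index set \<open>[k]\<close> is \<open>{1..k}\<close>; tuples and arrays indexed by \<open>[k]\<close> are functions on \<open>nat\<close>
  of which only the values on \<open>{1..k}\<close> matter. Functions on \<open>[0,1]\<close> and \<open>[0,1]\<^sup>2\<close> are functions on
  \<open>real\<close> of which only the values on the unit interval or square matter. Measurability always
  refers to the Lebesgue sigma-algebra.
\<close>

text \<open>
  No convention is imposed on which of two adjacent intervals owns their common endpoint.
  Disjointness follows from the last conjunct.
\<close>

definition consecutive_intervals :: "nat \<Rightarrow> (nat \<Rightarrow> real) \<Rightarrow> (nat \<Rightarrow> real set) \<Rightarrow> bool" where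
  "consecutive_intervals k b B \<longleftrightarrow>
     (\<forall>i\<in>{1..k}. is_interval (B i) \<and> measure lebesgue (B i) = b i) \<and>
     (\<Union>i\<in>{1..k}. B i) = {0..1} \<and>
     (\<forall>i\<in>{1..k}. \<forall>j\<in>{1..k}. i < j \<longrightarrow> (\<forall>x\<in>B i. \<forall>y\<in>B j. x < y))"

definition graphons :: "(real \<Rightarrow> real \<Rightarrow> real) set" where
  "graphons = {g. (\<lambda>(x, y). g x y) \<in> borel_measurable (lebesgue_on ({0..1} \<times> {0..1})) \<and>
                  (\<forall>x\<in>{0..1}. \<forall>y\<in>{0..1}. g x y \<in> {0..1} \<and> g x y = g y x)}"

type_synonym colored_graphon = "(real \<Rightarrow> real \<Rightarrow> real) \<times> (nat \<Rightarrow> real set)"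

definition colored_graphons :: "(nat \<Rightarrow> real set) \<Rightarrow> colored_graphon set" where
  "colored_graphons B = graphons \<times> {B}"

text \<open>The cut distance of \<open>(g1, B)\<close> and \<open>(g2, B)\<close>:\<close>

definition cut_dist ::
  "nat \<Rightarrow> (nat \<Rightarrow> real set) \<Rightarrow> (real \<Rightarrow> real \<Rightarrow> real) \<Rightarrow> (real \<Rightarrow> real \<Rightarrow> real) \<Rightarrow> real" where
  "cut_dist k B g1 g2 =
     (SUP (C, D) \<in> sets (lebesgue_on {0..1}) \<times> sets (lebesgue_on {0..1}).
        \<Sum>i\<in>{1..k}. \<Sum>j\<in>{1..k}.
          \<bar>LINT p : C \<times> D | lebesgue.
             indicator (B i \<times> B j) p * (g1 (fst p) (snd p) - g2 (fst p) (snd p))\<bar>)"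

definition color_preserving_maps :: "nat \<Rightarrow> (nat \<Rightarrow> real set) \<Rightarrow> (real \<Rightarrow> real) set" where
  "color_preserving_maps k B =
     {\<sigma>. \<sigma> \<in> lebesgue_on {0..1} \<rightarrow>\<^sub>M lebesgue_on {0..1} \<and>
         distr (lebesgue_on {0..1}) (lebesgue_on {0..1}) \<sigma> = lebesgue_on {0..1} \<and>
         (\<forall>i\<in>{1..k}. emeasure lebesgue (sym_diff (\<sigma> -` B i \<inter> {0..1}) (B i)) = 0)}"

definition graphon_pullback ::
  "(real \<Rightarrow> real \<Rightarrow> real) \<Rightarrow> (real \<Rightarrow> real) \<Rightarrow> real \<Rightarrow> real \<Rightarrow> real" where
  "graphon_pullback g \<sigma> = (\<lambda>x y. g (\<sigma> x) (\<sigma> y))"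

definition delta_cut ::
  "nat \<Rightarrow> (nat \<Rightarrow> real set) \<Rightarrow> (real \<Rightarrow> real \<Rightarrow> real) \<Rightarrow> (real \<Rightarrow> real \<Rightarrow> real) \<Rightarrow> real" where
  "delta_cut k B g1 g2 =
     (INF \<sigma> \<in> color_preserving_maps k B. cut_dist k B g1 (graphon_pullback g2 \<sigma>))"

definition delta_cut_rel ::
  "nat \<Rightarrow> (nat \<Rightarrow> real set) \<Rightarrow> (colored_graphon \<times> colored_graphon) set" where
  "delta_cut_rel k B =
     {(G1, G2). G1 \<in> colored_graphons B \<and> G2 \<in> colored_graphons B \<and>
                delta_cut k B (fst G1) (fst G2) = 0}"

definition unlabeled_colored_graphons ::
  "nat \<Rightarrow> (nat \<Rightarrow> real set) \<Rightarrow> colored_graphon set set" where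
  "unlabeled_colored_graphons k B = colored_graphons B // delta_cut_rel k B"

text \<open>
  Value on a class of a functional that does not depend on the choice of the representative:
  evaluate it at the first component of some representative.
\<close>

definition on_class :: "((real \<Rightarrow> real \<Rightarrow> real) \<Rightarrow> real) \<Rightarrow> colored_graphon set \<Rightarrow> real" where
  "on_class f G = f (fst (SOME r. r \<in> G))"

text \<open>
  A graph \<open>(m, E)\<close> has vertices \<open>{..<m}\<close>, and each edge in \<open>E\<close> is a two-element subset of it.
  The color of vertex \<open>v\<close> is the entry \<open>ls ! v\<close> of a list of length \<open>m\<close>. The completed product of
  \<open>m\<close> copies of \<open>lborel\<close> is Lebesgue measure on \<open>m\<close>-dimensional space; without the completion the
  integrand need not be measurable for a merely Lebesgue measurable \<open>g\<close>. As \<open>g\<close> is symmetric,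
  the order in which the two ends of an edge are passed to \<open>g\<close> is irrelevant.
\<close>

definition hom_dens ::
  "(nat \<Rightarrow> real set) \<Rightarrow> nat list \<Rightarrow> nat \<times> nat set set \<Rightarrow> (real \<Rightarrow> real \<Rightarrow> real) \<Rightarrow> real" where
  "hom_dens B ls H g =
     (LINT x : (\<Pi>\<^sub>E v\<in>{..<fst H}. B (ls ! v)) | completion (\<Pi>\<^sub>M v\<in>{..<fst H}. lborel).
        \<Prod>e\<in>snd H. g (x (Min e)) (x (Max e)))"

definition single_edge_graph :: "nat \<times> nat set set" where
  "single_edge_graph = (2, {{0, 1}})"

definition triangle_graph :: "nat \<times> nat set set" where
  "triangle_graph = (3, {{0, 1}, {0, 2}, {1, 2}})"

definition entropy_density :: "real \<Rightarrow> real" where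
  "entropy_density u = (if u = 0 \<or> u = 1 then 0 else u * ln u + (1 - u) * ln (1 - u))"

definition entropy_functional ::
  "nat \<Rightarrow> (nat \<Rightarrow> real set) \<Rightarrow> (real \<Rightarrow> real \<Rightarrow> real) \<Rightarrow> real" where
  "entropy_functional k B g =
     (\<Sum>i\<in>{1..k}. \<Sum>j\<in>{1..k}.
        LINT p : B i \<times> B j | lebesgue. entropy_density (g (fst p) (snd p)))"

definition energy_functional ::
  "nat \<Rightarrow> (nat \<Rightarrow> real set) \<Rightarrow> (nat \<Rightarrow> nat \<Rightarrow> nat \<Rightarrow> real) \<Rightarrow> (nat \<Rightarrow> nat \<Rightarrow> real) \<Rightarrow>
   (real \<Rightarrow> real \<Rightarrow> real) \<Rightarrow> real" where
  "energy_functional k B \<alpha> h g =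
     1 / 6 * (\<Sum>i\<in>{1..k}. \<Sum>j\<in>{1..k}. \<Sum>l\<in>{1..k}. \<alpha> i j l * hom_dens B [i, j, l] triangle_graph g) +
     1 / 2 * (\<Sum>i\<in>{1..k}. \<Sum>j\<in>{1..k}. h i j * hom_dens B [i, j] single_edge_graph g)"

definition C_sym :: "nat \<Rightarrow> (nat \<Rightarrow> nat \<Rightarrow> real) set" where
  "C_sym k = {c. \<forall>i\<in>{1..k}. \<forall>j\<in>{1..k}. c i j \<in> {0..1} \<and> c i j = c j i}"

definition block_graphon ::
  "nat \<Rightarrow> (nat \<Rightarrow> real set) \<Rightarrow> (nat \<Rightarrow> nat \<Rightarrow> real) \<Rightarrow> real \<Rightarrow> real \<Rightarrow> real" where
  "block_graphon k B c = (\<lambda>x y. \<Sum>i\<in>{1..k}. \<Sum>j\<in>{1..k}. c i j * indicator (B i) x * indicator (B j) y)"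

end

theory Submission
  imports Defs "HOL-Probability.Infinite_Product_Measure" "HOL-Real_Asymp.Real_Asymp"
begin

text \<open>
  Sample independent uniform points in the blocks and let \<open>C\<^sub>i\<^sub>j = g(x\<^sub>i, x\<^sub>j)\<close>, where \<open>C\<^sub>i\<^sub>i\<close> uses a second point
  of block \<open>i\<close>. The expectation of the finite-dimensional objective at \<open>C\<close> is the objective of \<open>g\<close>,
  except for the triangles with a repeated color, where AM-GM makes it larger because \<open>\<alpha> \<ge> 0\<close>. Hence
  the supremum over graphons is at most the finite-dimensional maximum.

  If \<open>g\<close> is optimal, then \<open>C\<close> is almost surely a finite-dimensional maximizer. Resampling a single
  point gives a second maximizer that differs from the first in one row only. The stationarity
  equations fix the product of the two affected factors of a triangle with \<open>\<alpha> > 0\<close>, while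
  supermodularity forbids them to move in opposite directions, so both stay fixed; for a triangle
  with a repeated color the equality case of AM-GM is used as well. Thus \<open>g\<close> is constant on blocks.

  As for the quotient, a color preserving map leaves block graphons invariant, so a graphon at
  distance \<open>0\<close> from a block graphon equals it almost everywhere.
\<close>

section \<open>The finite-dimensional problem\<close>

text \<open>The matrix problem need not be concave and may have several maximizers, so block
  constancy of \<open>g\<close> cannot be read off from uniqueness. Sampling turns \<open>g\<close>
  into a random point of the matrix problem, whose maximizers can be compared by finite-dimensional
  calculus. The price is paid on the diagonal: \<open>g(x, x)\<close> is read on a null set, so
  \<open>C\<^sub>i\<^sub>i\<close> needs a second point, and a triangle with a repeated color no
  longer matches its density. Nonnegativity of \<alpha> gives this error the right sign, and at an
  optimum it must vanish.

  A block pair that occurs in no triangle of positive weight is settled by its stationarity equation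
  alone, which then determines the entry from \<open>h\<close>.

  On the quotient, a functional is evaluated at an unspecified representative. The upper bound holds
  for every representative, and it is attained on the class of an optimal block graphon because all
  members of that class agree with it almost everywhere.\<close>

lemma entropy_density_eq: "entropy_density u = u * ln u + (1 - u) * ln (1 - u)"
  by (auto simp: entropy_density_def)

lemma entropy_density_flip: "entropy_density (1 - u) = entropy_density u"
  by (simp add: entropy_density_eq)

lemma continuous_on_times_ln: "continuous_on {0..1} (\<lambda>x::real. x * ln x)"
  unfolding continuous_on_eq_continuous_within
proof
  fix x :: real assume x: "x \<in> {0..1}"
  show "continuous (at x within {0..1}) (\<lambda>x. x * ln x)"
  proof (cases "x = 0")
    case True
    have "((\<lambda>x::real. x * ln x) \<longlongrightarrow> 0) (at_right 0)"
      by real_asymp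
    then show ?thesis
      using True by (simp add: continuous_within at_within_Icc_at_right)
  next
    case False
    then show ?thesis
      using x by (intro continuous_intros) auto
  qed
qed

lemma continuous_on_entropy_density: "continuous_on {0..1} entropy_density"
proof -
  have "continuous_on {0..1} (\<lambda>x. (1 - x) * ln (1 - x :: real))"
    by (rule continuous_on_compose2[OF continuous_on_times_ln]) (auto intro!: continuous_intros)
  then show ?thesis
    unfolding entropy_density_eq[abs_def] by (intro continuous_on_add continuous_on_times_ln)
qed

lemma entropy_density_bounded: "\<exists>K. \<forall>u\<in>{0..1}. \<bar>entropy_density u\<bar> \<le> K"
proof -
  have "bounded (entropy_density ` {0..1})"
    by (intro compact_imp_bounded compact_continuous_image continuous_on_entropy_density) simp
  then show ?thesis by (auto simp: bounded_iff)
qed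

lemma borel_measurable_entropy_density [measurable]: "entropy_density \<in> borel_measurable borel"
  unfolding entropy_density_eq[abs_def] by measurable

lemma DERIV_entropy_density:
  assumes "0 < u" "u < 1"
  shows "(entropy_density has_real_derivative (ln u - ln (1 - u))) (at u)"
  unfolding entropy_density_eq[abs_def]
  using assms by (auto intro!: derivative_eq_intros)

text \<open>The slope of \<open>entropy_density\<close> is infinite at the end points, so a maximizer is interior.\<close>

lemma entropic_maximizer:
  fixes p :: "real \<Rightarrow> real"
  assumes p: "(p has_real_derivative D) (at u)" and w: "w > 0" and u: "u \<in> {0..1}"
    and max: "\<And>t. t \<in> {0..1} \<Longrightarrow> p t - w * entropy_density t \<le> p u - w * entropy_density u"
  shows "0 < u \<and> u < 1 \<and> D = w * (ln u - ln (1 - u))"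
proof -
  \<comment> \<open>Near 0 the difference quotient of \<open>q\<close> converges while that of
    \<open>- w * entropy_density\<close> tends to infinity, so small positive \<open>t\<close> beat
    0. It is stated for arbitrary \<open>q\<close> because the end point 1 is reduced to it by the
    reflection \<open>t\<close> to \<open>1 - t\<close>, under which the entropy is
    invariant.\<close>
  have not_0: False
    if q: "(q has_real_derivative D') (at 0)"
      and max: "\<And>t. t \<in> {0..1} \<Longrightarrow> q t - w * entropy_density t \<le> q 0 - w * entropy_density 0"
    for q :: "real \<Rightarrow> real" and D'
  proof -
    have "((\<lambda>t. (q t - q 0) / t) \<longlongrightarrow> D') (at_right 0)"
      using q[unfolded has_field_derivative_iff] by (simp add: filterlim_at_split)
    moreover have "filterlim (\<lambda>t::real. - ((t * ln t + (1 - t) * ln (1 - t)) / t)) at_top (at_right 0)"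
      by real_asymp
    then have "filterlim (\<lambda>t. - (entropy_density t / t)) at_top (at_right 0)"
      by (simp only: entropy_density_eq)
    then have "filterlim (\<lambda>t. w * (- (entropy_density t / t))) at_top (at_right 0)"
      by (rule filterlim_tendsto_pos_mult_at_top[OF tendsto_const w])
    ultimately have "filterlim (\<lambda>t. (q t - q 0) / t + w * (- (entropy_density t / t))) at_top (at_right 0)"
      by (rule filterlim_tendsto_add_at_top)
    then have "eventually (\<lambda>t. (q t - q 0) / t + w * (- (entropy_density t / t)) > 0) (at_right 0)"
      unfolding filterlim_at_top_dense by blast
    moreover have "eventually (\<lambda>t::real. 0 < t \<and> t < 1) (at_right 0)"
      by (auto simp: eventually_at_right_less eventually_at_right_field intro!: exI[of _ 1])
    ultimately have "eventually (\<lambda>t::real. False) (at_right 0)"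
    proof eventually_elim
      case (elim t)
      have "((q t - q 0) - w * entropy_density t) / t \<le> 0"
        using max[of t] elim by (intro divide_nonpos_pos) (auto simp: entropy_density_def)
      with elim show ?case by (simp add: diff_divide_distrib)
    qed
    then show False by simp
  qed
  have "u \<noteq> 0" using not_0[of p D] p max by auto
  moreover have "u \<noteq> 1"
  proof
    assume "u = 1"
    have d: "((\<lambda>t. p (1 - t)) has_real_derivative D * (- 1)) (at 0)"
      by (rule DERIV_chain2[where f = p]) (use p \<open>u = 1\<close> in \<open>auto intro!: derivative_eq_intros\<close>)
    show False
    proof (rule not_0[OF d])
      fix t :: real assume "t \<in> {0..1}"
      then show "p (1 - t) - w * entropy_density t \<le> p (1 - 0) - w * entropy_density 0"
        using max[of "1 - t"] \<open>u = 1\<close> entropy_density_flip[of t] entropy_density_flip[of 0] by simp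
    qed
  qed
  ultimately have u': "0 < u" "u < 1" using u by auto
  have "((\<lambda>t. p t - w * entropy_density t) has_real_derivative D - w * (ln u - ln (1 - u))) (at u)"
    using u' by (auto intro!: derivative_eq_intros p DERIV_entropy_density)
  then have "D - w * (ln u - ln (1 - u)) = 0"
  proof (rule DERIV_local_max)
    show "0 < min u (1 - u)" using u' by auto
    show "\<forall>y. \<bar>u - y\<bar> < min u (1 - u) \<longrightarrow> p y - w * entropy_density y \<le> p u - w * entropy_density u"
      using u' by (auto intro!: max)
  qed
  with u' show ?thesis by simp
qed

section \<open>Existence of an optimal block matrix\<close>

text \<open>This is the objective at \<open>block_graphon k B c\<close> (see
  \<open>objective_block_graphon\<close>): the integrands are constant on products of blocks, whose
  lengths come out as factors.\<close>

definition block_objective ::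
  "nat \<Rightarrow> (nat \<Rightarrow> real) \<Rightarrow> (nat \<Rightarrow> nat \<Rightarrow> nat \<Rightarrow> real) \<Rightarrow> (nat \<Rightarrow> nat \<Rightarrow> real) \<Rightarrow>
   (nat \<Rightarrow> nat \<Rightarrow> real) \<Rightarrow> real" where
  "block_objective k b \<alpha> h c =
     1 / 6 * (\<Sum>i\<in>{1..k}. \<Sum>j\<in>{1..k}. \<Sum>l\<in>{1..k}.
                \<alpha> i j l * (b i * b j * b l * (c i j * c i l * c j l))) +
     1 / 2 * (\<Sum>i\<in>{1..k}. \<Sum>j\<in>{1..k}. h i j * (b i * b j * c i j)) -
     1 / 2 * (\<Sum>i\<in>{1..k}. \<Sum>j\<in>{1..k}. b i * b j * entropy_density (c i j))"

lemma block_objective_cong: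
  assumes "\<And>i j. i \<in> {1..k} \<Longrightarrow> j \<in> {1..k} \<Longrightarrow> c i j = c' i j"
  shows "block_objective k b \<alpha> h c = block_objective k b \<alpha> h c'"
  unfolding block_objective_def using assms by simp

text \<open>Compactness and continuity. Members of \<open>C_sym k\<close> are arbitrary outside
  \<open>[k]\<close>, so that set is not compact; the maximum is taken over the cube
  \<open>K\<close> instead, where \<open>sym\<close> produces a symmetric matrix by reading each
  entry at the sorted index pair.\<close>

lemma block_objective_attains_max:
  "\<exists>c\<in>C_sym k. \<forall>c'\<in>C_sym k. block_objective k b \<alpha> h c' \<le> block_objective k b \<alpha> h c"
proof -
  define sym where "sym x i j = x (min i j, max i j)" for x :: "nat \<times> nat \<Rightarrow> real" and i j
  define K where "K = Pi\<^sub>E UNIV (\<lambda>_ :: nat \<times> nat. {0..1::real})"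
  have "compactin (product_topology (\<lambda>_. euclidean) UNIV) K"
    unfolding K_def by (subst compactin_PiE) auto
  then have K: "compact K"
    by (simp add: euclidean_product_topology compactin_euclidean_iff)
  have coord: "continuous_on K (\<lambda>x. sym x i j)" for i j
    unfolding sym_def by (rule continuous_on_subset[OF continuous_on_product_coordinates]) auto
  have ent: "continuous_on K (\<lambda>x. entropy_density (sym x i j))" for i j
    by (rule continuous_on_compose2[OF continuous_on_entropy_density coord])
      (auto simp: K_def sym_def PiE_def Pi_def)
  have "continuous_on K (\<lambda>x. block_objective k b \<alpha> h (sym x))"
    unfolding block_objective_def by (intro continuous_intros coord ent)
  moreover have "(\<lambda>_. 0) \<in> K" by (auto simp: K_def)
  ultimately obtain x where x: "x \<in> K"
    "\<And>y. y \<in> K \<Longrightarrow> block_objective k b \<alpha> h (sym y) \<le> block_objective k b \<alpha> h (sym x)"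
    using continuous_attains_sup[OF K] by blast
  show ?thesis
  proof (intro bexI ballI)
    show "sym x \<in> C_sym k"
      using x(1) by (auto simp: C_sym_def sym_def K_def PiE_def Pi_def min.commute max.commute)
    fix c assume c: "c \<in> C_sym k"
    define y where "y = (\<lambda>(i, j). if i \<in> {1..k} \<and> j \<in> {1..k} then c i j else 0)"
    have "y \<in> K" using c by (auto simp: y_def K_def C_sym_def)
    moreover have "block_objective k b \<alpha> h c = block_objective k b \<alpha> h (sym y)"
      using c by (intro block_objective_cong) (auto simp: y_def sym_def C_sym_def min_def max_def)
    ultimately show "block_objective k b \<alpha> h c \<le> block_objective k b \<alpha> h (sym x)"
      using x(2) by simp
  qed
qed

text \<open>It serves when the whole sum is at most 0: then every single term vanishes.\<close>

lemma member_le_sum3: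
  fixes f :: "'a \<Rightarrow> 'a \<Rightarrow> 'a \<Rightarrow> real"
  assumes fin: "finite A" and mem: "x \<in> A" "y \<in> A" "z \<in> A"
    and nn: "\<And>x y z. x \<in> A \<Longrightarrow> y \<in> A \<Longrightarrow> z \<in> A \<Longrightarrow> 0 \<le> f x y z"
  shows "f x y z \<le> (\<Sum>x\<in>A. \<Sum>y\<in>A. \<Sum>z\<in>A. f x y z)"
proof -
  have "f x y z \<le> (\<Sum>z\<in>A. f x y z)"
    using mem by (intro member_le_sum nn fin) auto
  also have "\<dots> \<le> (\<Sum>y\<in>A. \<Sum>z\<in>A. f x y z)"
    using mem by (intro member_le_sum[where f = "\<lambda>y. \<Sum>z\<in>A. f x y z"] sum_nonneg nn fin) auto
  also have "\<dots> \<le> (\<Sum>x\<in>A. \<Sum>y\<in>A. \<Sum>z\<in>A. f x y z)"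
    using mem by (intro member_le_sum[where f = "\<lambda>x. \<Sum>y\<in>A. \<Sum>z\<in>A. f x y z"] sum_nonneg nn fin) auto
  finally show ?thesis .
qed

section \<open>Stationarity and comparison of maximizers\<close>

text \<open>The two index swaps in \<open>\<alpha>_sym\<close> generate all permutations of three
  indices. The name is borrowed from spin systems: nonnegative couplings favor entries that are
  large together.\<close>

locale ferromagnetic =
  fixes k :: nat and b :: "nat \<Rightarrow> real" and \<alpha> :: "nat \<Rightarrow> nat \<Rightarrow> nat \<Rightarrow> real"
    and h :: "nat \<Rightarrow> nat \<Rightarrow> real"
  assumes b_pos: "\<And>i. i \<in> {1..k} \<Longrightarrow> b i > 0"
    and \<alpha>_sym: "\<And>i j l. i \<in> {1..k} \<Longrightarrow> j \<in> {1..k} \<Longrightarrow> l \<in> {1..k} \<Longrightarrow>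
      \<alpha> i l j = \<alpha> i j l \<and> \<alpha> j i l = \<alpha> i j l"
    and h_sym: "\<And>i j. i \<in> {1..k} \<Longrightarrow> j \<in> {1..k} \<Longrightarrow> h i j = h j i"
    and \<alpha>_nonneg: "\<And>i j l. i \<in> {1..k} \<Longrightarrow> j \<in> {1..k} \<Longrightarrow> l \<in> {1..k} \<Longrightarrow> \<alpha> i j l \<ge> 0"
begin

abbreviation "\<Psi> \<equiv> block_objective k b \<alpha> h"

definition "maximizers = {c \<in> C_sym k. \<forall>c'\<in>C_sym k. \<Psi> c' \<le> \<Psi> c}"

text \<open>The entry at \<open>(p, q)\<close> and its mirror image are varied together, so that the
  matrix stays in \<open>C_sym k\<close>. The three edges of a triangle contribute equally to the
  derivative, which turns the weight 1/6 into 1/2, the weight of the edge and entropy terms.\<close>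

lemma stationary:
  assumes c: "c \<in> maximizers" and p: "p \<in> {1..k}" and q: "q \<in> {1..k}"
  shows "0 < c p q \<and> c p q < 1 \<and>
    ln (c p q) - ln (1 - c p q) = h p q + (\<Sum>l\<in>{1..k}. b l * c p l * c q l * \<alpha> p q l)"
proof -
  define e where "e i j = (if (i = p \<and> j = q) \<or> (i = q \<and> j = p) then 1 else 0::real)" for i j
  define ct where "ct t i j = c i j + (t - c p q) * e i j" for t i j
  define S where "S i j = h i j + (\<Sum>l\<in>{1..k}. b l * c i l * c j l * \<alpha> i j l)" for i j
  \<comment> \<open>Half the total weight of the varied positions: \<open>b p * b q\<close> off the
    diagonal and half of it for \<open>p = q\<close>. Summing against \<open>e\<close> treats both
    cases at once.\<close>
  define w where "w = 1 / 2 * (\<Sum>i\<in>{1..k}. \<Sum>j\<in>{1..k}. e i j * (b i * b j))"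
  \<comment> \<open>The part that is differentiable at every \<open>t\<close>: the entropy of the
    varied positions is left out, so that \<open>entropic_maximizer\<close> applies with weight
    \<open>w\<close>.\<close>
  define P where "P t = 1 / 6 * (\<Sum>i\<in>{1..k}. \<Sum>j\<in>{1..k}. \<Sum>l\<in>{1..k}.
                \<alpha> i j l * (b i * b j * b l * (ct t i j * ct t i l * ct t j l))) +
     1 / 2 * (\<Sum>i\<in>{1..k}. \<Sum>j\<in>{1..k}. h i j * (b i * b j * ct t i j)) -
     1 / 2 * (\<Sum>i\<in>{1..k}. \<Sum>j\<in>{1..k}. (1 - e i j) * (b i * b j * entropy_density (c i j)))" for t
  have csym: "c i j = c j i" if "i \<in> {1..k}" "j \<in> {1..k}" for i j
    using c that by (auto simp: maximizers_def C_sym_def)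
  have esym: "e i j = e j i" for i j by (auto simp: e_def)
  have u: "c p q \<in> {0..1}" using c p q by (auto simp: maximizers_def C_sym_def)
  have split: "\<Psi> (ct t) = P t - w * entropy_density t" for t
  proof -
    have "b i * b j * entropy_density (ct t i j) =
        (1 - e i j) * (b i * b j * entropy_density (c i j)) + e i j * (b i * b j) * entropy_density t"
      if "i \<in> {1..k}" "j \<in> {1..k}" for i j
      using csym[OF p q] by (auto simp: ct_def e_def)
    then have "(\<Sum>i\<in>{1..k}. \<Sum>j\<in>{1..k}. b i * b j * entropy_density (ct t i j)) =
       (\<Sum>i\<in>{1..k}. \<Sum>j\<in>{1..k}. (1 - e i j) * (b i * b j * entropy_density (c i j)) +
          e i j * (b i * b j) * entropy_density t)"
      by (intro sum.cong refl)
    then have "(\<Sum>i\<in>{1..k}. \<Sum>j\<in>{1..k}. b i * b j * entropy_density (ct t i j)) =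
       (\<Sum>i\<in>{1..k}. \<Sum>j\<in>{1..k}. (1 - e i j) * (b i * b j * entropy_density (c i j))) +
       (\<Sum>i\<in>{1..k}. \<Sum>j\<in>{1..k}. e i j * (b i * b j)) * entropy_density t"
      by (simp only: sum.distrib sum_distrib_right)
    then show ?thesis
      unfolding block_objective_def P_def w_def by (simp add: algebra_simps)
  qed
  have "e p q * (b p * b q) \<le> (\<Sum>j\<in>{1..k}. e p j * (b p * b j))"
    using p q b_pos by (intro member_le_sum) (auto simp: e_def less_imp_le)
  also have "\<dots> \<le> (\<Sum>i\<in>{1..k}. \<Sum>j\<in>{1..k}. e i j * (b i * b j))"
    using p q b_pos
    by (intro member_le_sum[where f = "\<lambda>i. \<Sum>j\<in>{1..k}. e i j * (b i * b j)"] sum_nonneg)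
      (auto simp: e_def less_imp_le)
  finally have w: "w > 0"
    using b_pos[OF p] b_pos[OF q] by (simp add: w_def e_def order_less_le_trans[rotated])
  have ct0: "ct (c p q) = c" by (simp add: ct_def fun_eq_iff)
  have dct: "((\<lambda>t. ct t i j) has_real_derivative e i j) (at x)" for i j x
    unfolding ct_def by (auto intro!: derivative_eq_intros)
  \<comment> \<open>Here the varied edge is \<open>(i, j)\<close>. Renaming summation indices moves
    a varied edge \<open>(i, l)\<close> or \<open>(j, l)\<close> to this place, which gives
    \<open>Q2\<close> and \<open>Q3\<close>.\<close>
  define Q where "Q = (\<Sum>i\<in>{1..k}. \<Sum>j\<in>{1..k}. \<Sum>l\<in>{1..k}.
      \<alpha> i j l * (b i * b j * b l * (e i j * c i l * c j l)))"
  have Q2: "(\<Sum>i\<in>{1..k}. \<Sum>j\<in>{1..k}. \<Sum>l\<in>{1..k}. \<alpha> i j l * (b i * b j * b l * (c i j * e i l * c j l))) = Q"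
    unfolding Q_def
    by (subst (2) sum.swap, intro sum.cong refl) (use \<alpha>_sym csym in \<open>auto simp: mult_ac\<close>)
  have "Q = (\<Sum>j\<in>{1..k}. \<Sum>i\<in>{1..k}. \<Sum>l\<in>{1..k}. \<alpha> i j l * (b i * b j * b l * (c i j * e i l * c j l)))"
    by (subst Q2[symmetric], rule sum.swap)
  then have Q3: "(\<Sum>i\<in>{1..k}. \<Sum>j\<in>{1..k}. \<Sum>l\<in>{1..k}. \<alpha> i j l * (b i * b j * b l * (c i j * c i l * e j l))) = Q"
    by (elim trans[rotated, OF sym], intro sum.cong refl) (use \<alpha>_sym csym in \<open>auto simp: mult_ac\<close>)
  have "(P has_real_derivative
     1 / 6 * (\<Sum>i\<in>{1..k}. \<Sum>j\<in>{1..k}. \<Sum>l\<in>{1..k}.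
        \<alpha> i j l * (b i * b j * b l * (e i j * c i l * c j l)) +
        \<alpha> i j l * (b i * b j * b l * (c i j * e i l * c j l)) +
        \<alpha> i j l * (b i * b j * b l * (c i j * c i l * e j l))) +
     1 / 2 * (\<Sum>i\<in>{1..k}. \<Sum>j\<in>{1..k}. h i j * (b i * b j * e i j))) (at (c p q))"
    unfolding P_def
    by (auto intro!: derivative_eq_intros dct sum.cong simp: ct0 algebra_simps)
  also have "(\<Sum>i\<in>{1..k}. \<Sum>j\<in>{1..k}. \<Sum>l\<in>{1..k}.
        \<alpha> i j l * (b i * b j * b l * (e i j * c i l * c j l)) +
        \<alpha> i j l * (b i * b j * b l * (c i j * e i l * c j l)) +
        \<alpha> i j l * (b i * b j * b l * (c i j * c i l * e j l))) = 3 * Q"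
    using Q2 Q3 by (simp add: sum.distrib Q_def)
  also have "1 / 6 * (3 * Q) + 1 / 2 * (\<Sum>i\<in>{1..k}. \<Sum>j\<in>{1..k}. h i j * (b i * b j * e i j)) =
     1 / 2 * (\<Sum>i\<in>{1..k}. \<Sum>j\<in>{1..k}. e i j * (b i * b j) * S i j)"
    by (simp add: Q_def S_def sum_distrib_left sum.distrib algebra_simps)
  also have "(\<Sum>i\<in>{1..k}. \<Sum>j\<in>{1..k}. e i j * (b i * b j) * S i j) =
      (\<Sum>i\<in>{1..k}. \<Sum>j\<in>{1..k}. e i j * (b i * b j) * S p q)"
  proof -
    have "S q p = S p q"
      unfolding S_def using h_sym[OF p q] \<alpha>_sym p q by (auto intro!: sum.cong)
    then show ?thesis by (intro sum.cong refl) (auto simp: e_def)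
  qed
  also have "1 / 2 * \<dots> = w * S p q"
    by (simp add: w_def sum_distrib_right)
  finally have "(P has_real_derivative w * S p q) (at (c p q))" .
  then have "0 < c p q \<and> c p q < 1 \<and> w * S p q = w * (ln (c p q) - ln (1 - c p q))"
    using w u
  proof (rule entropic_maximizer)
    fix t :: real assume t: "t \<in> {0..1}"
    have "ct t \<in> C_sym k"
      unfolding C_sym_def
    proof (intro CollectI ballI)
      fix i j assume ij: "i \<in> {1..k}" "j \<in> {1..k}"
      have "ct t i j = (if e i j = 1 then t else c i j)"
        using csym[OF p q] by (auto simp: ct_def e_def)
      moreover have "c i j \<in> {0..1}"
        using c ij unfolding maximizers_def C_sym_def by blast
      moreover have "ct t i j = ct t j i"
        by (simp only: ct_def csym[OF ij] esym[of i j])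
      ultimately show "ct t i j \<in> {0..1} \<and> ct t i j = ct t j i"
        using t by simp
    qed
    then have "\<Psi> (ct t) \<le> \<Psi> (ct (c p q))"
      using c unfolding maximizers_def ct0 by blast
    then show "P t - w * entropy_density t \<le> P (c p q) - w * entropy_density (c p q)"
      by (simp add: split)
  qed
  then show ?thesis using w unfolding S_def by simp
qed

lemma maximizer_logistic:
  assumes "c \<in> maximizers" "p \<in> {1..k}" "q \<in> {1..k}"
  shows "c p q = exp (h p q + (\<Sum>l\<in>{1..k}. b l * c p l * c q l * \<alpha> p q l)) /
    (1 + exp (h p q + (\<Sum>l\<in>{1..k}. b l * c p l * c q l * \<alpha> p q l)))"
proof -
  note s = stationary[OF assms]
  have "exp (h p q + (\<Sum>l\<in>{1..k}. b l * c p l * c q l * \<alpha> p q l)) = exp (ln (c p q) - ln (1 - c p q))"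
    using s by simp
  also have "\<dots> = c p q / (1 - c p q)"
    using s[THEN conjunct1] s[THEN conjunct2, THEN conjunct1] unfolding exp_diff by simp
  finally have "exp (h p q + (\<Sum>l\<in>{1..k}. b l * c p l * c q l * \<alpha> p q l)) = c p q / (1 - c p q)" .
  moreover have "c p q = (c p q / (1 - c p q)) / (1 + c p q / (1 - c p q))"
    using s[THEN conjunct2, THEN conjunct1] by (simp add: field_simps)
  ultimately show ?thesis by metis
qed

lemma maximizers_pos: "c \<in> maximizers \<Longrightarrow> i \<in> {1..k} \<Longrightarrow> j \<in> {1..k} \<Longrightarrow> c i j > 0"
  using stationary by blast

text \<open>
  The objective is supermodular for the entrywise order, so the entrywise minimum and maximum of two
  maximizers are maximizers, with equality in every single interaction term.
\<close>

lemma maximizers_noncrossing: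
  assumes c: "c \<in> maximizers" and c': "c' \<in> maximizers"
    and ijl: "i \<in> {1..k}" "j \<in> {1..k}" "l \<in> {1..k}"
    and \<alpha>: "\<alpha> i j l > 0" and eq: "c i j = c' i j"
  shows "(c i l - c' i l) * (c j l - c' j l) \<ge> 0"
proof -
  define lo where "lo i j = min (c i j) (c' i j)" for i j
  define hi where "hi i j = max (c i j) (c' i j)" for i j
  define T where "T x i j l = \<alpha> i j l * (b i * b j * b l * (x i j * x i l * x j l))"
    for x :: "nat \<Rightarrow> nat \<Rightarrow> real" and i j l
  have C: "c \<in> C_sym k" "c' \<in> C_sym k" using c c' by (auto simp: maximizers_def)
  then have "lo \<in> C_sym k" "hi \<in> C_sym k"
    by (auto simp: C_sym_def lo_def hi_def min_def max_def)
  then have "\<Psi> lo \<le> \<Psi> c" "\<Psi> hi \<le> \<Psi> c'" using c c' by (auto simp: maximizers_def)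
  moreover have "\<Psi> lo + \<Psi> hi - \<Psi> c - \<Psi> c' =
    1 / 6 * (\<Sum>i\<in>{1..k}. \<Sum>j\<in>{1..k}. \<Sum>l\<in>{1..k}. T lo i j l + T hi i j l - T c i j l - T c' i j l)"
  proof -
    \<comment> \<open>\<open>lo\<close> and \<open>hi\<close> take the two values
      \<open>c i j\<close> and \<open>c' i j\<close> in some order, so terms involving one entry
      cancel and only triangles remain to be compared.\<close>
    have "f (lo i j) + f (hi i j) = f (c i j) + f (c' i j)" for f :: "real \<Rightarrow> real" and i j
      by (auto simp: lo_def hi_def min_def max_def)
    then have "(\<Sum>i\<in>{1..k}. \<Sum>j\<in>{1..k}. f i j (lo i j)) + (\<Sum>i\<in>{1..k}. \<Sum>j\<in>{1..k}. f i j (hi i j)) =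
        (\<Sum>i\<in>{1..k}. \<Sum>j\<in>{1..k}. f i j (c i j)) + (\<Sum>i\<in>{1..k}. \<Sum>j\<in>{1..k}. f i j (c' i j))"
      for f :: "nat \<Rightarrow> nat \<Rightarrow> real \<Rightarrow> real"
      by (simp only: sum.distrib[symmetric])
    note eqs = this[of "\<lambda>i j u. h i j * (b i * b j * u)"] this[of "\<lambda>i j u. b i * b j * entropy_density u"]
    have "1 / 6 * t1 + 1 / 2 * a1 - 1 / 2 * e1 + (1 / 6 * t2 + 1 / 2 * a2 - 1 / 2 * e2) -
        (1 / 6 * t3 + 1 / 2 * a3 - 1 / 2 * e3) - (1 / 6 * t4 + 1 / 2 * a4 - 1 / 2 * e4) =
        1 / 6 * (t1 + t2 - t3 - t4)"
      if "a1 + a2 = a3 + a4" "e1 + e2 = e3 + e4" for a1 a2 a3 a4 e1 e2 e3 e4 t1 t2 t3 t4 :: real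
      using that by argo
    from this[OF eqs] show ?thesis
      unfolding block_objective_def T_def[symmetric] sum.distrib sum_subtractf .
  qed
  ultimately have le: "(\<Sum>i\<in>{1..k}. \<Sum>j\<in>{1..k}. \<Sum>l\<in>{1..k}. T lo i j l + T hi i j l - T c i j l - T c' i j l) \<le> 0"
    by linarith
  \<comment> \<open>The rearrangement inequality for two pairs. Splitting \<open>x'\<close> as
    \<open>x + (x' - x)\<close> extends it to nonnegative triples.\<close>
  have two: "y * z + y' * z' \<le> min y y' * min z z' + max y y' * max z z'" for y z y' z' :: real
  proof -
    have "0 \<le> (y' - y) * (z' - z)" if "y \<le> y'" "z \<le> z'" using that by simp
    moreover have "(y' - y) * (z' - z) \<le> 0" if "y \<le> y'" "z' \<le> z" using that by (simp add: mult_nonneg_nonpos)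
    moreover have "(y' - y) * (z' - z) \<le> 0" if "y' \<le> y" "z \<le> z'" using that by (simp add: mult_nonpos_nonneg)
    ultimately show ?thesis by (auto simp: min_def max_def algebra_simps)
  qed
  have "x * y * z + x' * y' * z' \<le> min x x' * min y y' * min z z' + max x x' * max y y' * max z z'"
    if nn: "0 \<le> x" "0 \<le> y" "0 \<le> z" "0 \<le> x'" "0 \<le> y'" "0 \<le> z'" and le: "x \<le> x'" for x y z x' y' z' :: real
  proof -
    have "x * y * z + x' * y' * z' = x * (y * z + y' * z') + (x' - x) * (y' * z')"
      by (simp add: algebra_simps)
    also have "\<dots> \<le> x * (min y y' * min z z' + max y y' * max z z') + (x' - x) * (max y y' * max z z')"
      using nn le by (intro add_mono mult_left_mono two mult_mono) auto
    also have "\<dots> = min x x' * min y y' * min z z' + max x x' * max y y' * max z z'"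
      using le by (simp add: algebra_simps)
    finally show ?thesis .
  qed
  note three = this
  have three': "x * y * z + x' * y' * z' \<le> min x x' * min y y' * min z z' + max x x' * max y y' * max z z'"
    if nn: "0 \<le> x" "0 \<le> y" "0 \<le> z" "0 \<le> x'" "0 \<le> y'" "0 \<le> z'" for x y z x' y' z' :: real
    using three[of x y z x' y' z'] three[of x' y' z' x y z] nn
    by (cases "x \<le> x'") (auto simp: min.commute max.commute)
  have nonneg: "0 \<le> c i j" "0 \<le> c' i j" if "i \<in> {1..k}" "j \<in> {1..k}" for i j
    using C that unfolding C_sym_def by auto
  have nn: "0 \<le> T lo i j l + T hi i j l - T c i j l - T c' i j l"
    if ijl: "i \<in> {1..k}" "j \<in> {1..k}" "l \<in> {1..k}" for i j l
  proof -
    have "c i j * c i l * c j l + c' i j * c' i l * c' j l \<le> lo i j * lo i l * lo j l + hi i j * hi i l * hi j l"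
      unfolding lo_def hi_def by (intro three' nonneg ijl)
    then have "0 \<le> lo i j * lo i l * lo j l + hi i j * hi i l * hi j l -
        (c i j * c i l * c j l + c' i j * c' i l * c' j l)"
      by simp
    moreover have "0 \<le> \<alpha> i j l * (b i * b j * b l)"
      using \<alpha>_nonneg[OF ijl] b_pos[OF ijl(1)] b_pos[OF ijl(2)] b_pos[OF ijl(3)] by simp
    ultimately
    have "0 \<le> \<alpha> i j l * (b i * b j * b l) * (lo i j * lo i l * lo j l + hi i j * hi i l * hi j l -
        (c i j * c i l * c j l + c' i j * c' i l * c' j l))"
      by (intro mult_nonneg_nonneg[of "\<alpha> i j l * (b i * b j * b l)"])
    also have "\<dots> = T lo i j l + T hi i j l - T c i j l - T c' i j l"
      by (simp add: T_def algebra_simps)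
    finally show ?thesis .
  qed
  have "T lo i j l + T hi i j l - T c i j l - T c' i j l \<le> 0"
    using member_le_sum3[OF _ ijl nn] le by fastforce
  \<comment> \<open>Agreement at \<open>(i, j)\<close> makes this defect a positive multiple of that
    in \<open>two\<close>. For pairs moving in opposite directions the latter is the product of the
    two distances, hence positive.\<close>
  moreover have "T lo i j l + T hi i j l - T c i j l - T c' i j l =
      (\<alpha> i j l * b i * b j * b l * c i j) * (lo i l * lo j l + hi i l * hi j l - c i l * c j l - c' i l * c' j l)"
    using eq unfolding T_def by (simp add: lo_def hi_def algebra_simps)
  moreover have "\<alpha> i j l * b i * b j * b l * c i j > 0"
    using \<alpha> b_pos ijl maximizers_pos[OF c] by simp
  ultimately have "lo i l * lo j l + hi i l * hi j l - c i l * c j l - c' i l * c' j l \<le> 0"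
    by (smt (verit) mult_pos_pos)
  note le0 = this
  show ?thesis
  proof (rule ccontr)
    assume neg: "\<not> 0 \<le> (c i l - c' i l) * (c j l - c' j l)"
    then consider "c i l < c' i l" "c' j l < c j l" | "c' i l < c i l" "c j l < c' j l"
      by (auto simp: not_le mult_less_0_iff)
    then show False
      using le0 neg by cases (auto simp: lo_def hi_def min_def max_def algebra_simps)
  qed
qed

text \<open>The stationarity equations at \<open>(i, j)\<close> have equal left sides and can differ
  in the summand at \<open>l\<close> only, so the products at \<open>l\<close> agree. Positive pairs
  with equal products that do not move in opposite directions coincide. In the applications the two
  matrices are samples that differ in one point of block \<open>l\<close>.\<close>

lemma maximizers_rigid:
  assumes c: "c \<in> maximizers" and c': "c' \<in> maximizers"
    and ijl: "i \<in> {1..k}" "j \<in> {1..k}" "l \<in> {1..k}"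
    and \<alpha>: "\<alpha> i j l > 0" and eq: "c i j = c' i j"
    and other: "\<And>m. m \<in> {1..k} \<Longrightarrow> m \<noteq> l \<Longrightarrow> c i m = c' i m \<and> c j m = c' j m"
  shows "c i l = c' i l"
proof -
  have "(\<Sum>m\<in>{1..k}. b m * c i m * c j m * \<alpha> i j m) = (\<Sum>m\<in>{1..k}. b m * c' i m * c' j m * \<alpha> i j m)"
    using stationary[OF c ijl(1,2)] stationary[OF c' ijl(1,2)] eq by auto
  moreover have "(\<Sum>m\<in>{1..k} - {l}. b m * c i m * c j m * \<alpha> i j m) =
      (\<Sum>m\<in>{1..k} - {l}. b m * c' i m * c' j m * \<alpha> i j m)"
    by (intro sum.cong) (auto simp: other)
  ultimately have "b l * c i l * c j l * \<alpha> i j l = b l * c' i l * c' j l * \<alpha> i j l"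
    using ijl(3) by (simp add: sum.remove[of _ l])
  then have prod: "c i l * c j l = c' i l * c' j l"
    using \<alpha> b_pos[OF ijl(3)] by simp
  note pos = maximizers_pos[OF c ijl(1,3)] maximizers_pos[OF c ijl(2,3)]
    maximizers_pos[OF c' ijl(1,3)] maximizers_pos[OF c' ijl(2,3)]
  have cross: "(c i l - c' i l) * (c j l - c' j l) \<ge> 0"
    by (rule maximizers_noncrossing[OF c c' ijl \<alpha> eq])
  show ?thesis
  proof (rule linorder_cases[of "c i l" "c' i l"])
    assume less: "c i l < c' i l"
    with cross have "c j l \<le> c' j l" by (simp add: zero_le_mult_iff)
    with less pos have "c i l * c j l < c' i l * c' j l" by (intro mult_less_le_imp_less) auto
    with prod show ?thesis by simp
  next
    assume less: "c' i l < c i l"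
    with cross have "c' j l \<le> c j l" by (simp add: zero_le_mult_iff)
    with less pos have "c' i l * c' j l < c i l * c j l" by (intro mult_less_le_imp_less) auto
    with prod show ?thesis by simp
  qed
qed

end

section \<open>Integrals over the completion, and random samples\<close>

lemma (in complete_measure) measurable_AE_eq:
  assumes f: "f \<in> M \<rightarrow>\<^sub>M N" and ae: "AE x in M. f x = g x" and g: "g \<in> space M \<rightarrow> space N"
  shows "g \<in> M \<rightarrow>\<^sub>M N"
proof (rule measurableI)
  fix x assume "x \<in> space M" then show "g x \<in> space N" using g by auto
next
  fix A assume A: "A \<in> sets N"
  from ae obtain Z where Z: "Z \<in> null_sets M" "{x \<in> space M. f x \<noteq> g x} \<subseteq> Z"
    by (auto elim!: AE_E)
  have "g -` A \<inter> space M = (f -` A \<inter> space M - Z) \<union> (g -` A \<inter> space M \<inter> Z)"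
    using Z(2) by auto
  moreover have "g -` A \<inter> space M \<inter> Z \<in> sets M"
    by (rule complete[OF _ Z(1)]) auto
  ultimately show "g -` A \<inter> space M \<in> sets M"
    using sets.Un[OF sets.Diff[OF measurable_sets[OF f A] null_setsD2[OF Z(1)]],
        of "g -` A \<inter> space M \<inter> Z"] by simp
qed

text \<open>In a complete measure \<open>f\<close> and \<open>g\<close> are both measurable, or
  neither is and both integrals are 0 by convention. So integrands may be replaced almost everywhere
  before anything is known about their measurability.\<close>

lemma (in complete_measure) integral_cong_AE':
  fixes f g :: "'a \<Rightarrow> real"
  assumes ae: "AE x in M. f x = g x"
  shows "integral\<^sup>L M f = integral\<^sup>L M g"
proof (cases "f \<in> borel_measurable M")
  case True
  then have "g \<in> borel_measurable M"
    using ae by (rule measurable_AE_eq) auto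
  with True ae show ?thesis by (intro integral_cong_AE)
next
  case False
  have "AE x in M. g x = f x" using ae by eventually_elim simp
  with False have "g \<notin> borel_measurable M"
    using measurable_AE_eq[of g borel f] by auto
  with False have "\<not> integrable M f" "\<not> integrable M g"
    by (blast dest: borel_measurable_integrable)+
  then show ?thesis by (simp add: not_integrable_integral_eq)
qed

text \<open>The bridge from the integrals in the definitions to expectations: the completed measure
  is traded for a measurable version \<open>g\<close>, and the domain \<open>A\<close> for the
  uniform law on it, with \<open>measure M A\<close> as normalization.\<close>

lemma set_integral_completion:
  fixes f g :: "'a \<Rightarrow> real"
  assumes A: "A \<in> sets M" "emeasure M A \<noteq> 0" "emeasure M A \<noteq> \<infinity>"
    and g: "g \<in> borel_measurable M" and ae: "AE x in uniform_measure M A. f x = g x"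
  shows "(LINT x:A|completion M. f x) = measure M A * integral\<^sup>L (uniform_measure M A) g"
proof -
  have pos: "measure M A > 0"
    using A by (simp add: zero_less_measure_iff emeasure_eq_ennreal_measure)
  have "AE x in M. x \<in> A \<longrightarrow> f x = g x"
    using ae A by (subst (asm) AE_uniform_measure) (auto simp: top.not_eq_extremum)
  then have "AE x in completion M. indicator A x *\<^sub>R f x = indicator A x *\<^sub>R g x"
    by (intro AE_completion) (auto elim!: eventually_mono simp: indicator_def)
  then have "(LINT x:A|completion M. f x) = (\<integral>x. indicator A x *\<^sub>R g x \<partial>completion M)"
    unfolding set_lebesgue_integral_def by (rule completion.integral_cong_AE')
  also have "\<dots> = (\<integral>x. indicator A x *\<^sub>R g x \<partial>M)"
    using A(1) g by (intro integral_completion) auto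
  finally have 1: "(LINT x:A|completion M. f x) = (\<integral>x. indicator A x *\<^sub>R g x \<partial>M)" .
  have "uniform_measure M A = density M (\<lambda>x. ennreal (indicator A x / measure M A))"
    unfolding uniform_measure_def
    using pos A(3) by (intro arg_cong[where f = "density M"] ext)
      (simp add: emeasure_eq_ennreal_measure divide_ennreal[symmetric] ennreal_indicator)
  then have "integral\<^sup>L (uniform_measure M A) g = (\<integral>x. indicator A x / measure M A * g x \<partial>M)"
    using A(1) g pos by (simp add: integral_real_density)
  also have "\<dots> = (\<integral>x. indicator A x *\<^sub>R g x \<partial>M) / measure M A"
    by simp
  finally show ?thesis using 1 pos by simp
qed

section \<open>Uniform laws on products\<close>

lemma uniform_measure_Pi:
  assumes "finite I" and M: "\<And>i. sigma_finite_measure (M i)"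
    and A: "\<And>i. A i \<in> sets (M i)" "\<And>i. emeasure (M i) (A i) \<noteq> 0" "\<And>i. emeasure (M i) (A i) \<noteq> \<infinity>"
  shows "uniform_measure (Pi\<^sub>M I M) (Pi\<^sub>E I A) = (\<Pi>\<^sub>M i\<in>I. uniform_measure (M i) (A i))"
proof -
  interpret M: product_sigma_finite M using M by (simp add: product_sigma_finite_def)
  interpret U: product_prob_space "\<lambda>i. uniform_measure (M i) (A i)"
    by (intro product_prob_spaceI prob_space_uniform_measure A)
  show ?thesis
  proof (rule U.PiM_eqI[OF \<open>finite I\<close>])
    show "sets (uniform_measure (Pi\<^sub>M I M) (Pi\<^sub>E I A)) = sets (\<Pi>\<^sub>M i\<in>I. uniform_measure (M i) (A i))"
      by (auto intro!: sets_PiM_cong)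
    fix C assume C: "\<And>i. i \<in> I \<Longrightarrow> C i \<in> sets (uniform_measure (M i) (A i))"
    have "emeasure (uniform_measure (Pi\<^sub>M I M) (Pi\<^sub>E I A)) (Pi\<^sub>E I C) =
        emeasure (Pi\<^sub>M I M) (Pi\<^sub>E I (\<lambda>i. A i \<inter> C i)) / emeasure (Pi\<^sub>M I M) (Pi\<^sub>E I A)"
      using C A \<open>finite I\<close> by (subst emeasure_uniform_measure) (auto simp: PiE_Int intro!: sets_PiM_I_finite)
    also have "\<dots> = (\<Prod>i\<in>I. emeasure (M i) (A i \<inter> C i)) / (\<Prod>i\<in>I. emeasure (M i) (A i))"
      using C A \<open>finite I\<close> by (auto simp: M.emeasure_PiM)
    also have "\<dots> = (\<Prod>i\<in>I. emeasure (M i) (A i \<inter> C i) / emeasure (M i) (A i))"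
      using \<open>finite I\<close>
    proof induction
      case (insert i I)
      have "inverse (emeasure (M i) (A i) * (\<Prod>i\<in>I. emeasure (M i) (A i))) =
          inverse (emeasure (M i) (A i)) * inverse (\<Prod>i\<in>I. emeasure (M i) (A i))"
      proof (rule ennreal_inverse_mult)
        have "(\<Prod>i\<in>I. emeasure (M i) (A i)) \<noteq> top"
          using A(3) by (subst ennreal_prod_eq_top) auto
        then show "(\<Prod>i\<in>I. emeasure (M i) (A i)) < top" by (simp only: less_top)
        show "emeasure (M i) (A i) < top" using A(3)[of i] by (simp add: less_top)
      qed
      then show ?case
        using insert by (simp add: divide_ennreal_def mult_ac)
    qed simp
    also have "\<dots> = (\<Prod>i\<in>I. emeasure (uniform_measure (M i) (A i)) (C i))"
      using C A by (intro prod.cong) auto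
    finally show "emeasure (uniform_measure (Pi\<^sub>M I M) (Pi\<^sub>E I A)) (Pi\<^sub>E I C) =
      (\<Prod>i\<in>I. emeasure (uniform_measure (M i) (A i)) (C i))" .
  qed
qed

lemma uniform_measure_times:
  fixes A B :: "real set"
  assumes A: "A \<in> sets borel" "emeasure lborel A \<noteq> 0" "emeasure lborel A \<noteq> \<infinity>"
    and B: "B \<in> sets borel" "emeasure lborel B \<noteq> 0" "emeasure lborel B \<noteq> \<infinity>"
  shows "uniform_measure lborel A \<Otimes>\<^sub>M uniform_measure lborel B = uniform_measure lborel (A \<times> B)"
proof (rule pair_measure_eqI)
  interpret A: prob_space "uniform_measure lborel A" by (intro prob_space_uniform_measure A)
  interpret B: prob_space "uniform_measure lborel B" by (intro prob_space_uniform_measure B)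
  show "sigma_finite_measure (uniform_measure lborel A)" "sigma_finite_measure (uniform_measure lborel B)" ..
  have "sets (uniform_measure lborel A \<Otimes>\<^sub>M uniform_measure lborel B) = sets (borel \<Otimes>\<^sub>M borel)"
    by (intro sets_pair_measure_cong) auto
  also have "(borel \<Otimes>\<^sub>M borel :: (real \<times> real) measure) = borel"
    by (rule borel_prod)
  finally show "sets (uniform_measure lborel A \<Otimes>\<^sub>M uniform_measure lborel B) = sets (uniform_measure lborel (A \<times> B))"
    by simp
  have times: "emeasure lborel (C \<times> D) = emeasure lborel C * emeasure lborel D"
    if "C \<in> sets borel" "D \<in> sets borel" for C D :: "real set"
    unfolding lborel_prod[symmetric] using that by (intro lborel.emeasure_pair_measure_Times) auto
  fix C D assume "C \<in> sets (uniform_measure lborel A)" "D \<in> sets (uniform_measure lborel B)"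
  then have CD: "C \<in> sets borel" "D \<in> sets borel" by auto
  have "emeasure (uniform_measure lborel (A \<times> B)) (C \<times> D) =
      emeasure lborel ((A \<inter> C) \<times> (B \<inter> D)) / emeasure lborel (A \<times> B)"
    using A(1) B(1) CD by (subst emeasure_uniform_measure) (auto simp: Times_Int_Times borel_Times)
  also have "\<dots> = (emeasure lborel (A \<inter> C) / emeasure lborel A) * (emeasure lborel (B \<inter> D) / emeasure lborel B)"
    using A B CD by (simp add: times ennreal_divide_times ennreal_times_divide divide_ennreal_def ennreal_inverse_mult mult_ac top.not_eq_extremum)
  also have "\<dots> = emeasure (uniform_measure lborel A) C * emeasure (uniform_measure lborel B) D"
    using A(1) B(1) CD by simp
  finally show "emeasure (uniform_measure lborel A) C * emeasure (uniform_measure lborel B) D =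
      emeasure (uniform_measure lborel (A \<times> B)) (C \<times> D)" ..
qed

lemma (in product_prob_space) distr_PiM_pair:
  assumes "i \<in> I" "j \<in> I" "i \<noteq> j"
  shows "distr (Pi\<^sub>M I M) (M i \<Otimes>\<^sub>M M j) (\<lambda>\<omega>. (\<omega> i, \<omega> j)) = M i \<Otimes>\<^sub>M M j"
proof (rule pair_measure_eqI[symmetric])
  show "sigma_finite_measure (M i)" "sigma_finite_measure (M j)"
    by (simp_all add: M.sigma_finite_measure_axioms)
  fix A B assume AB: "A \<in> sets (M i)" "B \<in> sets (M j)"
  have "emeasure (distr (Pi\<^sub>M I M) (M i \<Otimes>\<^sub>M M j) (\<lambda>\<omega>. (\<omega> i, \<omega> j))) (A \<times> B) =
      emeasure (Pi\<^sub>M I M) {\<omega> \<in> space (Pi\<^sub>M I M). \<forall>n\<in>{i, j}. \<omega> n \<in> (if n = i then A else B)}"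
    using assms AB by (subst emeasure_distr) (auto intro!: arg_cong[where f = "emeasure _"])
  also have "\<dots> = emeasure (M i) A * emeasure (M j) B"
    using assms AB by (subst emeasure_PiM_Collect) auto
  finally show "emeasure (M i) A * emeasure (M j) B =
    emeasure (distr (Pi\<^sub>M I M) (M i \<Otimes>\<^sub>M M j) (\<lambda>\<omega>. (\<omega> i, \<omega> j))) (A \<times> B)" ..
qed simp

section \<open>Blocks and the sample space\<close>

locale block_partition =
  fixes k :: nat and b :: "nat \<Rightarrow> real" and B :: "nat \<Rightarrow> real set"
  assumes b_pos: "\<And>i. i \<in> {1..k} \<Longrightarrow> b i > 0"
    and blocks: "consecutive_intervals k b B"
begin

lemma UN_B: "(\<Union>i\<in>{1..k}. B i) = {0..1}"
  using blocks by (simp add: consecutive_intervals_def)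

lemma B_subset: "i \<in> {1..k} \<Longrightarrow> B i \<subseteq> {0..1}"
  using UN_B by blast

lemma B_cases: assumes "x \<in> {0..1}" obtains i where "i \<in> {1..k}" "x \<in> B i"
  using assms UN_B by blast

lemma B_unique: assumes "i \<in> {1..k}" "j \<in> {1..k}" "x \<in> B i" "x \<in> B j" shows "i = j"
  using blocks assms unfolding consecutive_intervals_def
  by (metis less_irrefl linorder_less_linear)

lemma B_borel [measurable]: "i \<in> {1..k} \<Longrightarrow> B i \<in> sets borel"
  using blocks by (auto simp: consecutive_intervals_def intro: real_interval_borel_measurable)

lemma emeasure_B: "i \<in> {1..k} \<Longrightarrow> emeasure lborel (B i) = ennreal (b i)"
proof -
  assume i: "i \<in> {1..k}"
  have "emeasure lborel (B i) \<le> emeasure lborel {0..1::real}"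
    by (rule emeasure_mono) (use i B_subset in auto)
  then have "emeasure lborel (B i) \<noteq> \<infinity>"
    by (auto simp: top_unique)
  moreover have "measure lborel (B i) = b i"
    using blocks i B_borel[OF i] by (simp add: consecutive_intervals_def)
  ultimately show ?thesis by (simp add: emeasure_eq_ennreal_measure)
qed

text \<open>The value outside \<open>[k]\<close> is irrelevant; it makes \<open>\<mu>\<close> a family of probability measures.\<close>

definition "cell i = (if i \<in> {1..k} then B i else {0..1})"

definition "\<mu> i = uniform_measure lborel (cell i)"

lemma cell_borel [measurable, simp]: "cell i \<in> sets borel"
  by (simp add: cell_def)

lemma emeasure_cell: "emeasure lborel (cell i) \<noteq> 0" "emeasure lborel (cell i) \<noteq> \<infinity>"
  using b_pos[of i] by (auto simp: cell_def emeasure_B)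

lemma measure_cell: "i \<in> {1..k} \<Longrightarrow> measure lborel (cell i) = b i"
  using b_pos[of i] by (simp add: cell_def measure_def emeasure_B)

lemma sets_\<mu> [measurable_cong, simp]: "sets (\<mu> i) = sets borel"
  and space_\<mu> [simp]: "space (\<mu> i) = UNIV"
  by (simp_all add: \<mu>_def)

lemma prob_space_\<mu>: "prob_space (\<mu> i)"
  unfolding \<mu>_def by (intro prob_space_uniform_measure emeasure_cell)

text \<open>A sample consists of countably many independent uniform points in each block; the point with
  index \<open>(i, n)\<close> is the \<open>n\<close>th one in \<open>B i\<close>.\<close>

definition "P = Pi\<^sub>M UNIV (\<lambda>u :: nat \<times> nat. \<mu> (fst u))"

sublocale sample: product_prob_space "\<lambda>u :: nat \<times> nat. \<mu> (fst u)" UNIV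
  rewrites "Pi\<^sub>M UNIV (\<lambda>u :: nat \<times> nat. \<mu> (fst u)) = P"
  by (intro product_prob_spaceI prob_space_\<mu>) (simp add: P_def)

lemma component_P: "(\<lambda>\<omega>. \<omega> u) \<in> borel_measurable P"
  unfolding P_def using measurable_component_singleton[of u UNIV "\<lambda>u :: nat \<times> nat. \<mu> (fst u)"]
  by (simp cong: measurable_cong_sets)

text \<open>Points of one block are exchangeable, being independent with the same law. This is used
  to swap two copies of a point.\<close>

lemma distr_P_reindex:
  assumes "inj \<phi>" "\<And>u. fst (\<phi> u) = fst u"
  shows "distr P P (\<lambda>\<omega> u. \<omega> (\<phi> u)) = P"
  using distr_PiM_reindex[of UNIV "\<lambda>u :: nat \<times> nat. \<mu> (fst u)" \<phi> UNIV] assms prob_space_\<mu>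
  by (simp add: P_def restrict_def)

lemma distr_P_pair:
  assumes "u \<noteq> v"
  shows "distr P (borel \<Otimes>\<^sub>M borel) (\<lambda>\<omega>. (\<omega> u, \<omega> v)) = \<mu> (fst u) \<Otimes>\<^sub>M \<mu> (fst v)"
  using sample.distr_PiM_pair[of u v] assms
  by (simp cong: distr_cong)

section \<open>Borel versions, and densities as expectations\<close>

text \<open>\<open>r\<close> is only Lebesgue measurable, so
  \<open>r (\<omega> u) (\<omega> v)\<close> need not be measurable on \<open>P\<close>;
  \<open>g\<close> is a Borel substitute. Its range and symmetry are required on the whole plane,
  which saves side conditions at every later use.\<close>

definition borel_version :: "(real \<Rightarrow> real \<Rightarrow> real) \<Rightarrow> (real \<Rightarrow> real \<Rightarrow> real) \<Rightarrow> bool" where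
  "borel_version r g \<longleftrightarrow> (\<lambda>(x, y). g x y) \<in> borel_measurable (borel \<Otimes>\<^sub>M borel) \<and>
     (\<forall>x y. g x y \<in> {0..1} \<and> g x y = g y x) \<and>
     (AE p in lborel. p \<in> {0..1} \<times> {0..1} \<longrightarrow> r (fst p) (snd p) = g (fst p) (snd p))"

lemma component_P_pair: "(\<lambda>\<omega>. (\<omega> u, \<omega> v)) \<in> P \<rightarrow>\<^sub>M borel \<Otimes>\<^sub>M borel"
  by (intro measurable_Pair component_P)

lemma borel_version_measurable:
  assumes "borel_version r g" and f: "f \<in> borel_measurable M" "f' \<in> borel_measurable M"
  shows "(\<lambda>x. g (f x) (f' x)) \<in> borel_measurable M"
proof -
  have "(\<lambda>x. case (f x, f' x) of (x, y) \<Rightarrow> g x y) \<in> borel_measurable M"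
    by (rule measurable_compose[OF measurable_Pair[OF f]])
      (use assms(1) in \<open>simp add: borel_version_def\<close>)
  then show ?thesis by simp
qed

lemma borel_version_range:
  assumes "borel_version r g"
  shows "0 \<le> g x y" "g x y \<le> 1"
  using assms unfolding borel_version_def by auto

lemma borel_version_sym: "borel_version r g \<Longrightarrow> g x y = g y x"
  unfolding borel_version_def by blast

lemma pair_\<mu>: "\<mu> i \<Otimes>\<^sub>M \<mu> j = uniform_measure lborel (cell i \<times> cell j)"
  unfolding \<mu>_def by (intro uniform_measure_times emeasure_cell) simp_all

lemma emeasure_cell_times:
  "emeasure lborel (cell i \<times> cell j) = emeasure lborel (cell i) * emeasure lborel (cell j)"
  unfolding lborel_prod[symmetric] by (intro lborel.emeasure_pair_measure_Times) auto

lemma emeasure_cell_times_nontrivial: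
  "emeasure lborel (cell i \<times> cell j) \<noteq> 0" "emeasure lborel (cell i \<times> cell j) \<noteq> \<infinity>"
  unfolding emeasure_cell_times using emeasure_cell[of i] emeasure_cell[of j]
  by (auto simp: ennreal_mult_eq_top_iff)

lemma AE_version_pair:
  assumes "borel_version r g"
  shows "AE p in \<mu> i \<Otimes>\<^sub>M \<mu> j. r (fst p) (snd p) = g (fst p) (snd p)"
  unfolding pair_\<mu>
proof (rule AE_uniform_measureI)
  show "cell i \<times> cell j \<in> sets lborel"
    by (simp add: borel_Times)
  have "cell n \<subseteq> {0..1}" for n using B_subset by (auto simp: cell_def)
  then show "AE p in lborel. p \<in> cell i \<times> cell j \<longrightarrow> r (fst p) (snd p) = g (fst p) (snd p)"
    using assms unfolding borel_version_def by (auto elim!: eventually_mono)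
qed

lemma integral_block_version:
  assumes rg: "borel_version r g" and ij: "i \<in> {1..k}" "j \<in> {1..k}"
    and uv: "u \<noteq> v" "fst u = i" "fst v = j" and f[measurable]: "f \<in> borel_measurable borel"
  shows "(LINT p : B i \<times> B j | lebesgue. f (r (fst p) (snd p))) =
    b i * b j * (\<integral>\<omega>. f (g (\<omega> u) (\<omega> v)) \<partial>P)"
proof -
  have B: "B i = cell i" "B j = cell j" using ij by (simp_all add: cell_def)
  have g: "(\<lambda>p. f (g (fst p) (snd p))) \<in> borel_measurable (borel \<Otimes>\<^sub>M borel)"
    by (rule measurable_compose[OF borel_version_measurable[OF rg] f]) auto
  have "(LINT p : cell i \<times> cell j | lebesgue. f (r (fst p) (snd p))) =
      measure lborel (cell i \<times> cell j) * integral\<^sup>L (\<mu> i \<Otimes>\<^sub>M \<mu> j) (\<lambda>p. f (g (fst p) (snd p)))"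
    unfolding pair_\<mu>
  proof (rule set_integral_completion[OF _ emeasure_cell_times_nontrivial])
    show "AE p in uniform_measure lborel (cell i \<times> cell j). f (r (fst p) (snd p)) = f (g (fst p) (snd p))"
      using AE_version_pair[OF rg, of i j] unfolding pair_\<mu> by eventually_elim simp
  qed (use g in \<open>auto simp: borel_Times borel_prod\<close>)
  also have "integral\<^sup>L (\<mu> i \<Otimes>\<^sub>M \<mu> j) (\<lambda>p. f (g (fst p) (snd p))) = (\<integral>\<omega>. f (g (\<omega> u) (\<omega> v)) \<partial>P)"
    unfolding uv(2,3)[symmetric] distr_P_pair[OF uv(1), symmetric]
    by (subst integral_distr[OF component_P_pair g]) simp
  also have "measure lborel (cell i \<times> cell j) = b i * b j"
    using emeasure_cell_times[of i j] b_pos ij measure_cell[of i] measure_cell[of j]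
    by (simp add: measure_def enn2real_mult less_imp_le)
  finally show ?thesis by (simp add: B)
qed

text \<open>The points \<open>us\<close> of a sample are independent and have the colors
  \<open>ls\<close>, so every density becomes an expectation over one and the same space
  \<open>P\<close>, where different graphs and matrices can be compared.\<close>

lemma hom_dens_version:
  assumes rg: "borel_version r g"
    and us: "distinct us" "length us = m" "length ls = m"
      "\<And>v. v < m \<Longrightarrow> fst (us ! v) = ls ! v" "\<And>v. v < m \<Longrightarrow> ls ! v \<in> {1..k}"
    and E: "finite E" "\<And>e. e \<in> E \<Longrightarrow> Min e < m \<and> Max e < m \<and> Min e \<noteq> Max e"
  shows "hom_dens B ls (m, E) r =
    (\<Prod>v<m. b (ls ! v)) * (\<integral>\<omega>. (\<Prod>e\<in>E. g (\<omega> (us ! Min e)) (\<omega> (us ! Max e))) \<partial>P)"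
proof -
  define A where "A v = cell (fst (us ! v))" for v
  define M where "M = Pi\<^sub>M {..<m} (\<lambda>_. lborel :: real measure)"
  define U where "U = Pi\<^sub>M {..<m} (\<lambda>v. \<mu> (fst (us ! v)))"
  interpret L: product_sigma_finite "\<lambda>_ :: nat. lborel :: real measure"
    by (simp add: product_sigma_finite_def sigma_finite_lborel)
  interpret U: product_prob_space "\<lambda>v. \<mu> (fst (us ! v))" "{..<m}"
    by (intro product_prob_spaceI prob_space_\<mu>)
  have unif: "uniform_measure M (Pi\<^sub>E {..<m} A) = U"
    unfolding M_def U_def A_def \<mu>_def
    by (intro uniform_measure_Pi emeasure_cell sigma_finite_lborel) auto
  have emM: "emeasure M (Pi\<^sub>E {..<m} A) = (\<Prod>v<m. emeasure lborel (A v))"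
    unfolding M_def by (intro L.emeasure_PiM) (auto simp: A_def)
  have sets: "Pi\<^sub>E {..<m} A \<in> sets M"
    unfolding M_def by (intro sets_PiM_I_finite) (auto simp: A_def)
  let ?G = "\<lambda>x. \<Prod>e\<in>E. g (x (Min e)) (x (Max e))"
  have G: "?G \<in> borel_measurable M"
  proof (intro borel_measurable_prod borel_version_measurable[OF rg])
    fix e assume "e \<in> E"
    with E(2) have "Min e \<in> {..<m}" "Max e \<in> {..<m}" by auto
    then show "(\<lambda>x. x (Min e)) \<in> borel_measurable M" "(\<lambda>x. x (Max e)) \<in> borel_measurable M"
      using measurable_component_singleton[of _ "{..<m}" "\<lambda>_. lborel :: real measure"] by (auto simp: M_def)
  qed
  have "hom_dens B ls (m, E) r =
      (LINT x : (Pi\<^sub>E {..<m} A) | completion M. \<Prod>e\<in>E. r (x (Min e)) (x (Max e)))"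
  proof -
    have "(\<Pi>\<^sub>E v\<in>{..<m}. B (ls ! v)) = Pi\<^sub>E {..<m} A"
      using us by (intro PiE_cong) (simp add: A_def cell_def)
    then show ?thesis by (simp add: hom_dens_def M_def)
  qed
  also have "\<dots> = measure M (Pi\<^sub>E {..<m} A) * integral\<^sup>L U ?G"
    unfolding unif[symmetric]
  proof (rule set_integral_completion[OF sets _ _ G])
    show "emeasure M (Pi\<^sub>E {..<m} A) \<noteq> 0" "emeasure M (Pi\<^sub>E {..<m} A) \<noteq> \<infinity>"
      using emeasure_cell by (auto simp: emM A_def ennreal_prod_eq_top)
    \<comment> \<open>The two ends of an edge are different coordinates, so their joint law is
      uniform on a product of cells, where \<open>r\<close> and \<open>g\<close> agree almost
      everywhere. A loop would read the diagonal, where they may differ.\<close>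
    have "AE x in U. \<forall>e\<in>E. r (x (Min e)) (x (Max e)) = g (x (Min e)) (x (Max e))"
    proof (rule AE_finite_allI[OF E(1)])
      fix e assume "e \<in> E"
      then have e: "Min e \<in> {..<m}" "Max e \<in> {..<m}" "Min e \<noteq> Max e" using E(2) by auto
      have "AE p in distr U (\<mu> (fst (us ! Min e)) \<Otimes>\<^sub>M \<mu> (fst (us ! Max e))) (\<lambda>x. (x (Min e), x (Max e))).
          r (fst p) (snd p) = g (fst p) (snd p)"
        unfolding U_def U.distr_PiM_pair[OF e] by (rule AE_version_pair[OF rg])
      from AE_distrD[OF _ this]
      show "AE x in U. r (x (Min e)) (x (Max e)) = g (x (Min e)) (x (Max e))"
        using e by (auto simp: U_def)
    qed
    then show "AE x in uniform_measure M (Pi\<^sub>E {..<m} A). (\<Prod>e\<in>E. r (x (Min e)) (x (Max e))) = ?G x"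
      unfolding unif by eventually_elim (auto intro: prod.cong)
  qed
  also have "measure M (Pi\<^sub>E {..<m} A) = (\<Prod>v<m. b (ls ! v))"
  proof -
    have "emeasure M (Pi\<^sub>E {..<m} A) = (\<Prod>v<m. ennreal (b (ls ! v)))"
      unfolding emM using us by (intro prod.cong) (auto simp: A_def cell_def emeasure_B)
    also have "\<dots> = ennreal (\<Prod>v<m. b (ls ! v))"
      using us(5) b_pos by (intro prod_ennreal) (auto intro: less_imp_le)
    finally show ?thesis
      using us(5) b_pos by (simp add: measure_def) (intro enn2real_ennreal prod_nonneg, auto intro: less_imp_le)
  qed
  also have "integral\<^sup>L U ?G = (\<integral>\<omega>. (\<Prod>e\<in>E. g (\<omega> (us ! Min e)) (\<omega> (us ! Max e))) \<partial>P)"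
  proof -
    have "inj_on ((!) us) {..<m}" using us by (auto simp: inj_on_nth)
    then have "distr P U (\<lambda>\<omega>. \<lambda>n\<in>{..<m}. \<omega> (us ! n)) = U"
      unfolding P_def U_def by (intro distr_PiM_reindex prob_space_\<mu>) auto
    then have "integral\<^sup>L U ?G = integral\<^sup>L (distr P U (\<lambda>\<omega>. \<lambda>n\<in>{..<m}. \<omega> (us ! n))) ?G"
      by simp
    also have "\<dots> = (\<integral>\<omega>. ?G (\<lambda>n\<in>{..<m}. \<omega> (us ! n)) \<partial>P)"
    proof (rule integral_distr)
      show "(\<lambda>\<omega>. \<lambda>n\<in>{..<m}. \<omega> (us ! n)) \<in> P \<rightarrow>\<^sub>M U"
        unfolding U_def by (intro measurable_restrict) (simp add: component_P cong: measurable_cong_sets)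
      show "?G \<in> borel_measurable U"
        using G unfolding unif[symmetric] by (simp cong: measurable_cong_sets)
    qed
    also have "\<dots> = (\<integral>\<omega>. (\<Prod>e\<in>E. g (\<omega> (us ! Min e)) (\<omega> (us ! Max e))) \<partial>P)"
      using E(2) by (intro Bochner_Integration.integral_cong prod.cong) auto
    finally show ?thesis .
  qed
  finally show ?thesis .
qed

lemma borel_version_exists:
  assumes r: "r \<in> graphons"
  shows "\<exists>g. borel_version r g"
proof -
  let ?S = "{0..1} \<times> {0..1} :: (real \<times> real) set"
  have "(\<lambda>p. if p \<in> ?S then r (fst p) (snd p) else 0) \<in> borel_measurable lebesgue"
  proof (rule borel_measurable_if_I)
    show "(\<lambda>p. r (fst p) (snd p)) \<in> borel_measurable (lebesgue_on ?S)"
      using r by (simp add: graphons_def case_prod_beta')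
    have "?S \<in> sets lborel" by (simp add: borel_Times)
    then show "?S \<in> sets lebesgue" by (rule sets_completionI_sets)
  qed
  from completion_ex_borel_measurable_real[OF this] obtain g0 where
    g0: "g0 \<in> borel_measurable (lborel :: (real \<times> real) measure)"
    and ae: "AE p in lborel. (if p \<in> ?S then r (fst p) (snd p) else 0) = g0 p" by blast
  have g0': "(\<lambda>(x, y). g0 (x, y)) \<in> borel_measurable (borel \<Otimes>\<^sub>M borel)"
    using g0 by (simp add: borel_prod)
  \<comment> \<open>Averaging with the transpose gives symmetry, clamping gives the range. Both
    leave the value unchanged at points of the square where \<open>g0\<close> equals
    \<open>r\<close> at the point and at its reflection; the latter is \<open>ae'\<close>.\<close>
  define g where "g x y = max 0 (min 1 ((g0 (x, y) + g0 (y, x)) / 2))" for x y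
  have "pair_sigma_finite (lborel :: real measure) (lborel :: real measure)" ..
  note swap = pair_sigma_finite.distr_pair_swap[OF this]
  have "AE p in distr (lborel \<Otimes>\<^sub>M lborel) (lborel \<Otimes>\<^sub>M lborel) (\<lambda>(x, y). (y, x)).
      (if p \<in> ?S then r (fst p) (snd p) else 0) = g0 p"
    using ae by (simp only: swap[unfolded lborel_prod, symmetric] lborel_prod)
  from AE_distrD[OF measurable_pair_swap' this]
  have ae': "AE p in lborel. (if (snd p, fst p) \<in> ?S then r (snd p) (fst p) else 0) = g0 (snd p, fst p)"
    unfolding lborel_prod
  proof eventually_elim
    case (elim p)
    obtain x y where "p = (x, y)" by fastforce
    with elim show ?case by (auto split: if_splits)
  qed
  have "AE p in lborel. p \<in> ?S \<longrightarrow> r (fst p) (snd p) = g (fst p) (snd p)"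
    using ae ae'
  proof eventually_elim
    case (elim p)
    show ?case
    proof
      assume p: "p \<in> ?S"
      then have "r (fst p) (snd p) \<in> {0..1}" "r (fst p) (snd p) = r (snd p) (fst p)"
        using r by (auto simp: graphons_def)
      then show "r (fst p) (snd p) = g (fst p) (snd p)"
        using elim p by (auto simp: g_def)
    qed
  qed
  moreover have "(\<lambda>(x, y). g x y) \<in> borel_measurable (borel \<Otimes>\<^sub>M borel)"
  proof -
    have [measurable]: "g0 \<in> borel_measurable (borel \<Otimes>\<^sub>M borel)" using g0' by simp
    show ?thesis unfolding g_def by measurable
  qed
  moreover have "\<forall>x y. g x y \<in> {0..1} \<and> g x y = g y x"
    by (auto simp: g_def add.commute)
  ultimately show ?thesis unfolding borel_version_def by blast
qed

lemma P_integrable: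
  fixes F :: "_ \<Rightarrow> real"
  assumes "F \<in> borel_measurable P" "\<And>\<omega>. \<bar>F \<omega>\<bar> \<le> K"
  shows "integrable P F"
  using assms by (intro sample.P.integrable_const_bound[of _ K]) auto

lemma integral_P_pair:
  fixes F :: "real \<times> real \<Rightarrow> real"
  assumes "u \<noteq> v" "F \<in> borel_measurable (borel \<Otimes>\<^sub>M borel)"
  shows "(\<integral>\<omega>. F (\<omega> u, \<omega> v) \<partial>P) = integral\<^sup>L (\<mu> (fst u) \<Otimes>\<^sub>M \<mu> (fst v)) F"
  using integral_distr[OF component_P_pair[of u v] assms(2)] by (simp add: distr_P_pair[OF assms(1)])

text \<open>By Fubini the first pair can be frozen at a typical point, and \<open>F\<close> at the
  second pair then almost surely takes the fixed value found there. The law of the four coordinates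
  is split into two independent pairs by \<open>merge\<close>.\<close>

lemma AE_const_of_independent_copy:
  fixes F :: "real \<times> real \<Rightarrow> real"
  assumes F: "F \<in> borel_measurable (borel \<Otimes>\<^sub>M borel)" and dist: "distinct [u, v, u', v']"
    and eq: "AE \<omega> in P. F (\<omega> u, \<omega> v) = F (\<omega> u', \<omega> v')"
  shows "\<exists>c. AE p in \<mu> (fst u') \<Otimes>\<^sub>M \<mu> (fst v'). F p = c"
proof -
  let ?M = "\<lambda>u :: nat \<times> nat. \<mu> (fst u)"
  define I where "I = {u, v}"
  define J where "J = {u', v'}"
  interpret I: product_prob_space ?M I by (intro product_prob_spaceI prob_space_\<mu>)
  interpret J: product_prob_space ?M J by (intro product_prob_spaceI prob_space_\<mu>)
  have IJ: "I \<inter> J = {}" "finite I" "finite J" using dist by (auto simp: I_def J_def)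
  have [measurable]: "(\<lambda>x. x n) \<in> borel_measurable (Pi\<^sub>M K ?M)" if "n \<in> K" for n K
    using measurable_component_singleton[OF that, of ?M] by (simp cong: measurable_cong_sets)
  have meas: "(\<lambda>x. F (x n, x n')) \<in> borel_measurable (Pi\<^sub>M K ?M)" if "n \<in> K" "n' \<in> K" for n n' K
    using that by (intro measurable_compose[OF measurable_Pair F]) auto
  have restr: "distr P (Pi\<^sub>M (I \<union> J) ?M) (\<lambda>\<omega>. restrict \<omega> (I \<union> J)) = Pi\<^sub>M (I \<union> J) ?M"
    using sample.distr_PiM_restrict_finite[of "I \<union> J"] IJ by simp
  have "AE x in distr P (Pi\<^sub>M (I \<union> J) ?M) (\<lambda>\<omega>. restrict \<omega> (I \<union> J)). F (x u, x v) = F (x u', x v')"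
  proof (subst AE_distr_iff)
    show "(\<lambda>\<omega>. restrict \<omega> (I \<union> J)) \<in> P \<rightarrow>\<^sub>M Pi\<^sub>M (I \<union> J) ?M"
      unfolding P_def by (rule measurable_restrict_subset) auto
    show "{x \<in> space (Pi\<^sub>M (I \<union> J) ?M). F (x u, x v) = F (x u', x v')} \<in> sets (Pi\<^sub>M (I \<union> J) ?M)"
      by (intro borel_measurable_eq meas) (auto simp: I_def J_def)
    show "AE \<omega> in P. F (restrict \<omega> (I \<union> J) u, restrict \<omega> (I \<union> J) v) =
        F (restrict \<omega> (I \<union> J) u', restrict \<omega> (I \<union> J) v')"
      using eq by (simp add: I_def J_def)
  qed
  then have "AE x in distr (Pi\<^sub>M I ?M \<Otimes>\<^sub>M Pi\<^sub>M J ?M) (Pi\<^sub>M (I \<union> J) ?M) (merge I J).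
      F (x u, x v) = F (x u', x v')"
    unfolding restr sample.distr_merge[OF IJ] .
  from AE_distrD[OF measurable_merge this]
  have "AE z in Pi\<^sub>M I ?M \<Otimes>\<^sub>M Pi\<^sub>M J ?M. F (fst z u, fst z v) = F (snd z u', snd z v')"
    using dist by (auto simp: merge_def I_def J_def case_prod_beta)
  then have "AE x in Pi\<^sub>M I ?M. AE y in Pi\<^sub>M J ?M. F (x u, x v) = F (y u', y v')"
    using pair_sigma_finite.AE_pair[OF pair_sigma_finite.intro[OF I.P.sigma_finite_measure_axioms
          J.P.sigma_finite_measure_axioms]] by fastforce
  then obtain x where "AE y in Pi\<^sub>M J ?M. F (x u, x v) = F (y u', y v')"
    using eventually_happens'[OF I.P.ae_filter_bot] by blast
  then have "AE p in distr (Pi\<^sub>M J ?M) (?M u' \<Otimes>\<^sub>M ?M v') (\<lambda>\<omega>. (\<omega> u', \<omega> v')). F p = F (x u, x v)"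
  proof (subst AE_distr_iff)
    show "(\<lambda>\<omega>. (\<omega> u', \<omega> v')) \<in> Pi\<^sub>M J ?M \<rightarrow>\<^sub>M ?M u' \<Otimes>\<^sub>M ?M v'"
      by (intro measurable_Pair measurable_component_singleton) (auto simp: J_def)
    have "F \<in> borel_measurable (?M u' \<Otimes>\<^sub>M ?M v')"
      using F by (simp cong: measurable_cong_sets sets_pair_measure_cong)
    then show "{p \<in> space (?M u' \<Otimes>\<^sub>M ?M v'). F p = F (x u, x v)} \<in> sets (?M u' \<Otimes>\<^sub>M ?M v')"
      by (intro borel_measurable_eq) auto
  qed (auto elim!: eventually_mono)
  moreover have "distr (Pi\<^sub>M J ?M) (?M u' \<Otimes>\<^sub>M ?M v') (\<lambda>\<omega>. (\<omega> u', \<omega> v')) = ?M u' \<Otimes>\<^sub>M ?M v'"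
    by (rule J.distr_PiM_pair) (use dist in \<open>auto simp: J_def\<close>)
  ultimately have "AE p in ?M u' \<Otimes>\<^sub>M ?M v'. F p = F (x u, x v)"
    by (simp only:)
  then show ?thesis by (rule exI)
qed

end

section \<open>The sampling bound\<close>

locale block_problem = block_partition k b B + ferromagnetic k b \<alpha> h
  for k :: nat and b :: "nat \<Rightarrow> real" and B :: "nat \<Rightarrow> real set"
    and \<alpha> :: "nat \<Rightarrow> nat \<Rightarrow> nat \<Rightarrow> real" and h :: "nat \<Rightarrow> nat \<Rightarrow> real"
begin

section \<open>Triangle expectations and AM-GM errors\<close>

definition objective :: "(real \<Rightarrow> real \<Rightarrow> real) \<Rightarrow> real" where
  "objective g = energy_functional k B \<alpha> h g - 1 / 2 * entropy_functional k B g"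

definition tri :: "(real \<Rightarrow> real \<Rightarrow> real) \<Rightarrow> nat \<times> nat \<Rightarrow> nat \<times> nat \<Rightarrow> nat \<times> nat \<Rightarrow>
    (nat \<times> nat \<Rightarrow> real) \<Rightarrow> real" where
  "tri g u v w \<omega> = g (\<omega> u) (\<omega> v) * g (\<omega> u) (\<omega> w) * g (\<omega> v) (\<omega> w)"

text \<open>The random block matrix read off from a sample. Point number \<open>p i\<close> represents block \<open>i\<close>; point
  number \<open>q i\<close> serves as a second point of block \<open>i\<close> for the diagonal entry.\<close>

definition sample_matrix :: "(real \<Rightarrow> real \<Rightarrow> real) \<Rightarrow> (nat \<Rightarrow> nat) \<Rightarrow> (nat \<Rightarrow> nat) \<Rightarrow>
    (nat \<times> nat \<Rightarrow> real) \<Rightarrow> nat \<Rightarrow> nat \<Rightarrow> real" where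
  "sample_matrix g p q \<omega> i j =
    (if i = j then g (\<omega> (i, p i)) (\<omega> (i, q i)) else g (\<omega> (i, p i)) (\<omega> (j, p j)))"

context
  fixes r g :: "real \<Rightarrow> real \<Rightarrow> real"
  assumes rg: "borel_version r g"
begin

private lemmas g_range = borel_version_range[OF rg] and g_sym = borel_version_sym[OF rg]

lemma sample_entry_measurable [measurable]: "(\<lambda>\<omega>. g (\<omega> u) (\<omega> v)) \<in> borel_measurable P"
  by (intro borel_version_measurable[OF rg] component_P)

lemma borel_version_abs_le: "\<bar>g x y\<bar> \<le> 1"
  using g_range by (simp add: abs_le_iff order_trans[of _ 0])

lemma tri_integrable: "integrable P (tri g u v w)"
  unfolding tri_def
  by (rule P_integrable[of _ 1]) (auto simp: abs_mult intro!: mult_le_one borel_version_abs_le)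

lemma hom_dens_triangle:
  assumes "distinct [u, v, w]" "fst u \<in> {1..k}" "fst v \<in> {1..k}" "fst w \<in> {1..k}"
  shows "hom_dens B [fst u, fst v, fst w] triangle_graph r =
    b (fst u) * b (fst v) * b (fst w) * (\<integral>\<omega>. tri g u v w \<omega> \<partial>P)"
proof -
  have less3: "n < 3 \<longleftrightarrow> n = 0 \<or> n = 1 \<or> n = 2" for n :: nat by auto
  have "hom_dens B [fst u, fst v, fst w] triangle_graph r =
    (\<Prod>n<3. b ([fst u, fst v, fst w] ! n)) *
    (\<integral>\<omega>. (\<Prod>e\<in>{{0, 1}, {0, 2}, {1, 2}}. g (\<omega> ([u, v, w] ! Min e)) (\<omega> ([u, v, w] ! Max e))) \<partial>P)"
    unfolding triangle_graph_def using assms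
    by (intro hom_dens_version[OF rg]) (auto simp: less3)
  \<comment> \<open>The three edges are distinct sets, so the product over the edge set really has
    three factors.\<close>
  moreover have "{0, 1} \<noteq> {0, 2 :: nat}" "{0, 1} \<noteq> {1, 2 :: nat}" "{0, 2} \<noteq> {1, 2 :: nat}"
    by (auto simp: doubleton_eq_iff)
  ultimately show ?thesis
    by (simp add: tri_def eval_nat_numeral lessThan_Suc mult_ac)
qed

lemma hom_dens_edge:
  assumes "u \<noteq> v" "fst u \<in> {1..k}" "fst v \<in> {1..k}"
  shows "hom_dens B [fst u, fst v] single_edge_graph r =
    b (fst u) * b (fst v) * (\<integral>\<omega>. g (\<omega> u) (\<omega> v) \<partial>P)"
proof -
  have less2: "n < 2 \<longleftrightarrow> n = 0 \<or> n = 1" for n :: nat by auto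
  have "hom_dens B [fst u, fst v] single_edge_graph r =
    (\<Prod>n<2. b ([fst u, fst v] ! n)) *
    (\<integral>\<omega>. (\<Prod>e\<in>{{0, 1}}. g (\<omega> ([u, v] ! Min e)) (\<omega> ([u, v] ! Max e))) \<partial>P)"
    unfolding single_edge_graph_def using assms
    by (intro hom_dens_version[OF rg]) (auto simp: less2)
  then show ?thesis
    by (simp add: eval_nat_numeral lessThan_Suc mult_ac)
qed

lemma integral_g_cong:
  fixes f :: "real \<Rightarrow> real"
  assumes "u \<noteq> v" "u' \<noteq> v'" "fst u = fst u'" "fst v = fst v'" and f: "f \<in> borel_measurable borel"
  shows "(\<integral>\<omega>. f (g (\<omega> u) (\<omega> v)) \<partial>P) = (\<integral>\<omega>. f (g (\<omega> u') (\<omega> v')) \<partial>P)"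
proof -
  have m: "(\<lambda>p. f (g (fst p) (snd p))) \<in> borel_measurable (borel \<Otimes>\<^sub>M borel)"
    by (rule measurable_compose[OF borel_version_measurable[OF rg] f]) auto
  show ?thesis
    using integral_P_pair[OF assms(1) m] integral_P_pair[OF assms(2) m] assms(3,4) by simp
qed

text \<open>Both expectations equal the density of the triangle with these colors divided by the
  positive product of the block lengths.\<close>

lemma integral_tri_cong:
  assumes "distinct [u, v, w]" "distinct [u', v', w']"
    "fst u = fst u'" "fst v = fst v'" "fst w = fst w'"
    "fst u \<in> {1..k}" "fst v \<in> {1..k}" "fst w \<in> {1..k}"
  shows "(\<integral>\<omega>. tri g u v w \<omega> \<partial>P) = (\<integral>\<omega>. tri g u' v' w' \<omega> \<partial>P)"
  using hom_dens_triangle[of u v w] hom_dens_triangle[of u' v' w'] assms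
    b_pos[of "fst u"] b_pos[of "fst v"] b_pos[of "fst w"] by auto

text \<open>Two copies of a point in a repeated block: AM-GM with its defect, once the two mixed moments
  are identified by exchanging the copies.\<close>

lemma integral_tri_repeated:
  assumes "distinct [u, v, w]" "fst u = fst v"
  shows "(\<integral>\<omega>. g (\<omega> u) (\<omega> v) * (g (\<omega> u) (\<omega> w))\<^sup>2 \<partial>P) = (\<integral>\<omega>. tri g u v w \<omega> \<partial>P) +
    1 / 2 * (\<integral>\<omega>. g (\<omega> u) (\<omega> v) * (g (\<omega> u) (\<omega> w) - g (\<omega> v) (\<omega> w))\<^sup>2 \<partial>P)"
proof -
  define X where "X \<omega> = g (\<omega> u) (\<omega> v)" for \<omega> :: "nat \<times> nat \<Rightarrow> real"
  define Y where "Y \<omega> = g (\<omega> u) (\<omega> w)" for \<omega> :: "nat \<times> nat \<Rightarrow> real"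
  define Z where "Z \<omega> = g (\<omega> v) (\<omega> w)" for \<omega> :: "nat \<times> nat \<Rightarrow> real"
  have [measurable]: "X \<in> borel_measurable P" "Y \<in> borel_measurable P" "Z \<in> borel_measurable P"
    unfolding X_def Y_def Z_def by measurable
  have rng: "0 \<le> X \<omega>" "X \<omega> \<le> 1" "0 \<le> Y \<omega>" "Y \<omega> \<le> 1" "0 \<le> Z \<omega>" "Z \<omega> \<le> 1" for \<omega>
    by (simp_all add: X_def Y_def Z_def g_range)
  have int: "integrable P (\<lambda>\<omega>. X \<omega> * (Y \<omega>)\<^sup>2)" "integrable P (\<lambda>\<omega>. X \<omega> * (Z \<omega>)\<^sup>2)"
    "integrable P (\<lambda>\<omega>. X \<omega> * Y \<omega> * Z \<omega>)"
    by (rule P_integrable[of _ 1]; auto simp: abs_mult rng power_le_one intro!: mult_le_one)+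
  \<comment> \<open>Exchanging \<open>u\<close> and \<open>v\<close> fixes \<open>X\<close>, by
    symmetry of \<open>g\<close>, and turns \<open>Y\<close> into \<open>Z\<close>.\<close>
  define \<phi> where "\<phi> x = (if x = u then v else if x = v then u else x)" for x
  have \<phi>: "inj \<phi>" "\<And>x. fst (\<phi> x) = fst x"
    using assms(2) by (auto simp: \<phi>_def inj_on_def)
  have "(\<integral>\<omega>. X \<omega> * (Y \<omega>)\<^sup>2 \<partial>P) = (\<integral>\<omega>. X \<omega> * (Y \<omega>)\<^sup>2 \<partial>distr P P (\<lambda>\<omega> u. \<omega> (\<phi> u)))"
    by (simp add: distr_P_reindex[OF \<phi>])
  also have "\<dots> = (\<integral>\<omega>. X (\<lambda>u. \<omega> (\<phi> u)) * (Y (\<lambda>u. \<omega> (\<phi> u)))\<^sup>2 \<partial>P)"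
  proof (rule integral_distr)
    show "(\<lambda>\<omega> u. \<omega> (\<phi> u)) \<in> P \<rightarrow>\<^sub>M P"
      unfolding P_def
      by (rule measurable_PiM_single')
        (use component_P in \<open>auto simp: P_def space_PiM cong: measurable_cong_sets\<close>)
  qed simp
  also have "\<dots> = (\<integral>\<omega>. X \<omega> * (Z \<omega>)\<^sup>2 \<partial>P)"
    using assms(1) g_sym by (auto simp: X_def Y_def Z_def \<phi>_def intro!: Bochner_Integration.integral_cong)
  finally have swap: "(\<integral>\<omega>. X \<omega> * (Y \<omega>)\<^sup>2 \<partial>P) = (\<integral>\<omega>. X \<omega> * (Z \<omega>)\<^sup>2 \<partial>P)" .
  have "(\<integral>\<omega>. X \<omega> * (Y \<omega> - Z \<omega>)\<^sup>2 \<partial>P) =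
      (\<integral>\<omega>. X \<omega> * (Y \<omega>)\<^sup>2 + X \<omega> * (Z \<omega>)\<^sup>2 - 2 * (X \<omega> * Y \<omega> * Z \<omega>) \<partial>P)"
    by (intro Bochner_Integration.integral_cong) (auto simp: power2_eq_square algebra_simps)
  also have "\<dots> = 2 * (\<integral>\<omega>. X \<omega> * (Y \<omega>)\<^sup>2 \<partial>P) - 2 * (\<integral>\<omega>. X \<omega> * Y \<omega> * Z \<omega> \<partial>P)"
    using int swap by simp
  finally have "(\<integral>\<omega>. X \<omega> * (Y \<omega>)\<^sup>2 \<partial>P) = (\<integral>\<omega>. X \<omega> * Y \<omega> * Z \<omega> \<partial>P) +
      1 / 2 * (\<integral>\<omega>. X \<omega> * (Y \<omega> - Z \<omega>)\<^sup>2 \<partial>P)"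
    by linarith
  then show ?thesis
    unfolding X_def Y_def Z_def tri_def .
qed

text \<open>The identity behind AM-GM for three numbers:
  \<open>2 * (X^3 + Y^3 + Z^3 - 3 * X * Y * Z)\<close> is \<open>X + Y + Z\<close> times the sum of
  the squared differences. The three third moments agree because the points have one color, so the
  expectation is 6 times the gap, whence 1/6.\<close>

lemma integral_tri_monochromatic:
  assumes "distinct [u, v, w]" "fst u = fst v" "fst v = fst w"
  shows "(\<integral>\<omega>. g (\<omega> u) (\<omega> v) ^ 3 \<partial>P) = (\<integral>\<omega>. tri g u v w \<omega> \<partial>P) +
    1 / 6 * (\<integral>\<omega>. (g (\<omega> u) (\<omega> v) + g (\<omega> u) (\<omega> w) + g (\<omega> v) (\<omega> w)) *
      ((g (\<omega> u) (\<omega> v) - g (\<omega> u) (\<omega> w))\<^sup>2 + (g (\<omega> u) (\<omega> v) - g (\<omega> v) (\<omega> w))\<^sup>2 +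
       (g (\<omega> u) (\<omega> w) - g (\<omega> v) (\<omega> w))\<^sup>2) \<partial>P)"
proof -
  define X where "X \<omega> = g (\<omega> u) (\<omega> v)" for \<omega> :: "nat \<times> nat \<Rightarrow> real"
  define Y where "Y \<omega> = g (\<omega> u) (\<omega> w)" for \<omega> :: "nat \<times> nat \<Rightarrow> real"
  define Z where "Z \<omega> = g (\<omega> v) (\<omega> w)" for \<omega> :: "nat \<times> nat \<Rightarrow> real"
  have [measurable]: "X \<in> borel_measurable P" "Y \<in> borel_measurable P" "Z \<in> borel_measurable P"
    unfolding X_def Y_def Z_def by measurable
  have rng: "0 \<le> X \<omega>" "X \<omega> \<le> 1" "0 \<le> Y \<omega>" "Y \<omega> \<le> 1" "0 \<le> Z \<omega>" "Z \<omega> \<le> 1" for \<omega>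
    by (simp_all add: X_def Y_def Z_def g_range)
  have int: "integrable P (\<lambda>\<omega>. X \<omega> ^ 3)" "integrable P (\<lambda>\<omega>. Y \<omega> ^ 3)" "integrable P (\<lambda>\<omega>. Z \<omega> ^ 3)"
    "integrable P (\<lambda>\<omega>. X \<omega> * Y \<omega> * Z \<omega>)"
    by (rule P_integrable[of _ 1]; auto simp: abs_mult power_abs rng power_le_one intro!: mult_le_one)+
  have eq: "(\<integral>\<omega>. Y \<omega> ^ 3 \<partial>P) = (\<integral>\<omega>. X \<omega> ^ 3 \<partial>P)" "(\<integral>\<omega>. Z \<omega> ^ 3 \<partial>P) = (\<integral>\<omega>. X \<omega> ^ 3 \<partial>P)"
    unfolding X_def Y_def Z_def
    using assms by (auto intro!: integral_g_cong[where f = "\<lambda>x. x ^ 3"])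
  have "(\<integral>\<omega>. (X \<omega> + Y \<omega> + Z \<omega>) * ((X \<omega> - Y \<omega>)\<^sup>2 + (X \<omega> - Z \<omega>)\<^sup>2 + (Y \<omega> - Z \<omega>)\<^sup>2) \<partial>P) =
      (\<integral>\<omega>. 2 * (X \<omega> ^ 3) + 2 * (Y \<omega> ^ 3) + 2 * (Z \<omega> ^ 3) - 6 * (X \<omega> * Y \<omega> * Z \<omega>) \<partial>P)"
    by (intro Bochner_Integration.integral_cong) (auto simp: power2_eq_square power3_eq_cube algebra_simps)
  also have "\<dots> = 6 * (\<integral>\<omega>. X \<omega> ^ 3 \<partial>P) - 6 * (\<integral>\<omega>. X \<omega> * Y \<omega> * Z \<omega> \<partial>P)"
    using int eq by simp
  finally have "(\<integral>\<omega>. X \<omega> ^ 3 \<partial>P) = (\<integral>\<omega>. X \<omega> * Y \<omega> * Z \<omega> \<partial>P) +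
      1 / 6 * (\<integral>\<omega>. (X \<omega> + Y \<omega> + Z \<omega>) * ((X \<omega> - Y \<omega>)\<^sup>2 + (X \<omega> - Z \<omega>)\<^sup>2 + (Y \<omega> - Z \<omega>)\<^sup>2) \<partial>P)"
    by linarith
  then show ?thesis
    unfolding X_def Y_def Z_def tri_def .
qed

lemma sample_matrix_C_sym: "sample_matrix g p q \<omega> \<in> C_sym k"
  using g_range g_sym by (auto simp: C_sym_def sample_matrix_def)

lemma sample_matrix_meas [measurable]: "(\<lambda>\<omega>. sample_matrix g p q \<omega> i j) \<in> borel_measurable P"
  unfolding sample_matrix_def by (cases "i = j") (simp_all add: sample_entry_measurable)

lemma sample_matrix_range: "0 \<le> sample_matrix g p q \<omega> i j" "sample_matrix g p q \<omega> i j \<le> 1"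
  by (simp_all add: sample_matrix_def g_range)

lemma integral_sample_matrix:
  fixes f :: "real \<Rightarrow> real"
  assumes "\<And>i. p i \<noteq> q i" and f: "f \<in> borel_measurable borel"
  shows "(\<integral>\<omega>. f (sample_matrix g p q \<omega> i j) \<partial>P) = (\<integral>\<omega>. f (g (\<omega> (i, 0)) (\<omega> (j, 1))) \<partial>P)"
proof (cases "i = j")
  case True
  with assms show ?thesis
    by (simp add: sample_matrix_def) (intro integral_g_cong; simp)
next
  case False
  with assms show ?thesis
    by (simp add: sample_matrix_def) (intro integral_g_cong; simp)
qed

text \<open>Three different colors use three independent points, with equality. When a color is
  repeated, the matrix uses one entry several times where the density reads \<open>g\<close> at
  different copies, and the error formulas give the sign.\<close>

lemma integral_tri_le:
  assumes ijl: "i \<in> {1..k}" "j \<in> {1..k}" "l \<in> {1..k}" and pq: "\<And>i. p i \<noteq> q i"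
  shows "(\<integral>\<omega>. tri g (i, 0) (j, 1) (l, 2) \<omega> \<partial>P) \<le>
    (\<integral>\<omega>. sample_matrix g p q \<omega> i j * sample_matrix g p q \<omega> i l * sample_matrix g p q \<omega> j l \<partial>P)"
    (is "?T \<le> ?C")
proof -
  have perm: "tri g u v w = tri g v u w" "tri g u v w = tri g u w v" for u v w
    using g_sym by (auto simp: tri_def fun_eq_iff mult_ac)
  have T: "?T = (\<integral>\<omega>. tri g (i, x) (j, y) (l, z) \<omega> \<partial>P)" if "distinct [(i, x), (j, y), (l, z)]" for x y z
    by (rule integral_tri_cong) (use ijl that in auto)
  have defect: "0 \<le> (\<integral>\<omega>. g (\<omega> u) (\<omega> v) * (g (\<omega> u) (\<omega> w) - g (\<omega> v) (\<omega> w))\<^sup>2 \<partial>P)" for u v w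
    by (intro integral_nonneg_AE AE_I2 mult_nonneg_nonneg g_range zero_le_power2)
  have repeated: "(\<integral>\<omega>. tri g (m, p m) (m, q m) (n, p n) \<omega> \<partial>P) \<le>
      (\<integral>\<omega>. g (\<omega> (m, p m)) (\<omega> (m, q m)) * (g (\<omega> (m, p m)) (\<omega> (n, p n)))\<^sup>2 \<partial>P)" if "m \<noteq> n" for m n
    using integral_tri_repeated[of "(m, p m)" "(m, q m)" "(n, p n)"] that pq[of m] defect by simp
  consider "i \<noteq> j" "i \<noteq> l" "j \<noteq> l" | "i = j" "i \<noteq> l" | "i \<noteq> j" "j = l" | "i = l" "i \<noteq> j" | "i = j" "i = l"
    by blast
  then show ?thesis
  proof cases
    case 1
    then have "?T = (\<integral>\<omega>. tri g (i, p i) (j, p j) (l, p l) \<omega> \<partial>P)"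
      by (intro T) auto
    also have "\<dots> = ?C"
      using 1 by (intro Bochner_Integration.integral_cong) (auto simp: sample_matrix_def tri_def)
    finally show ?thesis by simp
  next
    case 2
    then show ?thesis
      using repeated[of i l] pq[of i] by (subst T[of "p i" "q i" "p l"])
        (auto simp: sample_matrix_def power2_eq_square mult_ac)
  next
    case 3
    have "tri g (i, p i) (j, p j) (j, q j) = tri g (j, p j) (j, q j) (i, p i)"
      by (metis perm)
    then have "?T = (\<integral>\<omega>. tri g (j, p j) (j, q j) (i, p i) \<omega> \<partial>P)"
      using 3 T[of "p i" "p j" "q j"] pq[of j] by simp
    also have "\<dots> \<le> (\<integral>\<omega>. g (\<omega> (j, p j)) (\<omega> (j, q j)) * (g (\<omega> (j, p j)) (\<omega> (i, p i)))\<^sup>2 \<partial>P)"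
      using repeated[of j i] 3 by simp
    also have "\<dots> = ?C"
      using 3 g_sym[of "\<omega> (j, p j)" "\<omega> (i, p i)" for \<omega>]
      by (intro Bochner_Integration.integral_cong) (auto simp: sample_matrix_def power2_eq_square mult_ac)
    finally show ?thesis .
  next
    case 4
    have "tri g (i, p i) (j, p j) (i, q i) = tri g (i, p i) (i, q i) (j, p j)"
      by (metis perm)
    then have "?T = (\<integral>\<omega>. tri g (i, p i) (i, q i) (j, p j) \<omega> \<partial>P)"
      using 4 T[of "p i" "p j" "q i"] pq[of i] by simp
    also have "\<dots> \<le> (\<integral>\<omega>. g (\<omega> (i, p i)) (\<omega> (i, q i)) * (g (\<omega> (i, p i)) (\<omega> (j, p j)))\<^sup>2 \<partial>P)"
      using repeated[of i j] 4 by simp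
    also have "\<dots> = ?C"
      using 4 g_sym[of "\<omega> (j, p j)" "\<omega> (i, p i)" for \<omega>]
      by (intro Bochner_Integration.integral_cong) (auto simp: sample_matrix_def power2_eq_square mult_ac)
    finally show ?thesis .
  next
    case 5
    \<comment> \<open>The number of a third point of block \<open>i\<close>: it exceeds both
      \<open>p i\<close> and \<open>q i\<close>.\<close>
    define n where "n = p i + q i + 1"
    have "?T = (\<integral>\<omega>. tri g (i, p i) (i, q i) (i, n) \<omega> \<partial>P)"
      using 5 pq[of i] by (subst T[of "p i" "q i" n]) (auto simp: n_def)
    also have "\<dots> \<le> (\<integral>\<omega>. g (\<omega> (i, p i)) (\<omega> (i, q i)) ^ 3 \<partial>P)"
      using pq[of i]
      by (subst integral_tri_monochromatic[of _ _ "(i, n)"])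
        (auto simp: n_def intro!: integral_nonneg_AE mult_nonneg_nonneg add_nonneg_nonneg g_range)
    also have "\<dots> = ?C"
      using 5 by (simp add: sample_matrix_def power3_eq_cube)
    finally show ?thesis .
  qed
qed

section \<open>Expected value of the matrix objective\<close>

text \<open>The numbers 0, 1, 2 keep the sample points distinct even where colors coincide. Only
  \<open>g\<close> occurs on the right, so functions with a common Borel version have the same
  objective.\<close>

lemma objective_eq:
  "objective r =
     1 / 6 * (\<Sum>i\<in>{1..k}. \<Sum>j\<in>{1..k}. \<Sum>l\<in>{1..k}.
        \<alpha> i j l * (b i * b j * b l * (\<integral>\<omega>. tri g (i, 0) (j, 1) (l, 2) \<omega> \<partial>P))) +
     1 / 2 * (\<Sum>i\<in>{1..k}. \<Sum>j\<in>{1..k}. h i j * (b i * b j * (\<integral>\<omega>. g (\<omega> (i, 0)) (\<omega> (j, 1)) \<partial>P))) -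
     1 / 2 * (\<Sum>i\<in>{1..k}. \<Sum>j\<in>{1..k}.
        b i * b j * (\<integral>\<omega>. entropy_density (g (\<omega> (i, 0)) (\<omega> (j, 1))) \<partial>P))"
proof -
  have 1: "hom_dens B [i, j, l] triangle_graph r = b i * b j * b l * (\<integral>\<omega>. tri g (i, 0) (j, 1) (l, 2) \<omega> \<partial>P)"
    if "i \<in> {1..k}" "j \<in> {1..k}" "l \<in> {1..k}" for i j l
    using hom_dens_triangle[of "(i, 0)" "(j, 1)" "(l, 2)"] that by simp
  have 2: "hom_dens B [i, j] single_edge_graph r = b i * b j * (\<integral>\<omega>. g (\<omega> (i, 0)) (\<omega> (j, 1)) \<partial>P)"
    if "i \<in> {1..k}" "j \<in> {1..k}" for i j
    using hom_dens_edge[of "(i, 0)" "(j, 1)"] that by simp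
  have 3: "(LINT p : B i \<times> B j | lebesgue. entropy_density (r (fst p) (snd p))) =
      b i * b j * (\<integral>\<omega>. entropy_density (g (\<omega> (i, 0)) (\<omega> (j, 1))) \<partial>P)"
    if "i \<in> {1..k}" "j \<in> {1..k}" for i j
    using integral_block_version[OF rg that, of "(i, 0)" "(j, 1)" entropy_density] by simp
  show ?thesis
    unfolding objective_def energy_functional_def entropy_functional_def
    by (simp only: 1 2 3 cong: sum.cong)
qed

lemma sample_matrix_integrable:
  "integrable P (\<lambda>\<omega>. sample_matrix g p q \<omega> i j)"
  "integrable P (\<lambda>\<omega>. sample_matrix g p q \<omega> i j * sample_matrix g p q \<omega> i l * sample_matrix g p q \<omega> j l)"
  "integrable P (\<lambda>\<omega>. entropy_density (sample_matrix g p q \<omega> i j))"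
proof -
  show "integrable P (\<lambda>\<omega>. sample_matrix g p q \<omega> i j)"
    "integrable P (\<lambda>\<omega>. sample_matrix g p q \<omega> i j * sample_matrix g p q \<omega> i l * sample_matrix g p q \<omega> j l)"
    by (rule P_integrable[of _ 1]; auto simp: abs_mult sample_matrix_range intro!: mult_le_one)+
  from entropy_density_bounded obtain K where "\<bar>entropy_density u\<bar> \<le> K" if "u \<in> {0..1}" for u by blast
  then show "integrable P (\<lambda>\<omega>. entropy_density (sample_matrix g p q \<omega> i j))"
    by (intro P_integrable[of _ K]) (simp_all add: sample_matrix_range)
qed

lemma block_objective_integrable: "integrable P (\<lambda>\<omega>. \<Psi> (sample_matrix g p q \<omega>))"
  unfolding block_objective_def
  by (intro Bochner_Integration.integrable_add Bochner_Integration.integrable_diff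
      Bochner_Integration.integrable_sum integrable_mult_right sample_matrix_integrable)

text \<open>Edge and entropy terms depend on one entry, that is, on two independent points, and have
  exactly the expectation found in \<open>objective r\<close>. The triangle errors are kept explicit
  because at an optimum each summand has to vanish (\<open>no_defect\<close>).\<close>

lemma integral_block_objective:
  assumes pq: "\<And>i. p i \<noteq> q i"
  shows "(\<integral>\<omega>. \<Psi> (sample_matrix g p q \<omega>) \<partial>P) = objective r +
    1 / 6 * (\<Sum>i\<in>{1..k}. \<Sum>j\<in>{1..k}. \<Sum>l\<in>{1..k}. \<alpha> i j l * (b i * b j * b l *
      ((\<integral>\<omega>. sample_matrix g p q \<omega> i j * sample_matrix g p q \<omega> i l * sample_matrix g p q \<omega> j l \<partial>P) -
       (\<integral>\<omega>. tri g (i, 0) (j, 1) (l, 2) \<omega> \<partial>P))))"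
proof -
  note int = sample_matrix_integrable
  have "(\<integral>\<omega>. \<Psi> (sample_matrix g p q \<omega>) \<partial>P) =
     1 / 6 * (\<Sum>i\<in>{1..k}. \<Sum>j\<in>{1..k}. \<Sum>l\<in>{1..k}. \<alpha> i j l * (b i * b j * b l *
      (\<integral>\<omega>. sample_matrix g p q \<omega> i j * sample_matrix g p q \<omega> i l * sample_matrix g p q \<omega> j l \<partial>P))) +
     1 / 2 * (\<Sum>i\<in>{1..k}. \<Sum>j\<in>{1..k}. h i j * (b i * b j * (\<integral>\<omega>. sample_matrix g p q \<omega> i j \<partial>P))) -
     1 / 2 * (\<Sum>i\<in>{1..k}. \<Sum>j\<in>{1..k}. b i * b j * (\<integral>\<omega>. entropy_density (sample_matrix g p q \<omega> i j) \<partial>P))"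
    unfolding block_objective_def by (simp add: int)
  then show ?thesis
    unfolding objective_eq
    using integral_sample_matrix[OF pq, of "\<lambda>x. x"] integral_sample_matrix[OF pq borel_measurable_entropy_density]
    by (simp add: sum_subtractf right_diff_distrib)
qed

lemma defect_nonneg:
  assumes "i \<in> {1..k}" "j \<in> {1..k}" "l \<in> {1..k}" "\<And>i. p i \<noteq> q i"
  shows "0 \<le> \<alpha> i j l * (b i * b j * b l *
      ((\<integral>\<omega>. sample_matrix g p q \<omega> i j * sample_matrix g p q \<omega> i l * sample_matrix g p q \<omega> j l \<partial>P) -
       (\<integral>\<omega>. tri g (i, 0) (j, 1) (l, 2) \<omega> \<partial>P)))"
  using assms integral_tri_le[OF assms] \<alpha>_nonneg b_pos
  by (intro mult_nonneg_nonneg) (auto intro: less_imp_le)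

lemma objective_le:
  assumes c: "c \<in> maximizers"
  shows "objective r \<le> \<Psi> c"
proof -
  define p where "p = (\<lambda>_ :: nat. 0 :: nat)"
  define q where "q = (\<lambda>_ :: nat. 1 :: nat)"
  have pq: "p i \<noteq> q i" for i by (simp add: p_def q_def)
  have "objective r \<le> (\<integral>\<omega>. \<Psi> (sample_matrix g p q \<omega>) \<partial>P)"
    unfolding integral_block_objective[OF pq] le_add_same_cancel1
    by (intro mult_nonneg_nonneg sum_nonneg defect_nonneg pq) simp_all
  also have "\<dots> \<le> \<Psi> c"
    using c sample_matrix_C_sym
    by (intro sample.P.integral_le_const block_objective_integrable) (auto simp: maximizers_def)
  finally show ?thesis .
qed

end

end

section \<open>The equality case\<close>

context block_problem begin

section \<open>Block graphons\<close>

lemma block_graphon_eq: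
  assumes ij: "i \<in> {1..k}" "j \<in> {1..k}" and xy: "x \<in> B i" "y \<in> B j"
  shows "block_graphon k B c x y = c i j"
proof -
  have "indicator (B m) x = (if m = i then 1 else 0 :: real)" if "m \<in> {1..k}" for m
    using B_unique[OF that ij(1) _ xy(1)] xy(1) by (cases "m = i") (auto simp: indicator_def)
  moreover have "indicator (B m) y = (if m = j then 1 else 0 :: real)" if "m \<in> {1..k}" for m
    using B_unique[OF that ij(2) _ xy(2)] xy(2) by (cases "m = j") (auto simp: indicator_def)
  ultimately have "block_graphon k B c x y =
      (\<Sum>m\<in>{1..k}. \<Sum>n\<in>{1..k}. if m = i then if n = j then c i j else 0 else 0)"
    unfolding block_graphon_def by (intro sum.cong) auto
  also have "\<dots> = (\<Sum>m\<in>{1..k}. if m = i then \<Sum>n\<in>{1..k}. if n = j then c i j else 0 else 0)"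
    by (intro sum.cong) auto
  also have "\<dots> = c i j"
    using ij by simp
  finally show ?thesis .
qed

lemma block_graphon_outside:
  assumes "x \<notin> {0..1} \<or> y \<notin> {0..1}"
  shows "block_graphon k B c x y = 0"
proof -
  have "x \<notin> B i \<or> y \<notin> B j" if "i \<in> {1..k}" "j \<in> {1..k}" for i j
    using that assms B_subset by blast
  then show ?thesis
    unfolding block_graphon_def by (intro sum.neutral ballI) (auto simp: indicator_def)
qed

text \<open>Outside the unit square the function is 0, so its range and symmetry are as required on
  the whole plane.\<close>

lemma block_graphon_version:
  assumes c: "c \<in> C_sym k"
  shows "borel_version (block_graphon k B c) (block_graphon k B c)"
  unfolding borel_version_def
proof (intro conjI allI)
  have "(\<lambda>p. indicator (B i) (fst p) :: real) \<in> borel_measurable (borel \<Otimes>\<^sub>M (borel :: real measure))"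
    "(\<lambda>p. indicator (B i) (snd p) :: real) \<in> borel_measurable ((borel :: real measure) \<Otimes>\<^sub>M borel)"
    if "i \<in> {1..k}" for i
    using B_borel[OF that]
    by (auto intro!: measurable_compose[OF measurable_fst] measurable_compose[OF measurable_snd])
  then show "(\<lambda>(x, y). block_graphon k B c x y) \<in> borel_measurable (borel \<Otimes>\<^sub>M borel)"
    unfolding block_graphon_def split_beta'
    by (intro borel_measurable_sum borel_measurable_times borel_measurable_const) auto
  fix x y
  have "block_graphon k B c x y \<in> {0..1} \<and> block_graphon k B c x y = block_graphon k B c y x"
  proof (cases "x \<in> {0..1} \<and> y \<in> {0..1}")
    case True
    then obtain i j where "i \<in> {1..k}" "x \<in> B i" "j \<in> {1..k}" "y \<in> B j"
      by (meson B_cases)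
    with c show ?thesis by (auto simp: block_graphon_eq C_sym_def)
  next
    case False
    then show ?thesis by (auto simp: block_graphon_outside)
  qed
  then show "block_graphon k B c x y \<in> {0..1}" "block_graphon k B c x y = block_graphon k B c y x"
    by auto
qed simp

lemma block_graphon_graphon:
  assumes c: "c \<in> C_sym k"
  shows "block_graphon k B c \<in> graphons"
proof -
  note v = block_graphon_version[OF c]
  have "(\<lambda>(x, y). block_graphon k B c x y) \<in> borel_measurable lebesgue"
    using v unfolding borel_version_def borel_prod by (intro measurable_completion) simp
  then have "(\<lambda>(x, y). block_graphon k B c x y) \<in> borel_measurable (lebesgue_on ({0..1} \<times> {0..1}))"
    by (rule measurable_restrict_space1)
  then show ?thesis
    using v unfolding graphons_def borel_version_def by blast
qed

section \<open>Structure of optimal graphons\<close>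

context
  fixes r g :: "real \<Rightarrow> real \<Rightarrow> real" and c :: "nat \<Rightarrow> nat \<Rightarrow> real"
  assumes rg: "borel_version r g" and c: "c \<in> maximizers" and opt: "\<Psi> c \<le> objective r"
begin

abbreviation "S \<equiv> sample_matrix g"

text \<open>The expectation of \<open>\<Psi> (S p q \<omega>)\<close> lies between
  \<open>objective r\<close> and \<open>\<Psi> c\<close>, and \<open>opt\<close> closes this gap.
  Equality on the lower side removes all weighted triangle errors; equality on the upper side makes
  the nonnegative variable \<open>\<Psi> c - \<Psi> (S p q \<omega>)\<close> vanish almost surely.
  \<open>p\<close> and \<open>q\<close> stay free, since samples with different choices are compared
  later.\<close>

lemma
  assumes pq: "\<And>i. p i \<noteq> q i"
  shows AE_maximizer: "AE \<omega> in P. S p q \<omega> \<in> maximizers"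
    and no_defect: "\<And>i j l. i \<in> {1..k} \<Longrightarrow> j \<in> {1..k} \<Longrightarrow> l \<in> {1..k} \<Longrightarrow> \<alpha> i j l > 0 \<Longrightarrow>
      (\<integral>\<omega>. S p q \<omega> i j * S p q \<omega> i l * S p q \<omega> j l \<partial>P) = (\<integral>\<omega>. tri g (i, 0) (j, 1) (l, 2) \<omega> \<partial>P)"
proof -
  define D where "D i j l = \<alpha> i j l * (b i * b j * b l *
      ((\<integral>\<omega>. S p q \<omega> i j * S p q \<omega> i l * S p q \<omega> j l \<partial>P) - (\<integral>\<omega>. tri g (i, 0) (j, 1) (l, 2) \<omega> \<partial>P)))" for i j l
  have D: "0 \<le> D i j l" if "i \<in> {1..k}" "j \<in> {1..k}" "l \<in> {1..k}" for i j l
    unfolding D_def by (rule defect_nonneg[OF rg that pq])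
  have exp: "(\<integral>\<omega>. \<Psi> (S p q \<omega>) \<partial>P) = objective r + 1 / 6 * (\<Sum>i\<in>{1..k}. \<Sum>j\<in>{1..k}. \<Sum>l\<in>{1..k}. D i j l)"
    unfolding D_def by (rule integral_block_objective[OF rg pq])
  have le: "\<Psi> (S p q \<omega>) \<le> \<Psi> c" for \<omega>
    using c sample_matrix_C_sym[OF rg] by (auto simp: maximizers_def)
  note int = block_objective_integrable[OF rg, of p q]
  have "(\<integral>\<omega>. \<Psi> (S p q \<omega>) \<partial>P) \<le> \<Psi> c"
    by (intro sample.P.integral_le_const int) (simp add: le)
  moreover have sum_nn: "0 \<le> (\<Sum>i\<in>{1..k}. \<Sum>j\<in>{1..k}. \<Sum>l\<in>{1..k}. D i j l)"
    by (intro sum_nonneg D)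
  ultimately have eq: "(\<integral>\<omega>. \<Psi> (S p q \<omega>) \<partial>P) = \<Psi> c"
    and sum0: "(\<Sum>i\<in>{1..k}. \<Sum>j\<in>{1..k}. \<Sum>l\<in>{1..k}. D i j l) \<le> 0"
    using exp opt by linarith+
  have "(\<integral>\<omega>. \<Psi> c - \<Psi> (S p q \<omega>) \<partial>P) = 0"
    using eq int by (simp add: sample.P.prob_space)
  then have "AE \<omega> in P. \<Psi> c - \<Psi> (S p q \<omega>) = 0"
    by (subst (asm) integral_nonneg_eq_0_iff_AE) (auto simp: le int)
  then show "AE \<omega> in P. S p q \<omega> \<in> maximizers"
  proof eventually_elim
    case (elim \<omega>)
    then show ?case
      using c sample_matrix_C_sym[OF rg, of p q \<omega>] by (auto simp: maximizers_def)
  qed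
  fix i j l assume ijl: "i \<in> {1..k}" "j \<in> {1..k}" "l \<in> {1..k}" and \<alpha>: "\<alpha> i j l > 0"
  have "D i j l \<le> 0"
    using member_le_sum3[of "{1..k}" i j l D] ijl D sum0 by fastforce
  with D[OF ijl] have "D i j l = 0" by simp
  then show "(\<integral>\<omega>. S p q \<omega> i j * S p q \<omega> i l * S p q \<omega> j l \<partial>P) = (\<integral>\<omega>. tri g (i, 0) (j, 1) (l, 2) \<omega> \<partial>P)"
    using \<alpha> b_pos[OF ijl(1)] b_pos[OF ijl(2)] b_pos[OF ijl(3)] by (simp add: D_def)
qed

text \<open>\<open>p\<close> and \<open>q\<close> are chosen such that the sample matrix shows the
  given pair of points at \<open>(i, j)\<close>. This carries positivity and the stationarity
  equations over to values of \<open>g\<close>.\<close>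

lemma AE_entry_maximizer:
  assumes ij: "i \<in> {1..k}" "j \<in> {1..k}" and ne: "(i, a) \<noteq> (j, d)"
  shows "AE \<omega> in P. \<exists>M\<in>maximizers. M i j = g (\<omega> (i, a)) (\<omega> (j, d))"
proof (cases "i = j")
  case True
  with ne have "AE \<omega> in P. S (\<lambda>_. a) (\<lambda>_. d) \<omega> \<in> maximizers"
    by (intro AE_maximizer) auto
  then show ?thesis
  proof eventually_elim
    case (elim \<omega>)
    moreover have "S (\<lambda>_. a) (\<lambda>_. d) \<omega> i j = g (\<omega> (i, a)) (\<omega> (j, d))"
      using True by (simp add: sample_matrix_def)
    ultimately show ?case by blast
  qed
next
  case False
  let ?p = "(\<lambda>_. a)(j := d)"
  have "AE \<omega> in P. S ?p (\<lambda>i. Suc (?p i)) \<omega> \<in> maximizers"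
    by (intro AE_maximizer) auto
  then show ?thesis
  proof eventually_elim
    case (elim \<omega>)
    moreover have "S ?p (\<lambda>i. Suc (?p i)) \<omega> i j = g (\<omega> (i, a)) (\<omega> (j, d))"
      using False by (simp add: sample_matrix_def)
    ultimately show ?case by blast
  qed
qed

lemma AE_entry_pos:
  assumes ij: "i \<in> {1..k}" "j \<in> {1..k}" and ne: "(i, a) \<noteq> (j, d)"
  shows "AE \<omega> in P. g (\<omega> (i, a)) (\<omega> (j, d)) > 0"
  using AE_entry_maximizer[OF assms]
proof eventually_elim
  case (elim \<omega>)
  then obtain M where "M \<in> maximizers" "M i j = g (\<omega> (i, a)) (\<omega> (j, d))" by blast
  then show ?case using maximizers_pos[OF _ ij] by metis
qed

text \<open>The cases ask for a triangle of positive weight on the colors \<open>i\<close>,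
  \<open>j\<close>, \<open>l\<close>. In \<open>other\<close> and \<open>diag\<close> it has an edge
  that avoids the replaced point, so \<open>maximizers_rigid\<close> applies to two samples. In
  \<open>repeated\<close> and \<open>mono\<close> every edge has an end of the color of the replaced
  point, and the vanishing AM-GM error is used instead.\<close>

lemma AE_indep_second:
  assumes ij: "i \<in> {1..k}" "j \<in> {1..k}" and acd: "distinct [a, c', d]"
  shows "AE \<omega> in P. g (\<omega> (i, a)) (\<omega> (j, c')) = g (\<omega> (i, a)) (\<omega> (j, d))"
proof -
  \<comment> \<open>A number larger than the others, for auxiliary second points that must avoid the
    points in play and be common to both samples.\<close>
  define e where "e = Suc (a + c' + d)"
  have e: "e \<noteq> a" "e \<noteq> c'" "e \<noteq> d" by (auto simp: e_def)
  consider (free) "\<forall>l\<in>{1..k}. \<alpha> i j l = 0"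
    | (other) l where "l \<in> {1..k}" "\<alpha> i j l > 0" "i \<noteq> j" "l \<noteq> j"
    | (diag) l where "l \<in> {1..k}" "\<alpha> i j l > 0" "i = j" "l \<noteq> i"
    | (repeated) "\<alpha> i j j > 0" "i \<noteq> j"
    | (mono) "\<alpha> i i i > 0" "i = j"
    using \<alpha>_nonneg[OF ij] by (metis order_le_less)
  then show ?thesis
  proof cases
    case free
    \<comment> \<open>No triangle term is left in the stationarity equation, so the entry is the
      logistic value of \<open>h i j\<close>, whatever the points.\<close>
    have const: "AE \<omega> in P. g (\<omega> (i, a)) (\<omega> (j, n)) = exp (h i j) / (1 + exp (h i j))" if "a \<noteq> n" for n
    proof -
      have "AE \<omega> in P. \<exists>M\<in>maximizers. M i j = g (\<omega> (i, a)) (\<omega> (j, n))"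
        using AE_entry_maximizer[OF ij] that by simp
      then show ?thesis
      proof eventually_elim
        case (elim \<omega>)
        then obtain M where M: "M \<in> maximizers" "M i j = g (\<omega> (i, a)) (\<omega> (j, n))" by blast
        have "(\<Sum>l\<in>{1..k}. b l * M i l * M j l * \<alpha> i j l) = 0"
          using free by (intro sum.neutral) simp
        then show ?case using maximizer_logistic[OF M(1) ij] M(2) by simp
      qed
    qed
    have "a \<noteq> c'" "a \<noteq> d" using acd by auto
    from const[OF this(1)] const[OF this(2)] show ?thesis
      by eventually_elim simp
  next
    case (other l)
    let ?p = "\<lambda>n. (\<lambda>_. a)(j := n)"
    have "AE \<omega> in P. S (?p c') (\<lambda>_. e) \<omega> \<in> maximizers" "AE \<omega> in P. S (?p d) (\<lambda>_. e) \<omega> \<in> maximizers"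
      by (rule AE_maximizer; use e in \<open>simp add: fun_upd_apply not_sym split: if_split\<close>)+
    then show ?thesis
    proof eventually_elim
      case (elim \<omega>)
      have "S (?p c') (\<lambda>_. e) \<omega> i j = S (?p d) (\<lambda>_. e) \<omega> i j"
      proof (rule maximizers_rigid[OF elim ij(1) other(1) ij(2)])
        show "\<alpha> i l j > 0" using \<alpha>_sym[OF ij other(1)] other(2) by simp
      qed (use other in \<open>auto simp: sample_matrix_def\<close>)
      then show ?case using other(3) by (simp add: sample_matrix_def)
    qed
  next
    case (diag l)
    let ?q = "\<lambda>n. (\<lambda>_. e)(i := n)"
    have pq: "a \<noteq> ?q n m" if "n \<noteq> a" for n m
      using that e(1) by (cases "m = i") auto
    have "AE \<omega> in P. S (\<lambda>_. a) (?q c') \<omega> \<in> maximizers" "AE \<omega> in P. S (\<lambda>_. a) (?q d) \<omega> \<in> maximizers"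
      by (rule AE_maximizer, rule pq, use acd in simp)+
    then show ?thesis
    proof eventually_elim
      case (elim \<omega>)
      have "S (\<lambda>_. a) (?q c') \<omega> i i = S (\<lambda>_. a) (?q d) \<omega> i i"
      proof (rule maximizers_rigid[OF elim ij(1) diag(1) ij(1)])
        show "\<alpha> i l i > 0" using \<alpha>_sym[OF ij(1,1) diag(1)] diag(2,3) by simp
      qed (use diag in \<open>auto simp: sample_matrix_def\<close>)
      then show ?case using diag(3) by (simp add: sample_matrix_def)
    qed
  next
    case repeated
    let ?p = "(\<lambda>_. c')(i := a)"
    let ?u = "(j, c')" and ?v = "(j, d)" and ?w = "(i, a)"
    \<comment> \<open>The AM-GM error for two copies \<open>?u\<close>, \<open>?v\<close> in block
      \<open>j\<close>, seen from \<open>?w\<close> in block \<open>i\<close>. It vanishes almost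
      surely and its first factor is almost surely positive, so the two copies look the same from
      \<open>?w\<close>.\<close>
    let ?d = "\<lambda>\<omega>. g (\<omega> ?u) (\<omega> ?v) * (g (\<omega> ?u) (\<omega> ?w) - g (\<omega> ?v) (\<omega> ?w))\<^sup>2"
    have dist: "distinct [?u, ?v, ?w]" using acd repeated by auto
    have pq: "?p n \<noteq> (\<lambda>_. d) n" for n using acd by auto
    have "\<alpha> j j i > 0"
      using \<alpha>_sym[OF ij ij(2)] \<alpha>_sym[of j i j] ij repeated(1) by simp
    from no_defect[of ?p "\<lambda>_. d", OF pq ij(2,2,1) this]
    have "(\<integral>\<omega>. g (\<omega> ?u) (\<omega> ?v) * (g (\<omega> ?u) (\<omega> ?w))\<^sup>2 \<partial>P) = (\<integral>\<omega>. tri g (j, 0) (j, 1) (i, 2) \<omega> \<partial>P)"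
      using repeated(2) by (simp add: sample_matrix_def power2_eq_square mult_ac)
    also have "\<dots> = (\<integral>\<omega>. tri g ?u ?v ?w \<omega> \<partial>P)"
      by (rule integral_tri_cong[OF rg]) (use dist ij in auto)
    finally have "integral\<^sup>L P ?d = 0"
      using integral_tri_repeated[OF rg dist] by simp
    moreover have "integrable P ?d"
    proof (rule P_integrable)
      show "?d \<in> borel_measurable P" using sample_entry_measurable[OF rg] by measurable
      fix \<omega>
      have "\<bar>g (\<omega> ?u) (\<omega> ?w) - g (\<omega> ?v) (\<omega> ?w)\<bar> \<le> 1"
        using borel_version_range[OF rg, of "\<omega> ?u" "\<omega> ?w"] borel_version_range[OF rg, of "\<omega> ?v" "\<omega> ?w"] by linarith
      then show "\<bar>?d \<omega>\<bar> \<le> 1"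
        using borel_version_abs_le[OF rg] by (auto simp: abs_mult abs_square_le_1 intro!: mult_le_one)
    qed
    ultimately have "AE \<omega> in P. ?d \<omega> = 0"
      using borel_version_range[OF rg] by (subst (asm) integral_nonneg_eq_0_iff_AE) auto
    moreover have "AE \<omega> in P. g (\<omega> ?u) (\<omega> ?v) > 0"
      by (rule AE_entry_pos) (use acd ij in auto)
    ultimately show ?thesis
      by eventually_elim (use borel_version_sym[OF rg] in auto)
  next
    case mono
    let ?u = "(i, a)" and ?v = "(i, c')" and ?w = "(i, d)"
    \<comment> \<open>The error for three copies in one block: a factor that is almost surely
      positive, times a sum of squares. The first square alone gives the claim.\<close>
    let ?d = "\<lambda>\<omega>. (g (\<omega> ?u) (\<omega> ?v) + g (\<omega> ?u) (\<omega> ?w) + g (\<omega> ?v) (\<omega> ?w)) *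
      ((g (\<omega> ?u) (\<omega> ?v) - g (\<omega> ?u) (\<omega> ?w))\<^sup>2 + (g (\<omega> ?u) (\<omega> ?v) - g (\<omega> ?v) (\<omega> ?w))\<^sup>2 +
       (g (\<omega> ?u) (\<omega> ?w) - g (\<omega> ?v) (\<omega> ?w))\<^sup>2)"
    have dist: "distinct [?u, ?v, ?w]" using acd by auto
    have pq: "(\<lambda>_ :: nat. a) n \<noteq> (\<lambda>_. c') n" for n using acd by auto
    from no_defect[of "\<lambda>_. a" "\<lambda>_. c'", OF pq ij(1,1,1) mono(1)]
    have "(\<integral>\<omega>. g (\<omega> ?u) (\<omega> ?v) ^ 3 \<partial>P) = (\<integral>\<omega>. tri g (i, 0) (i, 1) (i, 2) \<omega> \<partial>P)"
      by (simp add: sample_matrix_def power3_eq_cube)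
    also have "\<dots> = (\<integral>\<omega>. tri g ?u ?v ?w \<omega> \<partial>P)"
      by (rule integral_tri_cong[OF rg]) (use dist ij in auto)
    finally have "integral\<^sup>L P ?d = 0"
      using integral_tri_monochromatic[OF rg dist] by simp
    moreover have nn: "0 \<le> ?d \<omega>" for \<omega>
      by (intro mult_nonneg_nonneg add_nonneg_nonneg borel_version_range[OF rg] zero_le_power2)
    moreover have "integrable P ?d"
    proof (rule P_integrable)
      show "?d \<in> borel_measurable P" using sample_entry_measurable[OF rg] by measurable
      fix \<omega>
      have sq: "(g x y - g x' y')\<^sup>2 \<le> 1" for x y x' y'
      proof -
        have "\<bar>g x y - g x' y'\<bar> \<le> 1"
          using borel_version_range[OF rg, of x y] borel_version_range[OF rg, of x' y'] by linarith
        then show ?thesis by (simp add: abs_square_le_1)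
      qed
      have "?d \<omega> \<le> (1 + 1 + 1) * (1 + 1 + 1)"
        by (intro mult_mono add_mono add_nonneg_nonneg sq borel_version_range[OF rg] zero_le_power2) auto
      then show "\<bar>?d \<omega>\<bar> \<le> 9" using nn[of \<omega>] by simp
    qed
    ultimately have "AE \<omega> in P. ?d \<omega> = 0"
      by (subst (asm) integral_nonneg_eq_0_iff_AE) auto
    moreover have "AE \<omega> in P. g (\<omega> ?u) (\<omega> ?v) > 0"
      by (rule AE_entry_pos) (use acd ij in auto)
    ultimately show ?thesis
    proof eventually_elim
      case (elim \<omega>)
      have "0 < g (\<omega> ?u) (\<omega> ?v) + g (\<omega> ?u) (\<omega> ?w) + g (\<omega> ?v) (\<omega> ?w)"
        by (intro add_pos_nonneg elim(2) borel_version_range[OF rg])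
      with elim(1) have "(g (\<omega> ?u) (\<omega> ?v) - g (\<omega> ?u) (\<omega> ?w))\<^sup>2 + (g (\<omega> ?u) (\<omega> ?v) - g (\<omega> ?v) (\<omega> ?w))\<^sup>2 +
          (g (\<omega> ?u) (\<omega> ?w) - g (\<omega> ?v) (\<omega> ?w))\<^sup>2 = 0"
        by (metis less_irrefl mult_eq_0_iff)
      then have "(g (\<omega> ?u) (\<omega> ?v) - g (\<omega> ?u) (\<omega> ?w))\<^sup>2 = 0"
        by (smt (verit) zero_le_power2)
      then show ?case using mono(2) by simp
    qed
  qed
qed

text \<open>Replacing the second point and then, by symmetry, the first leads from
  \<open>(i, 0)\<close>, \<open>(j, 1)\<close> to the disjoint pair \<open>(i, 2)\<close>,
  \<open>(j, 3)\<close> without changing \<open>g\<close>. A variable equal to an independent copy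
  of itself is constant.\<close>

lemma optimal_block_constant:
  "\<exists>c\<in>C_sym k. AE p in lborel. p \<in> {0..1} \<times> {0..1} \<longrightarrow>
     r (fst p) (snd p) = block_graphon k B c (fst p) (snd p)"
proof -
  \<comment> \<open>The constant on a block pair must be the mean. Naming it this way lets its range
    and symmetry follow from those of \<open>g\<close>.\<close>
  define m where "m i j = (\<integral>\<omega>. g (\<omega> (i, 0)) (\<omega> (j, 1)) \<partial>P)" for i j
  have meas: "(\<lambda>p. g (fst p) (snd p)) \<in> borel_measurable (borel \<Otimes>\<^sub>M borel)"
    by (rule borel_version_measurable[OF rg]) auto
  have block: "AE p in lborel. p \<in> B i \<times> B j \<longrightarrow> g (fst p) (snd p) = m i j"
    if ij: "i \<in> {1..k}" "j \<in> {1..k}" for i j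
  proof -
    have "AE \<omega> in P. g (\<omega> (i, 0)) (\<omega> (j, 1)) = g (\<omega> (i, 0)) (\<omega> (j, 3))"
      "AE \<omega> in P. g (\<omega> (j, 3)) (\<omega> (i, 0)) = g (\<omega> (j, 3)) (\<omega> (i, 2))"
      by (rule AE_indep_second; use ij in simp)+
    then have "AE \<omega> in P. g (fst (\<omega> (i, 0), \<omega> (j, 1))) (snd (\<omega> (i, 0), \<omega> (j, 1))) =
        g (fst (\<omega> (i, 2), \<omega> (j, 3))) (snd (\<omega> (i, 2), \<omega> (j, 3)))"
    proof eventually_elim
      case (elim \<omega>)
      then show ?case
        using borel_version_sym[OF rg, of "\<omega> (j, 3)" "\<omega> (i, 0)"] borel_version_sym[OF rg, of "\<omega> (j, 3)" "\<omega> (i, 2)"] by simp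
    qed
    then have "\<exists>z. AE p in \<mu> (fst (i, 2 :: nat)) \<Otimes>\<^sub>M \<mu> (fst (j, 3 :: nat)). g (fst p) (snd p) = z"
      by (rule AE_const_of_independent_copy[OF meas, rotated]) simp
    then obtain z where z: "AE p in \<mu> i \<Otimes>\<^sub>M \<mu> j. g (fst p) (snd p) = z"
      unfolding fst_conv by blast
    have "m i j = integral\<^sup>L (\<mu> i \<Otimes>\<^sub>M \<mu> j) (\<lambda>p. g (fst p) (snd p))"
      unfolding m_def using integral_P_pair[OF _ meas, of "(i, 0)" "(j, 1)"] by simp
    also have "\<dots> = integral\<^sup>L (\<mu> i \<Otimes>\<^sub>M \<mu> j) (\<lambda>p. z)"
      using z meas by (intro integral_cong_AE) (auto cong: measurable_cong_sets sets_pair_measure_cong)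
    also have "\<dots> = z"
    proof -
      interpret prob_space "\<mu> i \<Otimes>\<^sub>M \<mu> j"
        unfolding pair_\<mu> by (intro prob_space_uniform_measure emeasure_cell_times_nontrivial)
      show ?thesis by (simp add: prob_space)
    qed
    finally have "AE p in uniform_measure lborel (cell i \<times> cell j). g (fst p) (snd p) = m i j"
      using z unfolding pair_\<mu> by simp
    then show ?thesis
      using ij emeasure_cell_times_nontrivial[of i j]
      by (subst (asm) AE_uniform_measure) (auto simp: less_top cell_def)
  qed
  have "m \<in> C_sym k"
    unfolding C_sym_def
  proof (intro CollectI ballI conjI)
    fix i j assume "i \<in> {1..k}" "j \<in> {1..k}"
    have int: "integrable P (\<lambda>\<omega>. g (\<omega> (i, 0)) (\<omega> (j, 1)))"
      by (rule P_integrable[of _ 1]) (simp_all add: sample_entry_measurable[OF rg] borel_version_abs_le[OF rg])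
    have "0 \<le> m i j" "m i j \<le> 1"
      unfolding m_def
      by (rule sample.P.integral_ge_const[OF int] sample.P.integral_le_const[OF int], simp add: borel_version_range[OF rg])+
    then show "m i j \<in> {0..1}" by simp
    have "m i j = (\<integral>\<omega>. g (\<omega> (j, 1)) (\<omega> (i, 0)) \<partial>P)"
      unfolding m_def by (intro Bochner_Integration.integral_cong refl borel_version_sym[OF rg])
    also have "\<dots> = m j i"
      unfolding m_def using integral_g_cong[OF rg, of "(j, 1)" "(i, 0)" "(j, 0)" "(i, 1)" "\<lambda>x. x"] by simp
    finally show "m i j = m j i" .
  qed
  moreover have "AE p in lborel. p \<in> {0..1} \<times> {0..1} \<longrightarrow>
     r (fst p) (snd p) = block_graphon k B m (fst p) (snd p)"
  proof -
    have "AE p in lborel. \<forall>i\<in>{1..k}. \<forall>j\<in>{1..k}. p \<in> B i \<times> B j \<longrightarrow> g (fst p) (snd p) = m i j"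
      by (intro AE_finite_allI block) auto
    moreover have "AE p in lborel. p \<in> {0..1} \<times> {0..1} \<longrightarrow> r (fst p) (snd p) = g (fst p) (snd p)"
      using rg by (simp add: borel_version_def)
    ultimately show ?thesis
    proof eventually_elim
      case (elim p)
      show ?case
      proof
        assume p: "p \<in> {0..1} \<times> {0..1}"
        then obtain i j where ij: "i \<in> {1..k}" "fst p \<in> B i" "j \<in> {1..k}" "snd p \<in> B j"
          by (metis B_cases mem_Times_iff)
        then have "p \<in> B i \<times> B j" by (simp add: mem_Times_iff)
        then show "r (fst p) (snd p) = block_graphon k B m (fst p) (snd p)"
          using elim p ij by (simp add: block_graphon_eq)
      qed
    qed
  qed
  ultimately show ?thesis by blast
qed

end

lemma objective_block_graphon:
  assumes c: "c \<in> C_sym k"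
  shows "objective (block_graphon k B c) = \<Psi> c"
proof -
  let ?g = "block_graphon k B c"
  note v = block_graphon_version[OF c]
  have AE_c: "AE \<omega> in P. ?g (\<omega> (i, m)) (\<omega> (j, n)) = c i j"
    if ij: "i \<in> {1..k}" "j \<in> {1..k}" and "m \<noteq> n" for i j m n
  proof -
    have "AE p in \<mu> i \<Otimes>\<^sub>M \<mu> j. ?g (fst p) (snd p) = c i j"
      unfolding pair_\<mu> using ij
      by (intro AE_uniform_measureI) (auto simp: cell_def block_graphon_eq borel_Times)
    then have "AE p in distr P (borel \<Otimes>\<^sub>M borel) (\<lambda>\<omega>. (\<omega> (i, m), \<omega> (j, n))). ?g (fst p) (snd p) = c i j"
      using distr_P_pair[of "(i, m)" "(j, n)"] \<open>m \<noteq> n\<close> by (simp only: fst_conv prod.inject simp_thms)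
    from AE_distrD[OF component_P_pair this] show ?thesis by simp
  qed
  have ne: "0 \<noteq> (1 :: nat)" "0 \<noteq> (2 :: nat)" "1 \<noteq> (2 :: nat)" by simp_all
  have const: "(\<integral>\<omega>. f \<omega> \<partial>P) = z" if "AE \<omega> in P. f \<omega> = z" "f \<in> borel_measurable P" for f :: "_ \<Rightarrow> real" and z
    using integral_cong_AE[OF that(2) _ that(1)] by (simp add: sample.P.prob_space)
  have 1: "(\<integral>\<omega>. tri ?g (i, 0) (j, 1) (l, 2) \<omega> \<partial>P) = c i j * c i l * c j l"
    if ijl: "i \<in> {1..k}" "j \<in> {1..k}" "l \<in> {1..k}" for i j l
  proof (rule const)
    show "AE \<omega> in P. tri ?g (i, 0) (j, 1) (l, 2) \<omega> = c i j * c i l * c j l"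
      using AE_c[OF ijl(1,2) ne(1)] AE_c[OF ijl(1,3) ne(2)] AE_c[OF ijl(2,3) ne(3)]
      by eventually_elim (simp add: tri_def)
  qed (rule borel_measurable_integrable[OF tri_integrable[OF v]])
  have 2: "(\<integral>\<omega>. f (?g (\<omega> (i, 0)) (\<omega> (j, 1))) \<partial>P) = f (c i j)"
    if ij: "i \<in> {1..k}" "j \<in> {1..k}" and f: "f \<in> borel_measurable borel" for i j and f :: "real \<Rightarrow> real"
  proof (rule const)
    show "AE \<omega> in P. f (?g (\<omega> (i, 0)) (\<omega> (j, 1))) = f (c i j)"
      using AE_c[OF ij ne(1)] by eventually_elim simp
  qed (rule measurable_compose[OF sample_entry_measurable[OF v] f])
  have 3: "(\<integral>\<omega>. ?g (\<omega> (i, 0)) (\<omega> (j, 1)) \<partial>P) = c i j" if "i \<in> {1..k}" "j \<in> {1..k}" for i j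
    using 2[OF that, of "\<lambda>x. x"] by simp
  have 4: "(\<integral>\<omega>. entropy_density (?g (\<omega> (i, 0)) (\<omega> (j, 1))) \<partial>P) = entropy_density (c i j)"
    if "i \<in> {1..k}" "j \<in> {1..k}" for i j
    by (rule 2[OF that borel_measurable_entropy_density])
  show ?thesis
    unfolding objective_eq[OF v] block_objective_def
    by (simp only: 1 3 4 cong: sum.cong)
qed

end

section \<open>The cut distance\<close>

lemma AE_pair_fst:
  assumes "sigma_finite_measure N" and "AE x in M. Q x"
  shows "AE p in M \<Otimes>\<^sub>M N. Q (fst p)"
proof -
  interpret N: sigma_finite_measure N by fact
  from assms(2) obtain Z where Z: "Z \<in> null_sets M" "{x \<in> space M. \<not> Q x} \<subseteq> Z"
    by (auto elim!: AE_E)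
  have "Z \<times> space N \<in> null_sets (M \<Otimes>\<^sub>M N)"
    using Z(1) by (auto simp: null_sets_def N.emeasure_pair_measure_Times)
  then show ?thesis
    by (rule AE_I') (use Z(2) in \<open>auto simp: space_pair_measure\<close>)
qed

lemma AE_pair_snd:
  assumes "sigma_finite_measure N" and "AE y in N. Q y"
  shows "AE p in M \<Otimes>\<^sub>M N. Q (snd p)"
proof -
  interpret N: sigma_finite_measure N by fact
  from assms(2) obtain Z where Z: "Z \<in> null_sets N" "{y \<in> space N. \<not> Q y} \<subseteq> Z"
    by (auto elim!: AE_E)
  have "space M \<times> Z \<in> null_sets (M \<Otimes>\<^sub>M N)"
    using Z(1) by (auto simp: null_sets_def N.emeasure_pair_measure_Times)
  then show ?thesis
    by (rule AE_I') (use Z(2) in \<open>auto simp: space_pair_measure\<close>)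
qed

text \<open>Rectangles are an intersection-stable generator of the product sigma-algebra, so the
  finite measures with densities \<open>f\<close> and \<open>g\<close> coincide, and densities are
  unique almost everywhere. Rectangles are just what the cut distance tests.\<close>

lemma AE_eq_of_rectangles:
  fixes f g :: "'a \<times> 'b \<Rightarrow> real"
  assumes "finite_measure (M \<Otimes>\<^sub>M N)"
    and f: "integrable (M \<Otimes>\<^sub>M N) f" "\<And>p. 0 \<le> f p" and g: "integrable (M \<Otimes>\<^sub>M N) g" "\<And>p. 0 \<le> g p"
    and eq: "\<And>C D. C \<in> sets M \<Longrightarrow> D \<in> sets N \<Longrightarrow>
      (\<integral>p. indicator (C \<times> D) p * f p \<partial>(M \<Otimes>\<^sub>M N)) = (\<integral>p. indicator (C \<times> D) p * g p \<partial>(M \<Otimes>\<^sub>M N))"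
  shows "AE p in M \<Otimes>\<^sub>M N. f p = g p"
proof -
  interpret finite_measure "M \<Otimes>\<^sub>M N" by fact
  have em: "emeasure (density (M \<Otimes>\<^sub>M N) (\<lambda>p. ennreal (u p))) (C \<times> D) =
      ennreal (\<integral>p. indicator (C \<times> D) p * u p \<partial>(M \<Otimes>\<^sub>M N))"
    if u: "integrable (M \<Otimes>\<^sub>M N) u" "\<And>p. 0 \<le> u p" and "C \<in> sets M" "D \<in> sets N" for u C D
  proof -
    have CD: "C \<times> D \<in> sets (M \<Otimes>\<^sub>M N)" using that by auto
    have "emeasure (density (M \<Otimes>\<^sub>M N) (\<lambda>p. ennreal (u p))) (C \<times> D) =
        (\<integral>\<^sup>+p. ennreal (u p) * indicator (C \<times> D) p \<partial>(M \<Otimes>\<^sub>M N))"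
      using u(1) CD by (intro emeasure_density) auto
    also have "\<dots> = (\<integral>\<^sup>+p. ennreal (indicator (C \<times> D) p * u p) \<partial>(M \<Otimes>\<^sub>M N))"
      by (intro nn_integral_cong) (auto simp: indicator_def)
    also have "\<dots> = ennreal (\<integral>p. indicator (C \<times> D) p * u p \<partial>(M \<Otimes>\<^sub>M N))"
      using u integrable_real_mult_indicator[OF CD u(1)]
      by (intro nn_integral_eq_integral) (auto simp: mult.commute)
    finally show ?thesis .
  qed
  have "density (M \<Otimes>\<^sub>M N) (\<lambda>p. ennreal (f p)) = density (M \<Otimes>\<^sub>M N) (\<lambda>p. ennreal (g p))"
  proof (rule measure_eqI_generator_eq[OF Int_stable_pair_measure_generator[of M N],
        where A = "\<lambda>_. space M \<times> space N" and \<Omega> = "space M \<times> space N"])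
    show "{a \<times> b |a b. a \<in> sets M \<and> b \<in> sets N} \<subseteq> Pow (space M \<times> space N)"
      by (auto dest: sets.sets_into_space)
    show "emeasure (density (M \<Otimes>\<^sub>M N) (\<lambda>p. ennreal (f p))) X =
        emeasure (density (M \<Otimes>\<^sub>M N) (\<lambda>p. ennreal (g p))) X"
      if "X \<in> {a \<times> b |a b. a \<in> sets M \<and> b \<in> sets N}" for X
      using that eq by (auto simp: em[OF f] em[OF g])
    show "emeasure (density (M \<Otimes>\<^sub>M N) (\<lambda>p. ennreal (f p))) (space M \<times> space N) \<noteq> \<infinity>"
      by (subst em[OF f]) auto
  qed (auto simp: sets_pair_measure)
  then have "AE p in M \<Otimes>\<^sub>M N. ennreal (f p) = ennreal (g p)"
    using f g by (subst (asm) density_unique_iff) auto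
  then show ?thesis
    by eventually_elim (use f g in simp)
qed

section \<open>Bounds for the cut distance\<close>

lemma measure_unit_square: "measure lebesgue ({0..1} \<times> {0..1} :: (real \<times> real) set) = 1"
proof -
  have "emeasure lborel ({0..1} \<times> {0..1} :: (real \<times> real) set) = 1"
    unfolding lborel_prod[symmetric] by (subst lborel.emeasure_pair_measure_Times) auto
  then have "measure lborel ({0..1} \<times> {0..1} :: (real \<times> real) set) = 1"
    by (simp add: measure_def)
  then show ?thesis by (simp add: borel_Times)
qed

text \<open>A non-integrable function has integral 0, and \<open>integral_mono'\<close> asks for
  integrability of the majorant only, so the bound applies directly to pulled back graphons, before
  their measurability is discussed.\<close>

lemma abs_set_integral_unit_square_le:
  fixes f :: "real \<times> real \<Rightarrow> real"
  assumes "A \<subseteq> {0..1} \<times> {0..1}" and f: "\<And>p. p \<in> A \<Longrightarrow> \<bar>f p\<bar> \<le> 1"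
  shows "\<bar>LINT p : A | lebesgue. f p\<bar> \<le> 1"
proof -
  let ?S = "{0..1} \<times> {0..1} :: (real \<times> real) set"
  have S: "?S \<in> sets lebesgue" by (rule sets_completionI_sets) (simp add: borel_Times)
  have "\<bar>LINT p : A | lebesgue. f p\<bar> \<le> (\<integral>p. norm (indicator A p *\<^sub>R f p) \<partial>lebesgue)"
    unfolding set_lebesgue_integral_def real_norm_def[symmetric] by (rule integral_norm_bound)
  also have "\<dots> \<le> (\<integral>p. indicator ?S p \<partial>lebesgue)"
  proof (rule integral_mono')
    show "integrable lebesgue (indicator ?S :: _ \<Rightarrow> real)"
      using S measure_unit_square by (intro integrable_real_indicator) (auto simp: emeasure_lborel_cbox less_top measure_def split: if_splits)
    show "norm (indicator A p *\<^sub>R f p) \<le> indicator ?S p" for p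
      using assms by (auto simp: indicator_def)
  qed auto
  also have "\<dots> = 1" using S measure_unit_square by simp
  finally show ?thesis .
qed

text \<open>This is what boundedness of the cut distance rests on. For a pullback it follows from
  the values of the graphon alone.\<close>

definition unit_valued :: "(real \<Rightarrow> real \<Rightarrow> real) \<Rightarrow> bool" where
  "unit_valued g \<longleftrightarrow> (\<forall>x\<in>{0..1}. \<forall>y\<in>{0..1}. g x y \<in> {0..1})"

lemma unit_valued_graphon: "g \<in> graphons \<Longrightarrow> unit_valued g"
  by (simp add: graphons_def unit_valued_def)

lemma color_preserving_mapsD:
  assumes "\<sigma> \<in> color_preserving_maps k B" "x \<in> {0..1}"
  shows "\<sigma> x \<in> {0..1}"
  using assms measurable_space[of \<sigma> "lebesgue_on {0..1}" "lebesgue_on {0..1}" x]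
  by (simp add: color_preserving_maps_def)

lemma unit_valued_pullback:
  assumes "g \<in> graphons" "\<sigma> \<in> color_preserving_maps k B"
  shows "unit_valued (graphon_pullback g \<sigma>)"
  using unit_valued_graphon[OF assms(1)] color_preserving_mapsD[OF assms(2)]
  unfolding unit_valued_def graphon_pullback_def by blast

lemma unit_interval_subset: "C \<in> sets (lebesgue_on {0..1}) \<Longrightarrow> C \<subseteq> {0..1}"
  using sets.sets_into_space[of C "lebesgue_on {0..1}"] by simp

text \<open>A real \<open>SUP\<close> is known to dominate its terms once they are bounded above;
  here each integral is at most 1 in absolute value.\<close>

lemma cut_dist_ge:
  assumes g: "unit_valued g1" "unit_valued g2"
    and CD: "C \<in> sets (lebesgue_on {0..1})" "D \<in> sets (lebesgue_on {0..1})"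
  shows "(\<Sum>i\<in>{1..k}. \<Sum>j\<in>{1..k}. \<bar>LINT p : C \<times> D | lebesgue.
      indicator (B i \<times> B j) p * (g1 (fst p) (snd p) - g2 (fst p) (snd p))\<bar>) \<le> cut_dist k B g1 g2"
proof -
  have bound: "\<bar>LINT p : C \<times> D | lebesgue.
      indicator (B i \<times> B j) p * (g1 (fst p) (snd p) - g2 (fst p) (snd p))\<bar> \<le> 1"
    if "C \<in> sets (lebesgue_on {0..1})" "D \<in> sets (lebesgue_on {0..1})" for C D i j
  proof (rule abs_set_integral_unit_square_le)
    have CD: "C \<subseteq> {0..1}" "D \<subseteq> {0..1}" using that unit_interval_subset by auto
    then show "C \<times> D \<subseteq> {0..1} \<times> {0..1}" by auto
    fix p assume "p \<in> C \<times> D"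
    then have "fst p \<in> {0..1}" "snd p \<in> {0..1}" using CD by auto
    then have "g1 (fst p) (snd p) \<in> {0..1}" "g2 (fst p) (snd p) \<in> {0..1}"
      using g unfolding unit_valued_def by blast+
    then show "\<bar>indicator (B i \<times> B j) p * (g1 (fst p) (snd p) - g2 (fst p) (snd p))\<bar> \<le> 1"
      by (auto simp: indicator_def)
  qed
  have "bdd_above ((\<lambda>(C, D). \<Sum>i\<in>{1..k}. \<Sum>j\<in>{1..k}. \<bar>LINT p : C \<times> D | lebesgue.
      indicator (B i \<times> B j) p * (g1 (fst p) (snd p) - g2 (fst p) (snd p))\<bar>) `
      (sets (lebesgue_on {0..1}) \<times> sets (lebesgue_on {0..1})))"
    by (rule bdd_aboveI2[where M = "\<Sum>i\<in>{1..k}. \<Sum>j\<in>{1..k}. 1"])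
      (auto simp del: sum_constant intro!: sum_mono bound)
  from cSUP_upper[OF _ this, of "(C, D)"] CD show ?thesis
    by (simp add: cut_dist_def)
qed

lemma cut_dist_nonneg:
  assumes "unit_valued g1" "unit_valued g2"
  shows "0 \<le> cut_dist k B g1 g2"
  using cut_dist_ge[OF assms, where C = "{}" and D = "{}" and k = k and B = B] by (simp add: set_lebesgue_integral_def)

lemma cut_dist_self: "cut_dist k B g g = 0"
proof -
  have "sets (lebesgue_on {0..1 :: real}) \<noteq> {}" using sets.empty_sets by blast
  then show ?thesis
    by (simp add: cut_dist_def set_lebesgue_integral_def case_prod_beta)
qed

lemma cut_dist_cong_AE:
  assumes "AE p in lborel. p \<in> {0..1} \<times> {0..1} \<longrightarrow> g2 (fst p) (snd p) = g2' (fst p) (snd p)"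
  shows "cut_dist k B g1 g2 = cut_dist k B g1 g2'"
proof -
  have "(LINT p : C \<times> D | lebesgue. indicator (B i \<times> B j) p * (g1 (fst p) (snd p) - g2 (fst p) (snd p))) =
      (LINT p : C \<times> D | lebesgue. indicator (B i \<times> B j) p * (g1 (fst p) (snd p) - g2' (fst p) (snd p)))"
    if "C \<in> sets (lebesgue_on {0..1})" "D \<in> sets (lebesgue_on {0..1})" for C D i j
    unfolding set_lebesgue_integral_def
  proof (rule completion.integral_cong_AE')
    show "AE p in lebesgue. indicator (C \<times> D) p *\<^sub>R (indicator (B i \<times> B j) p * (g1 (fst p) (snd p) - g2 (fst p) (snd p))) =
      indicator (C \<times> D) p *\<^sub>R (indicator (B i \<times> B j) p * (g1 (fst p) (snd p) - g2' (fst p) (snd p)))"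
      using AE_completion[OF assms]
    proof eventually_elim
      case (elim p)
      then show ?case
        using unit_interval_subset[OF that(1)] unit_interval_subset[OF that(2)]
        by (cases "p \<in> C \<times> D") auto
    qed
  qed
  then show ?thesis
    unfolding cut_dist_def by (intro SUP_cong refl) auto
qed

lemma id_color_preserving:
  assumes "\<And>i. i \<in> {1..k} \<Longrightarrow> B i \<subseteq> {0..1}"
  shows "(\<lambda>x. x) \<in> color_preserving_maps k B"
proof -
  have "emeasure lebesgue (sym_diff ((\<lambda>x. x) -` B i \<inter> {0..1}) (B i)) = 0" if "i \<in> {1..k}" for i
  proof -
    have "sym_diff ((\<lambda>x. x) -` B i \<inter> {0..1}) (B i) = {}"
      using assms[OF that] by auto
    then show ?thesis by (simp only: emeasure_empty)
  qed
  then show ?thesis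
    unfolding color_preserving_maps_def by (intro CollectI conjI ballI) (simp_all add: distr_id2)
qed

lemma delta_cut_self:
  assumes g: "g \<in> graphons" and B: "\<And>i. i \<in> {1..k} \<Longrightarrow> B i \<subseteq> {0..1}"
  shows "delta_cut k B g g = 0"
proof (rule antisym)
  have nn: "0 \<le> cut_dist k B g (graphon_pullback g \<sigma>)" if "\<sigma> \<in> color_preserving_maps k B" for \<sigma>
    by (rule cut_dist_nonneg[OF unit_valued_graphon[OF g] unit_valued_pullback[OF g that]])
  note id = id_color_preserving[of k B, OF B]
  have "delta_cut k B g g \<le> cut_dist k B g (graphon_pullback g (\<lambda>x. x))"
    unfolding delta_cut_def by (rule cINF_lower[OF bdd_belowI2[of _ 0] id]) (rule nn)
  also have "\<dots> = 0" by (simp add: graphon_pullback_def cut_dist_self)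
  finally show "delta_cut k B g g \<le> 0" .
  show "0 \<le> delta_cut k B g g"
    unfolding delta_cut_def using id by (intro cINF_greatest nn) auto
qed

section \<open>Color preserving maps\<close>

context block_partition begin

text \<open>0 lies outside \<open>[k]\<close>, so \<open>cell 0\<close> has its default value and
  \<open>\<mu> 0\<close> can stand for the uniform law on the unit interval.\<close>

lemma \<mu>_unit: "\<mu> 0 = uniform_measure lborel {0..1}"
  by (simp add: \<mu>_def cell_def)

lemma AE_unit_square:
  "(AE p in \<mu> 0 \<Otimes>\<^sub>M \<mu> 0. Q p) \<longleftrightarrow> (AE p in lborel. p \<in> {0..1} \<times> {0..1} \<longrightarrow> Q p)"
proof -
  have "cell 0 = {0..1}" by (simp add: cell_def)
  then show ?thesis
    unfolding pair_\<mu> using emeasure_cell_times_nontrivial[of 0 0]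
    by (subst AE_uniform_measure) (auto simp: less_top)
qed

text \<open>Altering \<sigma> on a null set changes preimages by null sets only, so preservation of
  measure and colors passes to a Borel version. Borel maps can then be combined to a map of the
  square that respects product measures.\<close>

lemma color_preserving_borel_version:
  assumes \<sigma>: "\<sigma> \<in> color_preserving_maps k B"
  shows "\<exists>s\<in>borel_measurable borel. (\<forall>x. s x \<in> {0..1}) \<and> (AE x in \<mu> 0. \<sigma> x = s x) \<and>
    distr (\<mu> 0) borel s = \<mu> 0 \<and> (\<forall>i\<in>{1..k}. AE x in \<mu> 0. s x \<in> B i \<longleftrightarrow> x \<in> B i)"
proof -
  let ?L = "lebesgue_on {0..1} :: real measure"
  have \<sigma>_meas: "\<sigma> \<in> ?L \<rightarrow>\<^sub>M ?L" and \<sigma>_distr: "distr ?L ?L \<sigma> = ?L"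
    and \<sigma>_B: "\<And>i. i \<in> {1..k} \<Longrightarrow> emeasure lebesgue (sym_diff (\<sigma> -` B i \<inter> {0..1}) (B i)) = 0"
    using \<sigma> by (auto simp: color_preserving_maps_def)
  have unit: "{0..1} \<in> sets (lebesgue :: real measure)" by simp
  have AE_unit: "(AE x in \<mu> 0. Q x) \<longleftrightarrow> (AE x in lborel. x \<in> {0..1} \<longrightarrow> Q x)" for Q
    unfolding \<mu>_unit by (subst AE_uniform_measure) auto
  have "\<sigma> \<in> ?L \<rightarrow>\<^sub>M borel"
    by (rule measurable_compose[OF \<sigma>_meas, of "\<lambda>x. x"])
      (auto intro!: measurable_restrict_space1 measurable_completion)
  then have "(\<lambda>x. if x \<in> {0..1} then \<sigma> x else 0) \<in> borel_measurable lebesgue"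
    by (rule borel_measurable_if_I[OF _ unit])
  from completion_ex_borel_measurable_real[OF this] obtain s0 where s0: "s0 \<in> borel_measurable lborel"
    "AE x in lborel. (if x \<in> {0..1} then \<sigma> x else 0) = s0 x" by blast
  \<comment> \<open>Clamping keeps every value in the unit interval and changes nothing at points of
    that interval where \<open>s0\<close> equals \<sigma>.\<close>
  define s where "s x = max 0 (min 1 (s0 x))" for x
  have s: "s \<in> borel_measurable borel" "s x \<in> {0..1}" for x
    using s0(1) unfolding s_def by auto
  have "AE x in lborel. x \<in> {0..1} \<longrightarrow> \<sigma> x = s x"
    using s0(2)
  proof eventually_elim
    case (elim x)
    show ?case
    proof
      assume "x \<in> {0..1}"
      with color_preserving_mapsD[OF \<sigma> this] elim show "\<sigma> x = s x" by (auto simp: s_def)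
    qed
  qed
  note ae = this
  have "distr (\<mu> 0) borel s = \<mu> 0"
  proof (rule measure_eqI)
    fix A assume "A \<in> sets (distr (\<mu> 0) borel s)"
    then have A: "A \<in> sets borel" by simp
    have sA: "s -` A \<in> sets borel" using measurable_sets[OF s(1) A] by simp
    have uni: "emeasure (\<mu> 0) X = emeasure lebesgue ({0..1} \<inter> X)" if "X \<in> sets borel" for X
      unfolding \<mu>_unit using that by (simp add: divide_ennreal_def)
    \<comment> \<open>\<open>\<mu> 0\<close> is a measure on the whole line and \<open>?L\<close>
      one on the unit interval, so \<open>A\<close> is cut down; the values of \<open>s\<close> lie
      in that interval anyway.\<close>
    have A': "A \<inter> {0..1} \<in> sets ?L"
      using A by (auto simp: sets_restrict_space)
    have \<sigma>A: "\<sigma> -` (A \<inter> {0..1}) \<inter> {0..1} \<in> sets ?L"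
      using measurable_sets[OF \<sigma>_meas A'] by simp
    have "emeasure (distr (\<mu> 0) borel s) A = emeasure (\<mu> 0) (s -` A)"
      using s(1) A by (subst emeasure_distr) auto
    also have "\<dots> = emeasure lebesgue ({0..1} \<inter> s -` A)"
      by (rule uni[OF sA])
    also have "\<dots> = emeasure lebesgue (\<sigma> -` (A \<inter> {0..1}) \<inter> {0..1})"
    proof (rule emeasure_eq_AE)
      show "AE x in lebesgue. x \<in> {0..1} \<inter> s -` A \<longleftrightarrow> x \<in> \<sigma> -` (A \<inter> {0..1}) \<inter> {0..1}"
        using AE_completion[OF ae]
      proof eventually_elim
        case (elim x)
        then show ?case
          using color_preserving_mapsD[OF \<sigma>, of x] by (cases "0 \<le> x"; cases "x \<le> 1") simp_all
      qed
      show "{0..1} \<inter> s -` A \<in> sets lebesgue"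
        by (rule sets_completionI_sets) (simp add: sA sets.Int)
      show "\<sigma> -` (A \<inter> {0..1}) \<inter> {0..1} \<in> sets lebesgue"
        using \<sigma>A unit by (auto simp: sets_restrict_space_iff)
    qed
    also have "\<dots> = emeasure ?L (\<sigma> -` (A \<inter> {0..1}) \<inter> {0..1})"
      by (subst emeasure_restrict_space) auto
    also have "\<dots> = emeasure (distr ?L ?L \<sigma>) (A \<inter> {0..1})"
      using \<sigma>_meas A' by (subst emeasure_distr) auto
    also have "\<dots> = emeasure ?L (A \<inter> {0..1})" by (simp only: \<sigma>_distr)
    also have "\<dots> = emeasure lebesgue ({0..1} \<inter> A)"
      by (subst emeasure_restrict_space) (auto simp: Int_commute)
    also have "\<dots> = emeasure (\<mu> 0) A" by (rule uni[OF A, symmetric])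
    finally show "emeasure (distr (\<mu> 0) borel s) A = emeasure (\<mu> 0) A" .
  qed simp
  moreover have "AE x in \<mu> 0. s x \<in> B i \<longleftrightarrow> x \<in> B i" if i: "i \<in> {1..k}" for i
  proof -
    have "B i \<inter> {0..1} \<in> sets ?L" using B_borel[OF i] by (auto simp: sets_restrict_space)
    then have "B i \<in> sets ?L" using B_subset[OF i] by (simp add: Int_absorb2)
    then have "\<sigma> -` B i \<inter> {0..1} \<in> sets ?L"
      using measurable_sets[OF \<sigma>_meas] by fastforce
    then have "\<sigma> -` B i \<inter> {0..1} \<in> sets lebesgue"
      using unit by (auto simp: sets_restrict_space_iff)
    moreover have "B i \<in> sets lebesgue" using B_borel[OF i] by (intro sets_completionI_sets) simp
    ultimately have "sym_diff (\<sigma> -` B i \<inter> {0..1}) (B i) \<in> null_sets lebesgue"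
      using \<sigma>_B[OF i] by (auto simp: null_sets_def)
    then have "AE x in lebesgue. x \<notin> sym_diff (\<sigma> -` B i \<inter> {0..1}) (B i)"
      by (rule AE_not_in)
    then have "AE x in lborel. x \<notin> sym_diff (\<sigma> -` B i \<inter> {0..1}) (B i)"
      by (simp only: AE_completion_iff)
    with ae show ?thesis
      unfolding AE_unit by eventually_elim auto
  qed
  moreover have "AE x in \<mu> 0. \<sigma> x = s x" using ae by (simp only: AE_unit)
  ultimately show ?thesis using s by blast
qed

end

context block_problem begin

lemma measurable_pair_\<mu>: "measurable (\<mu> i \<Otimes>\<^sub>M \<mu> j) N = measurable (borel \<Otimes>\<^sub>M borel) N"
  by (intro measurable_cong_sets sets_pair_measure_cong) simp_all

lemma pair_pullback:
  assumes \<sigma>: "\<sigma> \<in> color_preserving_maps k B"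
  shows "\<exists>s\<in>borel_measurable borel. (\<forall>x. s x \<in> {0..1}) \<and>
    (\<lambda>p. (s (fst p), s (snd p))) \<in> (borel \<Otimes>\<^sub>M borel) \<rightarrow>\<^sub>M (borel \<Otimes>\<^sub>M borel) \<and>
    distr (\<mu> 0 \<Otimes>\<^sub>M \<mu> 0) (borel \<Otimes>\<^sub>M borel) (\<lambda>p. (s (fst p), s (snd p))) = \<mu> 0 \<Otimes>\<^sub>M \<mu> 0 \<and>
    (AE p in \<mu> 0 \<Otimes>\<^sub>M \<mu> 0. \<sigma> (fst p) = s (fst p) \<and> \<sigma> (snd p) = s (snd p)) \<and>
    (\<forall>i\<in>{1..k}. \<forall>j\<in>{1..k}. AE p in \<mu> 0 \<Otimes>\<^sub>M \<mu> 0.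
       (s (fst p), s (snd p)) \<in> B i \<times> B j \<longleftrightarrow> p \<in> B i \<times> B j)"
proof -
  interpret prob_space "\<mu> 0" by (rule prob_space_\<mu>)
  have sf: "sigma_finite_measure (\<mu> 0)" ..
  from color_preserving_borel_version[OF \<sigma>] obtain s where
    s: "s \<in> borel_measurable borel" "\<And>x. s x \<in> {0..1}" and
    eq: "AE x in \<mu> 0. \<sigma> x = s x" and distr: "distr (\<mu> 0) borel s = \<mu> 0" and
    sB: "\<And>i. i \<in> {1..k} \<Longrightarrow> AE x in \<mu> 0. s x \<in> B i \<longleftrightarrow> x \<in> B i" by blast
  have s\<mu>: "s \<in> \<mu> 0 \<rightarrow>\<^sub>M borel" using s(1) by (simp cong: measurable_cong_sets)
  show ?thesis
  proof (intro bexI[OF _ s(1)] conjI allI ballI)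
    show "s x \<in> {0..1}" for x by (rule s(2))
    show "(\<lambda>p. (s (fst p), s (snd p))) \<in> (borel \<Otimes>\<^sub>M borel) \<rightarrow>\<^sub>M (borel \<Otimes>\<^sub>M borel)"
      by (intro measurable_Pair measurable_compose[OF measurable_fst s(1)] measurable_compose[OF measurable_snd s(1)])
    show "distr (\<mu> 0 \<Otimes>\<^sub>M \<mu> 0) (borel \<Otimes>\<^sub>M borel) (\<lambda>p. (s (fst p), s (snd p))) = \<mu> 0 \<Otimes>\<^sub>M \<mu> 0"
      using pair_measure_distr[OF s\<mu> s\<mu>] sf unfolding distr by (simp add: case_prod_beta')
    have fst: "AE p in \<mu> 0 \<Otimes>\<^sub>M \<mu> 0. Q (fst p)" and snd: "AE p in \<mu> 0 \<Otimes>\<^sub>M \<mu> 0. Q (snd p)"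
      if "AE x in \<mu> 0. Q x" for Q
      by (rule AE_pair_fst[OF sf that], rule AE_pair_snd[OF sf that])
    show "AE p in \<mu> 0 \<Otimes>\<^sub>M \<mu> 0. \<sigma> (fst p) = s (fst p) \<and> \<sigma> (snd p) = s (snd p)"
      using fst[OF eq] snd[OF eq] by eventually_elim simp
    show "AE p in \<mu> 0 \<Otimes>\<^sub>M \<mu> 0. (s (fst p), s (snd p)) \<in> B i \<times> B j \<longleftrightarrow> p \<in> B i \<times> B j"
      if "i \<in> {1..k}" "j \<in> {1..k}" for i j
      using fst[OF sB[OF that(1)]] snd[OF sB[OF that(2)]]
      by eventually_elim (simp add: mem_Times_iff)
  qed
qed

section \<open>Null sets and block graphons under the cut distance\<close>

text \<open>Acting by \<sigma> on both coordinates preserves the uniform law of the square, so the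
  null set where \<open>r\<close> and \<open>r'\<close> differ pulls back to a null set for every
  \<sigma>.\<close>

lemma delta_cut_cong_AE:
  assumes "AE p in lborel. p \<in> {0..1} \<times> {0..1} \<longrightarrow> r (fst p) (snd p) = r' (fst p) (snd p)"
  shows "delta_cut k B g r = delta_cut k B g r'"
proof -
  have ae: "AE p in \<mu> 0 \<Otimes>\<^sub>M \<mu> 0. r (fst p) (snd p) = r' (fst p) (snd p)"
    using assms by (simp only: AE_unit_square)
  have "cut_dist k B g (graphon_pullback r \<sigma>) = cut_dist k B g (graphon_pullback r' \<sigma>)"
    if \<sigma>: "\<sigma> \<in> color_preserving_maps k B" for \<sigma>
  proof (rule cut_dist_cong_AE)
    from pair_pullback[OF \<sigma>] obtain s where
      s: "(\<lambda>p. (s (fst p), s (snd p))) \<in> (borel \<Otimes>\<^sub>M borel) \<rightarrow>\<^sub>M (borel \<Otimes>\<^sub>M borel)"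
      "distr (\<mu> 0 \<Otimes>\<^sub>M \<mu> 0) (borel \<Otimes>\<^sub>M borel) (\<lambda>p. (s (fst p), s (snd p))) = \<mu> 0 \<Otimes>\<^sub>M \<mu> 0"
      "AE p in \<mu> 0 \<Otimes>\<^sub>M \<mu> 0. \<sigma> (fst p) = s (fst p) \<and> \<sigma> (snd p) = s (snd p)" by blast
    have sm: "(\<lambda>p. (s (fst p), s (snd p))) \<in> (\<mu> 0 \<Otimes>\<^sub>M \<mu> 0) \<rightarrow>\<^sub>M (borel \<Otimes>\<^sub>M borel)"
      using s(1) by (simp only: measurable_pair_\<mu>)
    have "AE p in distr (\<mu> 0 \<Otimes>\<^sub>M \<mu> 0) (borel \<Otimes>\<^sub>M borel) (\<lambda>p. (s (fst p), s (snd p))).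
        r (fst p) (snd p) = r' (fst p) (snd p)"
      unfolding s(2) by (rule ae)
    from AE_distrD[OF sm this] s(3)
    have "AE p in \<mu> 0 \<Otimes>\<^sub>M \<mu> 0. graphon_pullback r \<sigma> (fst p) (snd p) = graphon_pullback r' \<sigma> (fst p) (snd p)"
      by eventually_elim (simp add: graphon_pullback_def)
    then show "AE p in lborel. p \<in> {0..1} \<times> {0..1} \<longrightarrow>
        graphon_pullback r \<sigma> (fst p) (snd p) = graphon_pullback r' \<sigma> (fst p) (snd p)"
      by (simp only: AE_unit_square)
  qed
  then show ?thesis
    unfolding delta_cut_def by (intro INF_cong refl)
qed

text \<open>A color preserving pullback of \<open>r\<close> tested on the pulled back sets looks like \<open>r\<close> tested on the
  original sets, because block graphons are invariant under the pullback.\<close>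

lemma block_graphon_test_le:
  assumes c: "c \<in> C_sym k" and r: "r \<in> graphons" and rg: "borel_version r g"
    and \<sigma>: "\<sigma> \<in> color_preserving_maps k B" and ij: "i \<in> {1..k}" "j \<in> {1..k}"
    and CD: "C \<in> sets borel" "D \<in> sets borel"
  shows "\<bar>\<integral>p. indicator (C \<times> D) p * (indicator (B i \<times> B j) p *
      (block_graphon k B c (fst p) (snd p) - g (fst p) (snd p))) \<partial>(\<mu> 0 \<Otimes>\<^sub>M \<mu> 0)\<bar>
    \<le> cut_dist k B (block_graphon k B c) (graphon_pullback r \<sigma>)"
proof -
  let ?h = "block_graphon k B c"
  let ?\<Lambda> = "\<mu> 0 \<Otimes>\<^sub>M \<mu> 0"
  note v = block_graphon_version[OF c]
  from pair_pullback[OF \<sigma>] obtain s where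
    s: "s \<in> borel_measurable borel" "\<forall>x. s x \<in> {0..1}" and
    sm: "(\<lambda>p. (s (fst p), s (snd p))) \<in> (borel \<Otimes>\<^sub>M borel) \<rightarrow>\<^sub>M (borel \<Otimes>\<^sub>M borel)" and
    distr: "distr ?\<Lambda> (borel \<Otimes>\<^sub>M borel) (\<lambda>p. (s (fst p), s (snd p))) = ?\<Lambda>" and
    \<sigma>s: "AE p in ?\<Lambda>. \<sigma> (fst p) = s (fst p) \<and> \<sigma> (snd p) = s (snd p)" and
    sB: "\<forall>i\<in>{1..k}. \<forall>j\<in>{1..k}. AE p in ?\<Lambda>.
       (s (fst p), s (snd p)) \<in> B i \<times> B j \<longleftrightarrow> p \<in> B i \<times> B j" by blast
  define T where "T = (\<lambda>p. (s (fst p), s (snd p)))"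
  \<comment> \<open>The test with the pulled back sets \<open>C'\<close> and \<open>D'\<close> will
    turn out to have the integrand \<open>Y (T p)\<close> almost everywhere. As \<open>T\<close>
    preserves the uniform law, its integral is that of \<open>Y\<close>.\<close>
  define Y where "Y p = indicator (C \<times> D) p * (indicator (B i \<times> B j) p *
      (?h (fst p) (snd p) - g (fst p) (snd p)))" for p :: "real \<times> real"
  define C' where "C' = s -` C \<inter> {0..1}"
  define D' where "D' = s -` D \<inter> {0..1}"
  define X where "X p = indicator (B i \<times> B j) p *
      (?h (fst p) (snd p) - graphon_pullback r \<sigma> (fst p) (snd p))" for p
  have T\<Lambda>: "T \<in> ?\<Lambda> \<rightarrow>\<^sub>M (borel \<Otimes>\<^sub>M borel)"
    using sm unfolding T_def by (simp only: measurable_pair_\<mu>)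
  have Y: "Y \<in> borel_measurable (borel \<Otimes>\<^sub>M borel)"
    unfolding Y_def using CD B_borel[OF ij(1)] B_borel[OF ij(2)]
    by (intro borel_measurable_times borel_measurable_diff borel_measurable_indicator
        borel_version_measurable[OF v] borel_version_measurable[OF rg]) auto
  have "s -` C \<in> sets borel" "s -` D \<in> sets borel"
    using measurable_sets[OF s(1) CD(1)] measurable_sets[OF s(1) CD(2)] by simp_all
  then have "C' \<in> sets lborel" "D' \<in> sets lborel" by (simp_all add: C'_def D'_def sets.Int)
  then have "C' \<in> sets lebesgue" "D' \<in> sets lebesgue" by (blast intro: sets_completionI_sets)+
  then have CD': "C' \<in> sets (lebesgue_on {0..1})" "D' \<in> sets (lebesgue_on {0..1})"
    by (auto simp: sets_restrict_space_iff C'_def D'_def)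
  have cell0: "cell 0 \<times> cell 0 = {0..1} \<times> {0..1}" by (simp add: cell_def)
  \<comment> \<open>The domain is enlarged to the unit square, since it is the uniform law there
    that \<open>T\<close> preserves.\<close>
  have "(LINT p : C' \<times> D' | lebesgue. X p) =
      (LINT p : cell 0 \<times> cell 0 | lebesgue. indicator (C' \<times> D') p * X p)"
    unfolding set_lebesgue_integral_def cell0
    by (intro Bochner_Integration.integral_cong refl) (auto simp: indicator_def C'_def D'_def)
  also have "\<dots> = measure lborel (cell 0 \<times> cell 0) *
      integral\<^sup>L (uniform_measure lborel (cell 0 \<times> cell 0)) (\<lambda>p. Y (T p))"
  proof (rule set_integral_completion[OF _ emeasure_cell_times_nontrivial])
    show "cell 0 \<times> cell 0 \<in> sets lborel" by (simp add: borel_Times)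
    show "(\<lambda>p. Y (T p)) \<in> borel_measurable lborel"
      using measurable_compose[OF sm Y] by (simp add: T_def borel_prod)
    have rT: "AE p in ?\<Lambda>. r (fst (T p)) (snd (T p)) = g (fst (T p)) (snd (T p))"
    proof (rule AE_distrD[OF T\<Lambda>])
      show "AE p in distr ?\<Lambda> (borel \<Otimes>\<^sub>M borel) T. r (fst p) (snd p) = g (fst p) (snd p)"
        unfolding T_def distr by (rule AE_version_pair[OF rg])
    qed
    have S: "AE p in ?\<Lambda>. p \<in> {0..1} \<times> {0..1}" by (simp add: AE_unit_square)
    show "AE p in uniform_measure lborel (cell 0 \<times> cell 0). indicator (C' \<times> D') p * X p = Y (T p)"
      unfolding pair_\<mu>[symmetric]
      using \<sigma>s sB[rule_format, OF ij] rT S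
    proof eventually_elim
      case (elim p)
      have CDp: "p \<in> C' \<times> D' \<longleftrightarrow> T p \<in> C \<times> D"
        using elim(4) by (auto simp: C'_def D'_def T_def mem_Times_iff)
      have Bp: "T p \<in> B i \<times> B j \<longleftrightarrow> p \<in> B i \<times> B j"
        using elim(2) by (simp add: T_def)
      show ?case
      proof (cases "p \<in> B i \<times> B j")
        case True
        then have "?h (fst p) (snd p) = c i j" "?h (fst (T p)) (snd (T p)) = c i j"
          using Bp ij by (auto simp: block_graphon_eq mem_Times_iff)
        moreover have "graphon_pullback r \<sigma> (fst p) (snd p) = g (fst (T p)) (snd (T p))"
          using elim(1,3) by (simp add: graphon_pullback_def T_def)
        ultimately show ?thesis
          using CDp Bp True by (simp add: X_def Y_def indicator_def)
      next
        case False
        then show ?thesis using Bp by (simp add: X_def Y_def)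
      qed
    qed
  qed
  also have "measure lborel (cell 0 \<times> cell 0) = 1"
    using measure_unit_square by (simp add: cell0 borel_Times)
  also have "integral\<^sup>L (uniform_measure lborel (cell 0 \<times> cell 0)) (\<lambda>p. Y (T p)) = integral\<^sup>L ?\<Lambda> Y"
    unfolding pair_\<mu>[symmetric] integral_distr[OF T\<Lambda> Y, symmetric]
    unfolding T_def distr ..
  finally have eq: "(LINT p : C' \<times> D' | lebesgue. X p) = integral\<^sup>L ?\<Lambda> Y" by simp
  let ?t = "\<lambda>i j. \<bar>LINT p : C' \<times> D' | lebesgue. indicator (B i \<times> B j) p *
      (?h (fst p) (snd p) - graphon_pullback r \<sigma> (fst p) (snd p))\<bar>"
  have "\<bar>integral\<^sup>L ?\<Lambda> Y\<bar> = ?t i j"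
    unfolding eq[symmetric] X_def ..
  also have "\<dots> \<le> (\<Sum>j\<in>{1..k}. ?t i j)"
    using ij by (intro member_le_sum) auto
  also have "\<dots> \<le> (\<Sum>i\<in>{1..k}. \<Sum>j\<in>{1..k}. ?t i j)"
    using ij by (intro member_le_sum[where f = "\<lambda>i. \<Sum>j\<in>{1..k}. ?t i j"] sum_nonneg) auto
  also have "\<dots> \<le> cut_dist k B ?h (graphon_pullback r \<sigma>)"
    by (intro cut_dist_ge unit_valued_graphon[OF block_graphon_graphon[OF c]] unit_valued_pullback[OF r \<sigma>] CD')
  finally show ?thesis unfolding Y_def .
qed

text \<open>The left side in \<open>block_graphon_test_le\<close> does not contain \<sigma>, so it
  is bounded by the infimum, attained or not. Hence all rectangle tests against \<open>g\<close>
  vanish, and rectangles determine a function almost everywhere.\<close>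

lemma delta_cut_block_graphon_eq_0:
  assumes c: "c \<in> C_sym k" and r: "r \<in> graphons" and zero: "delta_cut k B (block_graphon k B c) r = 0"
  shows "AE p in lborel. p \<in> {0..1} \<times> {0..1} \<longrightarrow> r (fst p) (snd p) = block_graphon k B c (fst p) (snd p)"
proof -
  let ?h = "block_graphon k B c"
  let ?\<Lambda> = "\<mu> 0 \<Otimes>\<^sub>M \<mu> 0"
  note v = block_graphon_version[OF c]
  obtain g where rg: "borel_version r g" using borel_version_exists[OF r] by blast
  interpret \<Lambda>: prob_space ?\<Lambda>
    unfolding pair_\<mu> by (intro prob_space_uniform_measure emeasure_cell_times_nontrivial)
  have id: "color_preserving_maps k B \<noteq> {}"
    using id_color_preserving[of k B] B_subset by blast
  have block: "AE p in ?\<Lambda>. indicator (B i \<times> B j) p * ?h (fst p) (snd p) =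
      (indicator (B i \<times> B j) p * g (fst p) (snd p) :: real)"
    if ij: "i \<in> {1..k}" "j \<in> {1..k}" for i j
  proof (rule AE_eq_of_rectangles)
    have Bij: "B i \<times> B j \<in> sets (borel \<Otimes>\<^sub>M borel)"
      using B_borel[OF ij(1)] B_borel[OF ij(2)] by auto
    have int: "integrable ?\<Lambda> (\<lambda>p. indicator A p * (indicator (B i \<times> B j) p * u (fst p) (snd p)) :: real)"
      if "borel_version u' u" "A \<in> sets (borel \<Otimes>\<^sub>M borel)" for u' u A
    proof (rule \<Lambda>.integrable_const_bound[of _ 1])
      show "(\<lambda>p. indicator A p * (indicator (B i \<times> B j) p * u (fst p) (snd p)) :: real) \<in> borel_measurable ?\<Lambda>"
      proof -
        have "(\<lambda>p. indicator A p * (indicator (B i \<times> B j) p * u (fst p) (snd p)) :: real)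
            \<in> borel_measurable (borel \<Otimes>\<^sub>M borel)"
          using that Bij by (intro borel_measurable_times borel_measurable_indicator
              borel_version_measurable[OF that(1)]) auto
        then show ?thesis by (simp only: measurable_pair_\<mu>)
      qed
      show "AE p in ?\<Lambda>. norm (indicator A p * (indicator (B i \<times> B j) p * u (fst p) (snd p)) :: real) \<le> 1"
        using borel_version_range[OF that(1)] by (intro AE_I2) (auto simp: indicator_def)
    qed
    have UNIV: "UNIV \<in> sets ((borel :: real measure) \<Otimes>\<^sub>M (borel :: real measure))"
      using sets.top[of "(borel :: real measure) \<Otimes>\<^sub>M (borel :: real measure)"] by (simp add: space_pair_measure)
    show "integrable ?\<Lambda> (\<lambda>p. indicator (B i \<times> B j) p * ?h (fst p) (snd p) :: real)"
      "integrable ?\<Lambda> (\<lambda>p. indicator (B i \<times> B j) p * g (fst p) (snd p) :: real)"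
      using int[OF v UNIV] int[OF rg UNIV] by simp_all
    fix C D assume "C \<in> sets (\<mu> 0)" "D \<in> sets (\<mu> 0)"
    then have CD: "C \<in> sets borel" "D \<in> sets borel" by simp_all
    then have CDm: "C \<times> D \<in> sets (borel \<Otimes>\<^sub>M borel)" by auto
    have "\<bar>\<integral>p. indicator (C \<times> D) p * (indicator (B i \<times> B j) p *
        (?h (fst p) (snd p) - g (fst p) (snd p))) \<partial>?\<Lambda>\<bar> \<le> delta_cut k B ?h r"
      unfolding delta_cut_def by (intro cINF_greatest id block_graphon_test_le c r rg ij CD)
    then have "(\<integral>p. indicator (C \<times> D) p * (indicator (B i \<times> B j) p * ?h (fst p) (snd p)) -
        indicator (C \<times> D) p * (indicator (B i \<times> B j) p * g (fst p) (snd p)) \<partial>?\<Lambda>) = 0"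
      using zero by (simp add: right_diff_distrib)
    then show "(\<integral>p. indicator (C \<times> D) p * (indicator (B i \<times> B j) p * ?h (fst p) (snd p)) \<partial>?\<Lambda>) =
        (\<integral>p. indicator (C \<times> D) p * (indicator (B i \<times> B j) p * g (fst p) (snd p)) \<partial>?\<Lambda>)"
      by (subst (asm) Bochner_Integration.integral_diff[OF int[OF v CDm] int[OF rg CDm]]) simp
  qed (use borel_version_range[OF v] borel_version_range[OF rg] \<Lambda>.finite_measure_axioms in auto)
  have "AE p in ?\<Lambda>. \<forall>i\<in>{1..k}. \<forall>j\<in>{1..k}. indicator (B i \<times> B j) p * ?h (fst p) (snd p) =
      (indicator (B i \<times> B j) p * g (fst p) (snd p) :: real)"
    by (intro AE_finite_allI block) auto
  moreover have "AE p in ?\<Lambda>. p \<in> {0..1} \<times> {0..1}" by (simp add: AE_unit_square)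
  ultimately have "AE p in ?\<Lambda>. r (fst p) (snd p) = ?h (fst p) (snd p)"
    using AE_version_pair[OF rg]
  proof eventually_elim
    case (elim p)
    then obtain i j where ij: "i \<in> {1..k}" "fst p \<in> B i" "j \<in> {1..k}" "snd p \<in> B j"
      by (metis B_cases mem_Times_iff)
    then have "p \<in> B i \<times> B j" by (simp add: mem_Times_iff)
    moreover have "indicator (B i \<times> B j) p * ?h (fst p) (snd p) =
      (indicator (B i \<times> B j) p * g (fst p) (snd p) :: real)"
      using elim(1) ij by blast
    ultimately show ?case using elim(3) by simp
  qed
  then show ?thesis by (simp only: AE_unit_square)
qed

text \<open>The block graphon is a Borel version both of itself and of \<open>r\<close>, and the
  right side of \<open>objective_eq\<close> contains the version only.\<close>

lemma objective_AE_block_graphon: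
  assumes c: "c \<in> C_sym k"
    and ae: "AE p in lborel. p \<in> {0..1} \<times> {0..1} \<longrightarrow> r (fst p) (snd p) = block_graphon k B c (fst p) (snd p)"
  shows "objective r = \<Psi> c"
proof -
  note v = block_graphon_version[OF c]
  have "borel_version r (block_graphon k B c)"
    using v ae unfolding borel_version_def by blast
  from objective_eq[OF this] objective_eq[OF v] objective_block_graphon[OF c] show ?thesis by simp
qed

section \<open>Values on classes\<close>

text \<open>The graphon at which \<open>on_class\<close> evaluates a functional.\<close>

definition "representative G = fst (SOME r. r \<in> G)" for G :: "colored_graphon set"

text \<open>A class is the image of a single \<open>g\<close>, so its members are at distance 0 from
  \<open>g\<close>, in this order of the arguments. It contains \<open>g\<close> itself, so the
  choice operator does pick a member.\<close>

lemma representative: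
  assumes "G \<in> unlabeled_colored_graphons k B"
  obtains g where "g \<in> graphons" "G = delta_cut_rel k B `` {(g, B)}"
    "representative G \<in> graphons" "delta_cut k B g (representative G) = 0"
proof -
  from assms obtain g where g: "g \<in> graphons" "G = delta_cut_rel k B `` {(g, B)}"
    unfolding unlabeled_colored_graphons_def colored_graphons_def by (auto elim!: quotientE)
  have "(g, B) \<in> G"
    using g delta_cut_self[OF g(1) B_subset] by (simp add: delta_cut_rel_def colored_graphons_def)
  then have "(SOME r. r \<in> G) \<in> G" by (rule someI)
  then have "representative G \<in> graphons" "delta_cut k B g (representative G) = 0"
    using g(2) by (auto simp: representative_def delta_cut_rel_def colored_graphons_def)
  with g show thesis by (rule that)
qed

lemma objective_representative_le:
  assumes "G \<in> unlabeled_colored_graphons k B" "c \<in> maximizers"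
  shows "objective (representative G) \<le> \<Psi> c"
  using representative[OF assms(1)] borel_version_exists objective_le[OF _ assms(2)] by metis

text \<open>Whatever member is picked, it is at distance 0 from the block graphon and therefore
  equal to it almost everywhere.\<close>

lemma block_class:
  assumes c: "c \<in> C_sym k"
  defines "G \<equiv> delta_cut_rel k B `` {(block_graphon k B c, B)}"
  shows "G \<in> unlabeled_colored_graphons k B" "objective (representative G) = \<Psi> c"
proof -
  have bc: "block_graphon k B c \<in> graphons" by (rule block_graphon_graphon[OF c])
  then show "G \<in> unlabeled_colored_graphons k B"
    unfolding G_def unlabeled_colored_graphons_def colored_graphons_def by (intro quotientI) auto
  have "(block_graphon k B c, B) \<in> G"
    using bc delta_cut_self[OF bc B_subset] by (simp add: G_def delta_cut_rel_def colored_graphons_def)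
  then have "(SOME r. r \<in> G) \<in> G" by (rule someI)
  then have "representative G \<in> graphons" "delta_cut k B (block_graphon k B c) (representative G) = 0"
    by (auto simp: G_def representative_def delta_cut_rel_def colored_graphons_def)
  then show "objective (representative G) = \<Psi> c"
    using delta_cut_block_graphon_eq_0[OF c] objective_AE_block_graphon[OF c] by blast
qed

text \<open>The picked member equals a block graphon almost everywhere, and replacing one by the
  other does not affect the distance from \<open>g\<close>; so the block graphon lies in the same
  class.\<close>

lemma optimal_class:
  assumes G: "G \<in> unlabeled_colored_graphons k B" and c: "c \<in> maximizers"
    and opt: "\<Psi> c \<le> objective (representative G)"
  shows "\<exists>c\<in>C_sym k. (block_graphon k B c, B) \<in> G"
proof -
  from representative[OF G] obtain g where g: "g \<in> graphons" "G = delta_cut_rel k B `` {(g, B)}"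
    and r: "representative G \<in> graphons" "delta_cut k B g (representative G) = 0" by metis
  obtain g' where "borel_version (representative G) g'" using borel_version_exists[OF r(1)] by blast
  from optimal_block_constant[OF this c opt] obtain c' where c': "c' \<in> C_sym k"
    and ae: "AE p in lborel. p \<in> {0..1} \<times> {0..1} \<longrightarrow>
      representative G (fst p) (snd p) = block_graphon k B c' (fst p) (snd p)" by blast
  have "delta_cut k B g (block_graphon k B c') = 0"
    using delta_cut_cong_AE[OF ae, of g] r(2) by simp
  then have "(block_graphon k B c', B) \<in> G"
    using g block_graphon_graphon[OF c'] by (simp add: delta_cut_rel_def colored_graphons_def)
  with c' show ?thesis by blast
qed

end

theorem theorem2p14:
  fixes k :: nat and b :: "nat \<Rightarrow> real" and B :: "nat \<Rightarrow> real set"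
    and \<alpha> :: "nat \<Rightarrow> nat \<Rightarrow> nat \<Rightarrow> real" and h :: "nat \<Rightarrow> nat \<Rightarrow> real"
  assumes b_pos: "\<forall>i\<in>{1..k}. b i > 0"
    and b_sum: "(\<Sum>i\<in>{1..k}. b i) = 1"
    and B: "consecutive_intervals k b B"
    and \<alpha>_sym: "\<forall>i\<in>{1..k}. \<forall>j\<in>{1..k}. \<forall>l\<in>{1..k}.
                  \<alpha> i j l = \<alpha> i l j \<and> \<alpha> i j l = \<alpha> j i l \<and> \<alpha> i j l = \<alpha> j l i \<and>
                  \<alpha> i j l = \<alpha> l i j \<and> \<alpha> i j l = \<alpha> l j i"
    and h_sym: "\<forall>i\<in>{1..k}. \<forall>j\<in>{1..k}. h i j = h j i"
    and \<alpha>_nonneg: "\<forall>i\<in>{1..k}. \<forall>j\<in>{1..k}. \<forall>l\<in>{1..k}. \<alpha> i j l \<ge> 0"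
  defines "F \<equiv> \<lambda>G. on_class (energy_functional k B \<alpha> h) G
                     - 1 / 2 * on_class (entropy_functional k B) G"
    and "f \<equiv> \<lambda>c. 1 / 6 * (\<Sum>i\<in>{1..k}. \<Sum>j\<in>{1..k}. \<Sum>l\<in>{1..k}.
                              \<alpha> i j l * hom_dens B [i, j, l] triangle_graph (block_graphon k B c))
                 + 1 / 2 * (\<Sum>i\<in>{1..k}. \<Sum>j\<in>{1..k}.
                              h i j * hom_dens B [i, j] single_edge_graph (block_graphon k B c))
                 - 1 / 2 * entropy_functional k B (block_graphon k B c)"
  shows "(\<forall>G. is_arg_max F (\<lambda>G. G \<in> unlabeled_colored_graphons k B) G \<longrightarrow>
                (\<exists>c\<in>C_sym k. (block_graphon k B c, B) \<in> G))
       \<and> (SUP G \<in> unlabeled_colored_graphons k B. F G) = (SUP c \<in> C_sym k. f c)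
       \<and> (\<exists>c. is_arg_max f (\<lambda>c. c \<in> C_sym k) c)
       \<and> (\<forall>c. is_arg_max f (\<lambda>c. c \<in> C_sym k) c \<longrightarrow>
            (\<forall>i\<in>{1..k}. \<forall>j\<in>{1..k}.
               c i j = exp (h i j + (\<Sum>l\<in>{1..k}. b l * c i l * c j l * \<alpha> i j l))
                       / (1 + exp (h i j + (\<Sum>l\<in>{1..k}. b l * c i l * c j l * \<alpha> i j l)))))"
proof -
  interpret block_problem k b B \<alpha> h
  proof
    show "\<alpha> i l j = \<alpha> i j l \<and> \<alpha> j i l = \<alpha> i j l" if "i \<in> {1..k}" "j \<in> {1..k}" "l \<in> {1..k}" for i j l
      using \<alpha>_sym[rule_format, OF that] by simp
  qed (use b_pos B h_sym \<alpha>_nonneg in blast)+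
  have F_eq: "F G = objective (representative G)" for G
    by (simp add: F_def on_class_def objective_def representative_def)
  have f_eq: "f c = \<Psi> c" if "c \<in> C_sym k" for c
    using objective_block_graphon[OF that]
    by (simp only: f_def objective_def energy_functional_def)
  have arg_max_f: "is_arg_max f (\<lambda>c. c \<in> C_sym k) c \<longleftrightarrow> c \<in> maximizers" for c
    by (auto simp: is_arg_max_linorder maximizers_def f_eq)
  obtain c where c: "c \<in> maximizers"
    using block_objective_attains_max[of k b \<alpha> h] by (auto simp: maximizers_def)
  \<comment> \<open>The class of an optimal block graphon attains the upper bound. A maximizing
    class therefore has at least this value, which is the premise of
    \<open>optimal_class\<close>.\<close>
  define Gc where "Gc = delta_cut_rel k B `` {(block_graphon k B c, B)}"
  have Gc: "Gc \<in> unlabeled_colored_graphons k B" "F Gc = \<Psi> c"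
    using block_class[of c] c by (simp_all add: Gc_def F_eq maximizers_def)
  have 1: "\<exists>c\<in>C_sym k. (block_graphon k B c, B) \<in> G"
    if "is_arg_max F (\<lambda>G. G \<in> unlabeled_colored_graphons k B) G" for G
  proof (rule optimal_class[OF _ c])
    show "G \<in> unlabeled_colored_graphons k B" using that by (simp add: is_arg_max_def)
    have "F Gc \<le> F G" using that Gc(1) by (auto simp: is_arg_max_linorder)
    then show "\<Psi> c \<le> objective (representative G)" using Gc(2) by (simp add: F_eq)
  qed
  have 2: "(SUP G \<in> unlabeled_colored_graphons k B. F G) = \<Psi> c"
  proof (rule cSup_eq_maximum)
    show "\<Psi> c \<in> F ` unlabeled_colored_graphons k B"
      using Gc by (intro image_eqI[of _ _ Gc]) simp_all
    show "x \<le> \<Psi> c" if "x \<in> F ` unlabeled_colored_graphons k B" for x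
      using that objective_representative_le[OF _ c] by (auto simp: F_eq)
  qed
  have 3: "(SUP c \<in> C_sym k. f c) = \<Psi> c"
  proof (rule cSup_eq_maximum)
    show "\<Psi> c \<in> f ` C_sym k"
      using c by (intro image_eqI[of _ _ c]) (simp_all add: f_eq maximizers_def)
    show "x \<le> \<Psi> c" if "x \<in> f ` C_sym k" for x
      using that c by (auto simp: f_eq maximizers_def)
  qed
  have 4: "is_arg_max f (\<lambda>c. c \<in> C_sym k) c" using c by (simp add: arg_max_f)
  have 5: "\<forall>i\<in>{1..k}. \<forall>j\<in>{1..k}.
      c i j = exp (h i j + (\<Sum>l\<in>{1..k}. b l * c i l * c j l * \<alpha> i j l))
        / (1 + exp (h i j + (\<Sum>l\<in>{1..k}. b l * c i l * c j l * \<alpha> i j l)))"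
    if "is_arg_max f (\<lambda>c. c \<in> C_sym k) c" for c
    using maximizer_logistic that unfolding arg_max_f by blast
  show ?thesis
  proof (intro conjI)
    show "\<exists>c. is_arg_max f (\<lambda>c. c \<in> C_sym k) c" by (rule exI, rule 4)
    show "(SUP G \<in> unlabeled_colored_graphons k B. F G) = (SUP c \<in> C_sym k. f c)"
      unfolding 2 3 ..
  qed (intro allI impI 1 5, assumption)+
qed

end
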